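(* Let $K\ge 1$ be fixed. There is a constant $c>0$ such that the following holds. Let $N$ and $m_1$ be powers of two, $\epsilon\in(0,1/9)$, $\delta\in(0,1)$, and $a_i\ge 1$ for $i=1,\dots,K$. If $r\ge c\,\epsilon^{-2}[d+\log(N/\delta)]\log(ed/\delta)$ and $m_1>r$, then, with probability at least $1-2\delta$ (over the sketching matrices), for every $i=1,\dots,K$, $$\mathbb{E}\|X(\beta_{a_i}^{i}-\beta)\|\le \theta^{a_i}\,\mathbb{E}\|X(\beta_0^{i}-\beta)\|+(1+\theta^{a_i})\,\delta_i,\qquad \theta=\tfrac14 .$$
   Context: Model. $X\in\mathbb{R}^{N\times d}$ has full column rank, $N\gg d$, and $Y=X\beta+\zeta\in\mathbb{R}^N$, where $\beta\in\mathbb{R}^d$ is the true parameter and $\zeta$ is a zero-mean noise vector with covariance $\sigma^2 I_N$, independent of the sketching matrices. $\|\cdot\|$ is the Euclidean norm (spectral norm for matrices); logarithms are natural. $\mathbb{E}$ is expectation with respect to the noise $\zeta$ only (sketches held fixed); probabilities are over the sketching matrices. Sketches. An SRHT matrix of size $m\times N$ ($N$ a power of two) is $S=\sqrt{N/m}\,(HDP)_{\mathcal I,:}$, where $H$ is the normalized $N\times N$ Walsh–Hadamard matrix, $D$ is a diagonal matrix of independent Rademacher signs, $P$ is a random permutation matrix, and $\mathcal I$ is a uniformly sampled set of $m$ row indices. Let $d<m_1<\dots<m_K<N$ with $m_{i}=2m_{i-1}$ for $i\ge 2$. The sketches $S_i=\sqrt{N/m_i}\,(HDP)_{\mathcal I_i,:}\in\mathbb{R}^{m_i\times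 N}$ share the same $H,D,P$ and use nested random index sets $\mathcal I_1\subset\dots\subset\mathcal I_K$, $|\mathcal I_i|=m_i$, each $\mathcal I_i$ being a uniformly sampled set of $m_i$ row indices. $\widehat S\in\mathbb{R}^{r\times N}$ is an SRHT matrix independent of the $S_i$, and $\widehat H=(\widehat SX)^\top\widehat SX$. Estimators. $\tilde\beta^i=\arg\min_{u\in\mathbb{R}^d}\frac12\|S_iXu-S_iY\|^2$ and $\delta_i=\mathbb{E}\|X(\tilde\beta^i-\beta)\|$. PCG. $\mathrm{PCG}(A,b,\widehat H,\beta_{\rm init},a)$ is the iterate obtained after $a$ iterations (exact arithmetic) of the conjugate gradient method preconditioned by $\widehat H$ for $\min_u\frac12\|Au-b\|^2$ started at $\beta_{\rm init}$, i.e. $\widehat H^{-1/2}$ times the $a$-th CG iterate for the system $\widehat H^{-1/2}A^\top A\widehat H^{-1/2}\check u=\widehat H^{-1/2}A^\top b$ started at $\widehat H^{1/2}\beta_{\rm init}$ (if CG reaches the exact solution, subsequent iterates stay there). SPCG iterates. Given an initial $\beta_0\in\mathbb{R}^d$ and integers $a_1,\dots,a_K$, the $j$-th iterate of the $i$-th subproblem is $\beta_j^i=\mathrm{PCG}(S_iX,S_iY,\widehat H,\beta_0^i,j)$, with warm starts $\beta_0^1=\beta_0$ and $\beta_0^i=\beta_{a_{i-1}}^{i-1}$ for $i\ge2$. *)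

theory Defs
  imports
    "HOL-Probability.Probability"
    "Jordan_Normal_Form.Gauss_Jordan_Elimination"
    "Jordan_Normal_Form.DL_Rank"
    "Jordan_Normal_Form.DL_Submatrix"
begin

text \<open>
  All dimensions vary under the scope of a single constant, so vectors and matrices are those of
  \<open>Jordan_Normal_Form\<close>, with dimensions as natural numbers. Rows and columns are numbered from 0,
  subproblems from 1.
\<close>

definition eucl_norm :: "real Matrix.vec \<Rightarrow> real" where
  "eucl_norm v = sqrt (scalar_prod v v)"

section \<open>Subsampled randomized Hadamard transforms\<close>

text \<open>
  The normalized Walsh-Hadamard matrix of size \<open>2 ^ n\<close>, in Sylvester's row order. Other orders
  of rows and columns yield the same distributions of sketches, since the sampled rows and the
  permutation are uniform.
\<close>

fun walsh_hadamard :: "nat \<Rightarrow> real mat" where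
  "walsh_hadamard 0 = 1\<^sub>m 1"
| "walsh_hadamard (Suc n) =
     (let H = walsh_hadamard n in (1 / sqrt 2) \<cdot>\<^sub>m four_block_mat H H H (- H))"

definition permutation_matrix :: "nat \<Rightarrow> (nat \<Rightarrow> nat) \<Rightarrow> real mat" where
  "permutation_matrix N p = Matrix.mat N N (\<lambda>(i, j). if j = p i then 1 else 0)"

text \<open>
  A pair \<open>(s, p)\<close> of a sign vector and a permutation encodes the pair of matrices \<open>(D, P)\<close>.
\<close>

type_synonym sign_perm = "(nat \<Rightarrow> real) \<times> (nat \<Rightarrow> nat)"

fun srht :: "nat \<Rightarrow> nat \<Rightarrow> sign_perm \<Rightarrow> nat set \<Rightarrow> real mat" where
  "srht n m (s, p) I =
     sqrt (2 ^ n / real m) \<cdot>\<^sub>m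
       submatrix (walsh_hadamard n * mat_diag (2 ^ n) s * permutation_matrix (2 ^ n) p) I UNIV"

definition sign_perm_law :: "nat \<Rightarrow> sign_perm pmf" where
  "sign_perm_law N =
     pair_pmf (Pi_pmf {..<N} 1 (\<lambda>_. pmf_of_set {- 1, 1})) (pmf_of_set {p. p permutes {..<N}})"

definition index_law :: "nat \<Rightarrow> nat \<Rightarrow> nat set pmf" where
  "index_law N m = pmf_of_set {I. I \<subseteq> {..<N} \<and> card I = m}"

text \<open>
  Only nestedness and the laws of the single index sets are prescribed, not their joint law.
\<close>

definition nested_index_law :: "nat \<Rightarrow> nat \<Rightarrow> (nat \<Rightarrow> nat) \<Rightarrow> (nat \<Rightarrow> nat set) pmf \<Rightarrow> bool" where
  "nested_index_law N K m \<tau> \<longleftrightarrow>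
     (\<forall>I \<in> set_pmf \<tau>. \<forall>i \<in> {1..<K}. I i \<subset> I (Suc i)) \<and>
     (\<forall>i \<in> {1..K}. map_pmf (\<lambda>I. I i) \<tau> = index_law N (m i))"

text \<open>
  Joint law of the data of the sketches: one pair \<open>(D, P)\<close> shared by all the nested sketches,
  their index sets (with law \<open>\<tau>\<close>), and the pair and the index set of the sketch of size \<open>r\<close>
  that defines the preconditioner, all independent.
\<close>

definition sketch_law ::
  "nat \<Rightarrow> nat \<Rightarrow> (nat \<Rightarrow> nat set) pmf \<Rightarrow>
     (sign_perm \<times> (nat \<Rightarrow> nat set) \<times> sign_perm \<times> nat set) pmf" where
  "sketch_law N r \<tau> =
     pair_pmf (sign_perm_law N) (pair_pmf \<tau> (pair_pmf (sign_perm_law N) (index_law N r)))"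

section \<open>Noise\<close>

text \<open>
  Expectations over the noise depend only on its distribution \<open>\<nu>\<close>, which is taken as a measure on
  the coordinate functions on \<open>{..<N}\<close>; \<open>Matrix.vec N z\<close> is the noise vector at the outcome \<open>z\<close>.
  Square integrability makes all the integrals below meaningful.
\<close>

definition isotropic_noise :: "nat \<Rightarrow> real \<Rightarrow> (nat \<Rightarrow> real) measure \<Rightarrow> bool" where
  "isotropic_noise N \<sigma> \<nu> \<longleftrightarrow>
     prob_space \<nu> \<and> sets \<nu> = sets (Pi\<^sub>M {..<N} (\<lambda>_. borel)) \<and>
     (\<forall>i<N. integrable \<nu> (\<lambda>z. (z i)\<^sup>2)) \<and>
     (\<forall>i<N. (\<integral>z. z i \<partial>\<nu>) = 0) \<and>
     (\<forall>i<N. \<forall>j<N. (\<integral>z. z i * z j \<partial>\<nu>) = (if i = j then \<sigma>\<^sup>2 else 0))"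

section \<open>Least squares and preconditioned conjugate gradients\<close>

definition least_squares :: "real mat \<Rightarrow> real Matrix.vec \<Rightarrow> real Matrix.vec" where
  "least_squares A b =
     arg_min_on (\<lambda>u. 1 / 2 * (eucl_norm (A *\<^sub>v u - b))\<^sup>2) (carrier_vec (dim_col A))"

text \<open>
  The triple consists of the iterate, the residual and the search direction of the conjugate
  gradient method for \<open>B u = g\<close> started at \<open>u0\<close>.
\<close>

primrec cg_state ::
  "real mat \<Rightarrow> real Matrix.vec \<Rightarrow> real Matrix.vec \<Rightarrow> nat \<Rightarrow>
     real Matrix.vec \<times> real Matrix.vec \<times> real Matrix.vec" where
  "cg_state B g u0 0 = (let r = g - B *\<^sub>v u0 in (u0, r, r))"
| "cg_state B g u0 (Suc k) =
     (let (u, r, p) = cg_state B g u0 k in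
      if r = 0\<^sub>v (dim_vec r) then (u, r, p)
      else
        let \<alpha> = scalar_prod r r / scalar_prod p (B *\<^sub>v p);
            r' = r - \<alpha> \<cdot>\<^sub>v (B *\<^sub>v p);
            \<gamma> = scalar_prod r' r' / scalar_prod r r
        in (u + \<alpha> \<cdot>\<^sub>v p, r', r' + \<gamma> \<cdot>\<^sub>v p))"

definition cg :: "real mat \<Rightarrow> real Matrix.vec \<Rightarrow> real Matrix.vec \<Rightarrow> nat \<Rightarrow> real Matrix.vec" where
  "cg B g u0 a = fst (cg_state B g u0 a)"

definition psd_sqrt :: "real mat \<Rightarrow> real mat" where
  "psd_sqrt H =
     (THE R. R \<in> carrier_mat (dim_row H) (dim_row H) \<and> transpose_mat R = R \<and>
             (\<forall>v \<in> carrier_vec (dim_row H). scalar_prod v (R *\<^sub>v v) \<ge> 0) \<and> R * R = H)"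

text \<open>Meaningful for a symmetric positive definite preconditioner \<open>H\<close> only.\<close>

definition pcg ::
  "real mat \<Rightarrow> real Matrix.vec \<Rightarrow> real mat \<Rightarrow> real Matrix.vec \<Rightarrow> nat \<Rightarrow> real Matrix.vec" where
  "pcg A b H u0 a =
     (let R = psd_sqrt H; R' = the (mat_inverse R) in
      R' *\<^sub>v cg (R' * (transpose_mat A * A) * R') (R' *\<^sub>v (transpose_mat A *\<^sub>v b)) (R *\<^sub>v u0) a)"

text \<open>
  \<open>spcg_start S H X Y \<beta>0 a i\<close> is the starting point of the \<open>i\<close>-th subproblem; the value at
  \<open>i = 0\<close> is a dummy.
\<close>

fun spcg_start ::
  "(nat \<Rightarrow> real mat) \<Rightarrow> real mat \<Rightarrow> real mat \<Rightarrow> real Matrix.vec \<Rightarrow> real Matrix.vec \<Rightarrow>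
     (nat \<Rightarrow> nat) \<Rightarrow> nat \<Rightarrow> real Matrix.vec" where
  "spcg_start S H X Y \<beta>0 a 0 = \<beta>0"
| "spcg_start S H X Y \<beta>0 a (Suc 0) = \<beta>0"
| "spcg_start S H X Y \<beta>0 a (Suc (Suc i)) =
     pcg (S (Suc i) * X) (S (Suc i) *\<^sub>v Y) H (spcg_start S H X Y \<beta>0 a (Suc i)) (a (Suc i))"

definition spcg_iterate ::
  "(nat \<Rightarrow> real mat) \<Rightarrow> real mat \<Rightarrow> real mat \<Rightarrow> real Matrix.vec \<Rightarrow> real Matrix.vec \<Rightarrow>
     (nat \<Rightarrow> nat) \<Rightarrow> nat \<Rightarrow> nat \<Rightarrow> real Matrix.vec" where
  "spcg_iterate S H X Y \<beta>0 a i j =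
     pcg (S i * X) (S i *\<^sub>v Y) H (spcg_start S H X Y \<beta>0 a i) j"

text \<open>
  Expected prediction error of an estimator \<open>b\<close> that maps the response vector to \<open>real ^ d\<close>.
\<close>

definition prediction_error ::
  "(nat \<Rightarrow> real) measure \<Rightarrow> real mat \<Rightarrow> real Matrix.vec \<Rightarrow>
     (real Matrix.vec \<Rightarrow> real Matrix.vec) \<Rightarrow> real" where
  "prediction_error \<nu> X \<beta> b =
     (\<integral>z. eucl_norm (X *\<^sub>v (b (X *\<^sub>v \<beta> + Matrix.vec (dim_row X) z) - \<beta>)) \<partial>\<nu>)"

end

theory Submission
  imports Defs
begin

text \<open>
  Everything rests on one event: every sketch changes the squared norms of the vectors \<open>X v\<close> by a
  relative error of at most \<open>1 / 100\<close>.

  On this event, the sketched problems, preconditioned by \<open>H\<close>, have all their eigenvalues between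
  \<open>99 / 101\<close> and \<open>101 / 99\<close>. A conjugate gradient step decreases the energy of the error at least as
  much as a steepest descent step from the same iterate, so it multiplies the energy by at most
  \<open>1 - (99 / 101)\<^sup>2 = 400 / 10201\<close> (\<open>cg_error_bound\<close>). The change from the energy to
  the squared norm of \<open>X v\<close> and back costs a factor \<open>101 / 99\<close> once; as at least one step is made, this
  leaves a contraction by \<open>1 / 4\<close> per step towards the solution of the sketched least squares problem
  (\<open>pcg_contraction\<close>). The triangle inequality yields the inequality of the theorem at each outcome of
  the noise, and it can be integrated: the iterates are measurable, because a conjugate gradient step
  consists of rational operations and one case distinction, and the errors are integrable, because
  the error of the sketched least squares solution is at most a multiple of the norm of the
  sketched noise (\<open>spcg_prediction_errors\<close>).

  It remains to show that a single sketch with at least a multiple of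
  \<open>K\<^sup>2 (d + ln (N / \<delta>)) ln (e d / \<delta>)\<close> rows fails with probability at most \<open>\<delta> / K\<close>
  (\<open>srht_embedding_prob\<close>); a union bound over the \<open>K + 1\<close> sketches finishes the proof. Replace \<open>X\<close> by a
  matrix \<open>U\<close> with orthonormal columns and the same range, and let \<open>x\<^sub>i\<close> be the rows of \<open>H D P U\<close>. Both
  steps compare consecutive even moments of a random quantity that is perturbed in one place.

  \<^item> Each \<open>x\<^sub>i\<close> is, up to the factor \<open>1 / sqrt N\<close>, a sum of vectors \<open>u\<^sub>j\<close> with random signs, where the
    matrices \<open>u\<^sub>j u\<^sub>j\<^sup>T\<close> sum to the identity. Flipping one sign at a time shows
    that the moment of order \<open>2 p + 2\<close> of the norm of this sum is at most \<open>d + 4 p\<close> times the moment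
    of order \<open>2 p\<close> (\<open>rsq_moment_Suc_le\<close>). Hence all rows have squared norms \<open>O((d + ln (N / \<delta>)) / N)\<close>.

  \<^item> Let \<open>Y\<close> be the sum of the matrices \<open>x\<^sub>i x\<^sub>i\<^sup>T\<close> over the sampled indices minus its mean. Exchanging
    a random sampled index with a random other one gives a matrix \<open>Y'\<close> such that
    \<open>(Y, Y')\<close> is exchangeable and the conditional mean of \<open>Y - Y'\<close> is a multiple of \<open>Y\<close>. This is
    the method of exchangeable pairs of Stein, in the matrix form of Mackey, Jordan, Chen, Farrell and Tropp. It
    bounds the expected trace of \<open>Y\<close> to the power \<open>2 p + 2\<close> by a multiple of that of \<open>Y\<close> to the
    power \<open>2 p\<close> (\<open>moment_Suc_le\<close>). Markov's inequality with \<open>p\<close> of the order \<open>ln (d / \<delta>)\<close> then bounds the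
    spectral norm of \<open>Y\<close> (\<open>prob_distorted_le\<close>).
\<close>

section \<open>Algebra of square matrices as functions\<close>

text \<open>
  Real \<open>d \<times> d\<close> matrices are represented by functions on all pairs of indices of which only the
  entries below \<open>d\<close> matter. Products are then associative and distributive without side conditions;
  only the identity requires that the entries outside vanish (\<open>supp\<close>).
\<close>

definition mm :: "nat \<Rightarrow> (nat \<Rightarrow> nat \<Rightarrow> real) \<Rightarrow> (nat \<Rightarrow> nat \<Rightarrow> real) \<Rightarrow> nat \<Rightarrow> nat \<Rightarrow> real" where
  "mm d A B = (\<lambda>i j. \<Sum>k<d. A i k * B k j)"

definition frob :: "nat \<Rightarrow> (nat \<Rightarrow> nat \<Rightarrow> real) \<Rightarrow> (nat \<Rightarrow> nat \<Rightarrow> real) \<Rightarrow> real" where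
  "frob d A B = (\<Sum>i<d. \<Sum>j<d. A i j * B i j)"

definition symm :: "(nat \<Rightarrow> nat \<Rightarrow> real) \<Rightarrow> bool" where
  "symm A \<longleftrightarrow> (\<forall>i j. A i j = A j i)"

definition supp :: "nat \<Rightarrow> (nat \<Rightarrow> nat \<Rightarrow> real) \<Rightarrow> bool" where
  "supp d A \<longleftrightarrow> (\<forall>i j. d \<le> i \<or> d \<le> j \<longrightarrow> A i j = 0)"

definition idm :: "nat \<Rightarrow> nat \<Rightarrow> nat \<Rightarrow> real" where
  "idm d i j = (if i = j \<and> i < d then 1 else 0)"

primrec mpow :: "nat \<Rightarrow> (nat \<Rightarrow> nat \<Rightarrow> real) \<Rightarrow> nat \<Rightarrow> nat \<Rightarrow> nat \<Rightarrow> real" where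
  "mpow d A 0 = idm d"
| "mpow d A (Suc n) = mm d A (mpow d A n)"

lemma mm_assoc: "mm d (mm d A B) C = mm d A (mm d B C)"
proof (intro ext)
  fix i j
  have "mm d (mm d A B) C i j = (\<Sum>k<d. \<Sum>l<d. A i l * B l k * C k j)"
    by (simp add: mm_def sum_distrib_right)
  also have "\<dots> = (\<Sum>l<d. \<Sum>k<d. A i l * B l k * C k j)"
    by (rule sum.swap)
  also have "\<dots> = mm d A (mm d B C) i j"
    by (simp add: mm_def sum_distrib_left mult.assoc)
  finally show "mm d (mm d A B) C i j = mm d A (mm d B C) i j" .
qed

lemma mm_diff_left: "mm d (\<lambda>i j. A i j - B i j) C = (\<lambda>i j. mm d A C i j - mm d B C i j)"
  by (simp add: mm_def left_diff_distrib sum_subtractf)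

lemma mm_diff_right: "mm d A (\<lambda>i j. B i j - C i j) = (\<lambda>i j. mm d A B i j - mm d A C i j)"
  by (simp add: mm_def right_diff_distrib sum_subtractf)

lemma mm_sum_right: "mm d A (\<lambda>i j. \<Sum>x\<in>S. B x i j) = (\<lambda>i j. \<Sum>x\<in>S. mm d A (B x) i j)"
  unfolding mm_def sum_distrib_left by (intro ext) (rule sum.swap)

lemma supp_idm: "supp d (idm d)"
  by (auto simp: supp_def idm_def)

lemma supp_mm: "supp d A \<Longrightarrow> supp d B \<Longrightarrow> supp d (mm d A B)"
  by (auto simp: supp_def mm_def intro!: sum.neutral)

lemma supp_mpow: "supp d A \<Longrightarrow> supp d (mpow d A n)"
  by (induction n) (auto simp: supp_idm supp_mm)

lemma mm_idm_left: "supp d M \<Longrightarrow> mm d (idm d) M = M"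
proof (intro ext)
  fix i j assume "supp d M"
  have "mm d (idm d) M i j = (\<Sum>k<d. if k = i then M k j else 0)"
    unfolding mm_def by (intro sum.cong refl) (auto simp: idm_def)
  also have "\<dots> = M i j" using \<open>supp d M\<close> by (auto simp: supp_def)
  finally show "mm d (idm d) M i j = M i j" .
qed

lemma mm_idm_right: "supp d M \<Longrightarrow> mm d M (idm d) = M"
proof (intro ext)
  fix i j assume "supp d M"
  have "mm d M (idm d) i j = (\<Sum>k<d. if k = j then M i k else 0)"
    unfolding mm_def by (intro sum.cong refl) (auto simp: idm_def)
  also have "\<dots> = M i j" using \<open>supp d M\<close> by (auto simp: supp_def)
  finally show "mm d M (idm d) i j = M i j" .
qed

lemma mpow_commute: "supp d A \<Longrightarrow> mm d (mpow d A n) A = mpow d A (Suc n)"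
  by (induction n) (simp_all add: mm_idm_left mm_idm_right mm_assoc)

lemma mpow_add: "supp d A \<Longrightarrow> mm d (mpow d A m) (mpow d A n) = mpow d A (m + n)"
  by (induction m) (simp_all add: mm_idm_left supp_mpow mm_assoc)

lemma symm_idm: "symm (idm d)"
  by (auto simp: symm_def idm_def)

lemma symm_mm_transpose: "symm A \<Longrightarrow> symm B \<Longrightarrow> mm d A B i j = mm d B A j i"
  by (simp add: mm_def symm_def mult.commute)

lemma symm_mpow: "supp d A \<Longrightarrow> symm A \<Longrightarrow> symm (mpow d A n)"
proof (induction n)
  case (Suc n)
  then have s: "symm (mpow d A n)" by simp
  show ?case unfolding symm_def
  proof (intro allI)
    fix i j
    have "mpow d A (Suc n) i j = mm d (mpow d A n) A j i"
      using symm_mm_transpose[OF Suc.prems(2) s] by simp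
    then show "mpow d A (Suc n) i j = mpow d A (Suc n) j i"
      by (simp add: mpow_commute Suc.prems(1))
  qed
qed (simp add: symm_idm)

lemma frob_commute: "frob d A B = frob d B A"
  by (simp add: frob_def mult.commute)

lemma frob_nonneg: "0 \<le> frob d A A"
  by (auto simp: frob_def intro!: sum_nonneg)

lemma frob_diff_right: "frob d A (\<lambda>i j. B i j - C i j) = frob d A B - frob d A C"
  by (simp add: frob_def right_diff_distrib sum_subtractf)

lemma frob_diff_left: "frob d (\<lambda>i j. A i j - B i j) C = frob d A C - frob d B C"
  by (simp add: frob_def left_diff_distrib sum_subtractf)

lemma frob_scale_left: "frob d (\<lambda>i j. c * A i j) C = c * frob d A C"
  by (simp add: frob_def sum_distrib_left mult.assoc)

lemma frob_sum_left: "frob d (\<lambda>i j. \<Sum>x\<in>S. A x i j) C = (\<Sum>x\<in>S. frob d (A x) C)"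
proof -
  have "frob d (\<lambda>i j. \<Sum>x\<in>S. A x i j) C = (\<Sum>i<d. \<Sum>j<d. \<Sum>x\<in>S. A x i j * C i j)"
    by (simp add: frob_def sum_distrib_right)
  also have "\<dots> = (\<Sum>i<d. \<Sum>x\<in>S. \<Sum>j<d. A x i j * C i j)"
    by (intro sum.cong refl sum.swap)
  also have "\<dots> = (\<Sum>x\<in>S. frob d (A x) C)"
    unfolding frob_def by (rule sum.swap)
  finally show ?thesis .
qed

lemma frob_le_half: "frob d A B \<le> (frob d A A + frob d B B) / 2"
proof -
  have "0 \<le> frob d (\<lambda>i j. A i j - B i j) (\<lambda>i j. A i j - B i j)" by (rule frob_nonneg)
  then show ?thesis
    by (simp add: frob_diff_left frob_diff_right frob_commute[of d B A])
qed

lemma frob_adjoint_left: "symm A \<Longrightarrow> frob d (mm d A M) N = frob d M (mm d A N)"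
proof -
  assume s: "symm A"
  have "frob d (mm d A M) N = (\<Sum>i<d. \<Sum>j<d. \<Sum>k<d. A i k * M k j * N i j)"
    by (simp add: frob_def mm_def sum_distrib_right)
  also have "\<dots> = (\<Sum>i<d. \<Sum>k<d. \<Sum>j<d. A i k * M k j * N i j)"
    by (intro sum.cong refl sum.swap)
  also have "\<dots> = (\<Sum>k<d. \<Sum>i<d. \<Sum>j<d. A i k * M k j * N i j)"
    by (rule sum.swap)
  also have "\<dots> = (\<Sum>k<d. \<Sum>j<d. \<Sum>i<d. A i k * M k j * N i j)"
    by (intro sum.cong refl sum.swap)
  also have "\<dots> = (\<Sum>k<d. \<Sum>j<d. \<Sum>i<d. M k j * (A k i * N i j))"
    by (intro sum.cong refl) (use s in \<open>auto simp: symm_def mult_ac\<close>)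
  also have "\<dots> = frob d M (mm d A N)"
    by (simp add: frob_def mm_def sum_distrib_left)
  finally show ?thesis .
qed

lemma frob_transpose: "frob d (\<lambda>i j. A j i) (\<lambda>i j. B j i) = frob d A B"
  unfolding frob_def by (rule sum.swap)

lemma frob_adjoint_right: "symm B \<Longrightarrow> frob d (mm d M B) N = frob d M (mm d N B)"
proof -
  assume s: "symm B"
  have t: "(\<lambda>i j. mm d M B j i) = mm d B (\<lambda>i j. M j i)" for M
  proof (intro ext)
    fix i j
    show "mm d M B j i = mm d B (\<lambda>i j. M j i) i j"
      using s unfolding mm_def symm_def by (intro sum.cong refl) (metis mult.commute)
  qed
  have "frob d (mm d M B) N = frob d (\<lambda>i j. mm d M B j i) (\<lambda>i j. N j i)"
    by (rule frob_transpose[symmetric])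
  also have "\<dots> = frob d (\<lambda>i j. M j i) (mm d B (\<lambda>i j. N j i))"
    by (simp only: t frob_adjoint_left[OF s])
  also have "\<dots> = frob d (\<lambda>i j. M j i) (\<lambda>i j. mm d N B j i)" by (simp only: t)
  also have "\<dots> = frob d M (mm d N B)" by (rule frob_transpose)
  finally show ?thesis .
qed

definition app :: "nat \<Rightarrow> (nat \<Rightarrow> nat \<Rightarrow> real) \<Rightarrow> (nat \<Rightarrow> real) \<Rightarrow> nat \<Rightarrow> real" where
  "app d A w = (\<lambda>i. \<Sum>j<d. A i j * w j)"

definition vdot :: "nat \<Rightarrow> (nat \<Rightarrow> real) \<Rightarrow> (nat \<Rightarrow> real) \<Rightarrow> real" where
  "vdot d v w = (\<Sum>i<d. v i * w i)"

lemma app_mm: "app d (mm d A B) w = app d A (app d B w)"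
proof
  fix i
  have "app d (mm d A B) w i = (\<Sum>j<d. \<Sum>k<d. A i k * B k j * w j)"
    by (simp add: app_def mm_def sum_distrib_right)
  also have "\<dots> = (\<Sum>k<d. \<Sum>j<d. A i k * B k j * w j)" by (rule sum.swap)
  also have "\<dots> = app d A (app d B w) i" by (simp add: app_def sum_distrib_left mult.assoc)
  finally show "app d (mm d A B) w i = app d A (app d B w) i" .
qed

lemma app_idm: "i < d \<Longrightarrow> app d (idm d) w i = w i"
proof -
  assume i: "i < d"
  have "app d (idm d) w i = (\<Sum>j<d. if j = i then w j else 0)"
    unfolding app_def by (intro sum.cong refl) (use i in \<open>auto simp: idm_def\<close>)
  then show ?thesis using i by simp
qed

lemma vdot_app_symm: "symm A \<Longrightarrow> vdot d (app d A v) w = vdot d v (app d A w)"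
proof -
  assume s: "symm A"
  have "vdot d (app d A v) w = (\<Sum>i<d. \<Sum>j<d. A i j * v j * w i)"
    by (simp add: vdot_def app_def sum_distrib_right)
  also have "\<dots> = (\<Sum>j<d. \<Sum>i<d. A i j * v j * w i)" by (rule sum.swap)
  also have "\<dots> = (\<Sum>j<d. \<Sum>i<d. v j * (A j i * w i))"
  proof (intro sum.cong refl)
    fix i j
    have "A i j = A j i" using s unfolding symm_def by blast
    then show "A i j * v j * w i = v j * (A j i * w i)" by simp
  qed
  finally show ?thesis by (simp add: vdot_def app_def sum_distrib_left)
qed

lemma vdot_self_nonneg: "0 \<le> vdot d v v"
  by (auto simp: vdot_def intro!: sum_nonneg)

lemma vdot_diff_left: "vdot d (\<lambda>i. u i - v i) w = vdot d u w - vdot d v w"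
  by (simp add: vdot_def left_diff_distrib sum_subtractf)

lemma vdot_diff_right: "vdot d w (\<lambda>i. u i - v i) = vdot d w u - vdot d w v"
  by (simp add: vdot_def right_diff_distrib sum_subtractf)

lemma app_diff: "app d A (\<lambda>i. u i - v i) = (\<lambda>i. app d A u i - app d A v i)"
  by (simp add: app_def right_diff_distrib sum_subtractf)

lemma vdot_Cauchy_Schwarz: "(vdot d v w)\<^sup>2 \<le> vdot d v v * vdot d w w"
  unfolding vdot_def using Cauchy_Schwarz_ineq_sum[of v w "{..<d}"] by (simp add: power2_eq_square)

section \<open>Moments of a uniformly sampled Gram matrix\<close>

lemma midpoint_convex_le_max:
  fixes f :: "nat \<Rightarrow> real"
  assumes conv: "\<And>i. 0 < i \<Longrightarrow> i < p \<Longrightarrow> 2 * f i \<le> f (i - 1) + f (i + 1)" and "i \<le> p"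
  shows "f i \<le> max (f 0) (f p)"
proof -
  define M where "M = Max (f ` {..p})"
  have le: "f k \<le> M" if "k \<le> p" for k using that by (simp add: M_def)
  have "M \<in> f ` {..p}" unfolding M_def by (rule Max_in) auto
  then have ex: "\<exists>k. k \<le> p \<and> f k = M" by auto
  define k where "k = (LEAST k. k \<le> p \<and> f k = M)"
  have k: "k \<le> p" "f k = M" using LeastI_ex[OF ex] by (auto simp: k_def)
  \<comment> \<open>The first maximum cannot be interior: its left neighbour is strictly smaller.\<close>
  have "k = 0 \<or> k = p"
  proof (rule ccontr)
    assume "\<not> ?thesis"
    then have k2: "0 < k" "k < p" using k by auto
    have "f (k - 1) \<noteq> M"
      using not_less_Least[of "k - 1" "\<lambda>k. k \<le> p \<and> f k = M"] k2 by (auto simp: k_def[symmetric])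
    moreover have "f (k - 1) \<le> M" using le k2 by simp
    ultimately have "f (k - 1) < M" by simp
    moreover have "f (k + 1) \<le> M" using le k2 by simp
    ultimately show False using conv[OF k2] k(2) by linarith
  qed
  then have "M \<le> max (f 0) (f p)" using k by auto
  then show ?thesis using le[OF \<open>i \<le> p\<close>] by linarith
qed

text \<open>
  The matrix form of the inequality
  \<open>(a - b) (a\<^sup>n - b\<^sup>n) \<le> n (a - b)\<^sup>2 (a\<^sup>2\<^sup>p + b\<^sup>2\<^sup>p)\<close> for \<open>n = 2 p + 1\<close>. Telescoping writes the left-hand side as a
  sum of the inner products of \<open>D\<close> with \<open>A\<^sup>k D B\<^sup>2\<^sup>p\<^sup>-\<^sup>k\<close>. Since left and right multiplications are
  self-adjoint, such a product is also the inner product of \<open>A\<^sup>i D B\<^sup>p\<^sup>-\<^sup>i\<close> and \<open>A\<^sup>j D B\<^sup>p\<^sup>-\<^sup>j\<close> whenever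
  \<open>i + j = k\<close>. Therefore the squared norms of \<open>A\<^sup>i D B\<^sup>p\<^sup>-\<^sup>i\<close> form a convex sequence in \<open>i\<close>,
  which is bounded by its two end terms.
\<close>

lemma odd_power_increment_bound:
  fixes A B :: "nat \<Rightarrow> nat \<Rightarrow> real" and p :: nat
  assumes sA: "symm A" "supp d A" and sB: "symm B" "supp d B"
  defines "D \<equiv> (\<lambda>i j. A i j - B i j)" and "n \<equiv> 2 * p + 1"
  shows "frob d D (\<lambda>i j. mpow d A n i j - mpow d B n i j)
    \<le> real n * (frob d (mm d D (mpow d A p)) (mm d D (mpow d A p))
              + frob d (mm d D (mpow d B p)) (mm d D (mpow d B p)))"
proof -
  have D: "symm D" "supp d D" using assms by (auto simp: symm_def supp_def)
  define W where "W i j = mm d (mpow d A i) (mm d D (mpow d B j))" for i j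
  have WA: "mm d A (W i j) = W (Suc i) j" for i j by (simp add: W_def mm_assoc)
  have WB: "mm d (W i j) B = W i (Suc j)" for i j
    using mpow_commute[OF sB(2)] by (simp add: W_def mm_assoc)
  have W0: "W 0 0 = D" by (simp add: W_def mm_idm_left mm_idm_right D)
  \<comment> \<open>Inner products of the \<open>W i j\<close> depend only on the total exponents.\<close>
  have shift: "frob d (W i j) (W k l) = frob d D (W (i + k) (j + l))" for i j k l
  proof (induction i arbitrary: k)
    case 0
    show ?case
    proof (induction j arbitrary: l)
      case (Suc j)
      have "frob d (W 0 (Suc j)) (W k l) = frob d (W 0 j) (W k (Suc l))"
        by (simp only: WB[symmetric] frob_adjoint_right[OF sB(1)])
      then show ?case by (simp add: Suc.IH)
    qed (simp add: W0)
  next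
    case (Suc i)
    have "frob d (W (Suc i) j) (W k l) = frob d (W i j) (W (Suc k) l)"
      by (simp only: WA[symmetric] frob_adjoint_left[OF sA(1)])
    then show ?case by (simp add: Suc.IH)
  qed
  define a where "a i = frob d (W i (p - i)) (W i (p - i))" for i
  have conv: "2 * a i \<le> a (i - 1) + a (i + 1)" if "0 < i" "i < p" for i
  proof -
    have "a i = frob d (W (i - 1) (p - (i - 1))) (W (i + 1) (p - (i + 1)))"
      unfolding a_def shift using that
      by (intro arg_cong2[where f = "\<lambda>x y. frob d D (W x y)"]) auto
    also have "\<dots> \<le> (a (i - 1) + a (i + 1)) / 2" unfolding a_def by (rule frob_le_half)
    finally show ?thesis by simp
  qed
  have a_nonneg: "0 \<le> a i" for i by (simp add: a_def frob_nonneg)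
  have a_le: "a i \<le> a 0 + a p" if "i \<le> p" for i
    using midpoint_convex_le_max[of p a i, OF conv that] a_nonneg[of 0] a_nonneg[of p] by linarith
  have tele: "(\<lambda>i j. mpow d A k i j - mpow d B k i j) = (\<lambda>i j. \<Sum>l<k. W l (k - 1 - l) i j)" for k
  proof (induction k)
    case (Suc k)
    have "mpow d A (Suc k) i j - mpow d B (Suc k) i j
        = mm d A (\<lambda>i j. mpow d A k i j - mpow d B k i j) i j + W 0 k i j" for i j
      by (simp add: mm_diff_right D_def mm_diff_left W_def mm_idm_left supp_mm supp_mpow sA sB)
    also have "mm d A (\<lambda>i j. mpow d A k i j - mpow d B k i j) i j + W 0 k i j
        = (\<Sum>l<Suc k. W l (Suc k - 1 - l) i j)" for i j
      unfolding arg_cong[OF Suc.IH, of "mm d A"] mm_sum_right sum.lessThan_Suc_shift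
      by (simp add: WA)
    finally show ?case by (intro ext)
  qed simp
  have term_le: "frob d D (W l (2 * p - l)) \<le> a 0 + a p" if "l \<le> 2 * p" for l
  proof -
    \<comment> \<open>An even split keeps both indices at most \<open>p\<close>.\<close>
    define i j where "i = l div 2" and "j = l - l div 2"
    have ij: "i + j = l" "i \<le> p" "j \<le> p" using that by (auto simp: i_def j_def)
    have "frob d D (W l (2 * p - l)) = frob d (W i (p - i)) (W j (p - j))"
      unfolding shift using ij
      by (intro arg_cong2[where f = "\<lambda>x y. frob d D (W x y)"]) auto
    also have "\<dots> \<le> (a i + a j) / 2" unfolding a_def by (rule frob_le_half)
    also have "\<dots> \<le> a 0 + a p" using a_le[OF ij(2)] a_le[OF ij(3)] by simp
    finally show ?thesis .
  qed
  have "frob d D (\<lambda>i j. mpow d A n i j - mpow d B n i j) = (\<Sum>l<n. frob d D (W l (2 * p - l)))"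
    unfolding tele by (subst frob_commute, subst frob_sum_left) (simp add: n_def frob_commute)
  also have "\<dots> \<le> (\<Sum>l<n. a 0 + a p)"
    by (intro sum_mono term_le) (simp add: n_def)
  also have "\<dots> = real n * (a 0 + a p)" by simp
  also have "a 0 = frob d (mm d D (mpow d B p)) (mm d D (mpow d B p))"
    by (simp add: a_def W_def mm_idm_left supp_mm supp_mpow D sB)
  also have "a p = frob d (mm d D (mpow d A p)) (mm d D (mpow d A p))"
  proof -
    have "a p = frob d (mm d (mpow d A p) D) (mm d (mpow d A p) D)"
      by (simp add: a_def W_def mm_idm_right D)
    also have "mm d (mpow d A p) D = (\<lambda>i j. mm d D (mpow d A p) j i)"
      using symm_mm_transpose[OF symm_mpow[OF sA(2,1)] D(1)] by (intro ext) auto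
    finally show ?thesis unfolding frob_transpose[of d "mm d D (mpow d A p)" "mm d D (mpow d A p)"] .
  qed
  finally show ?thesis by (simp add: add.commute)
qed

lemma frob_mpow: "symm A \<Longrightarrow> frob d (mpow d A i) (mpow d A j) = frob d (idm d) (mpow d A (i + j))"
proof (induction i arbitrary: j)
  case (Suc i)
  have "frob d (mpow d A (Suc i)) (mpow d A j) = frob d (mpow d A i) (mpow d A (Suc j))"
    by (simp add: frob_adjoint_left[OF Suc.prems])
  then show ?case by (simp only: Suc.IH[OF Suc.prems] add_Suc add_Suc_right)
qed simp

lemma frob_diff_le:
  "frob d (\<lambda>i j. P i j - Q i j) (\<lambda>i j. P i j - Q i j) \<le> 2 * frob d P P + 2 * frob d Q Q"
proof -
  have "(P i j - Q i j) * (P i j - Q i j) \<le> 2 * (P i j * P i j) + 2 * (Q i j * Q i j)" for i j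
    using zero_le_square[of "P i j + Q i j"] by (simp add: algebra_simps)
  then have "frob d (\<lambda>i j. P i j - Q i j) (\<lambda>i j. P i j - Q i j)
      \<le> (\<Sum>i<d. \<Sum>j<d. 2 * (P i j * P i j) + 2 * (Q i j * Q i j))"
    unfolding frob_def by (intro sum_mono)
  then show ?thesis by (simp add: frob_def sum.distrib sum_distrib_left)
qed

text \<open>
  The rows \<open>x i\<close> of a matrix with orthonormal columns, all of squared norm at most \<open>l\<close>. They vanish
  beyond the dimension \<open>d\<close>, so that their Gram matrices are supported on the first \<open>d\<close> indices.
\<close>

locale tight_frame =
  fixes d N :: nat and x :: "nat \<Rightarrow> nat \<Rightarrow> real" and l :: real
  assumes N_pos: "0 < N" and l_pos: "0 < l"
    and supported: "\<And>i k. d \<le> k \<Longrightarrow> x i k = 0"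
    and tight: "\<And>k k'. k < d \<Longrightarrow> k' < d \<Longrightarrow> (\<Sum>i<N. x i k * x i k') = idm d k k'"
    and row_le: "\<And>i. i < N \<Longrightarrow> (\<Sum>k<d. (x i k)\<^sup>2) \<le> l"
begin

definition outer :: "nat \<Rightarrow> nat \<Rightarrow> nat \<Rightarrow> real" where
  "outer a = (\<lambda>i j. x a i * x a j)"

definition gram :: "nat set \<Rightarrow> nat \<Rightarrow> nat \<Rightarrow> real" where
  "gram I = (\<lambda>i j. \<Sum>a\<in>I. outer a i j)"

definition row_energy :: "(nat \<Rightarrow> nat \<Rightarrow> real) \<Rightarrow> nat \<Rightarrow> real" where
  "row_energy W a = (\<Sum>j<d. (\<Sum>k<d. x a k * W k j)\<^sup>2)"

definition deviation :: "nat \<Rightarrow> nat set \<Rightarrow> nat \<Rightarrow> nat \<Rightarrow> real" where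
  "deviation m I = (\<lambda>i j. gram I i j - real m / real N * idm d i j)"

definition subsets_of_size :: "nat \<Rightarrow> nat set set" where
  "subsets_of_size m = {I. I \<subseteq> {..<N} \<and> card I = m}"

lemma gram_all: "gram {..<N} = idm d"
proof (intro ext)
  fix i j
  show "gram {..<N} i j = idm d i j"
  proof (cases "i < d \<and> j < d")
    case True
    then show ?thesis by (simp add: gram_def outer_def tight)
  next
    case False
    then show ?thesis using supported by (auto simp: gram_def outer_def idm_def not_less)
  qed
qed

lemma row_energy_nonneg: "0 \<le> row_energy W a"
  by (auto simp: row_energy_def intro!: sum_nonneg)

lemma mm_outer: "mm d (outer a) W = (\<lambda>i j. x a i * (\<Sum>k<d. x a k * W k j))"
  by (simp add: mm_def outer_def sum_distrib_left mult.assoc)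

lemma frob_outer_le:
  assumes "a < N"
  shows "frob d (mm d (outer a) W) (mm d (outer a) W) \<le> l * row_energy W a"
proof -
  have "frob d (mm d (outer a) W) (mm d (outer a) W) = (\<Sum>k<d. (x a k)\<^sup>2) * row_energy W a"
    by (simp add: frob_def mm_outer row_energy_def sum_product power2_eq_square mult_ac)
  also have "\<dots> \<le> l * row_energy W a"
    by (intro mult_right_mono row_le assms row_energy_nonneg)
  finally show ?thesis .
qed

lemma sum_row_energy: "(\<Sum>a\<in>I. row_energy W a) = frob d W (mm d (gram I) W)"
proof -
  have one: "frob d (mm d (outer a) W) W = row_energy W a" for a
  proof -
    have "frob d (mm d (outer a) W) W = (\<Sum>j<d. \<Sum>i<d. x a i * (\<Sum>k<d. x a k * W k j) * W i j)"
      unfolding frob_def mm_outer by (rule sum.swap)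
    also have "\<dots> = (\<Sum>j<d. (\<Sum>k<d. x a k * W k j) * (\<Sum>i<d. x a i * W i j))"
      by (simp add: sum_distrib_left sum_distrib_right mult_ac)
    finally show ?thesis by (simp add: row_energy_def power2_eq_square)
  qed
  have "mm d (gram I) W = (\<lambda>i j. \<Sum>a\<in>I. mm d (outer a) W i j)"
  proof (intro ext)
    fix i j
    have "mm d (gram I) W i j = (\<Sum>k<d. \<Sum>a\<in>I. outer a i k * W k j)"
      by (simp add: mm_def gram_def sum_distrib_right)
    then show "mm d (gram I) W i j = (\<Sum>a\<in>I. mm d (outer a) W i j)"
      unfolding mm_def by (subst (asm) sum.swap)
  qed
  then have "frob d W (mm d (gram I) W) = (\<Sum>a\<in>I. frob d (mm d (outer a) W) W)"
    by (subst frob_commute) (simp add: frob_sum_left)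
  then show ?thesis by (simp add: one)
qed

lemma deviation_symm: "symm (deviation m I)"
  by (auto simp: symm_def deviation_def gram_def outer_def idm_def mult.commute)

lemma deviation_supp: "supp d (deviation m I)"
  using supported by (auto simp: supp_def deviation_def gram_def outer_def idm_def)

lemma finite_subsets_of_size: "finite (subsets_of_size m)"
  by (rule finite_subset[of _ "Pow {..<N}"]) (auto simp: subsets_of_size_def)

text \<open>
  The triples \<open>(I, a, b)\<close> in which a sampled index \<open>a\<close> is to be exchanged with another one \<open>b\<close>.
  Undoing the exchange is the involution that makes the pair of samples exchangeable.
\<close>

definition swap_triples :: "nat \<Rightarrow> (nat set \<times> nat \<times> nat) set" where
  "swap_triples m = Sigma (subsets_of_size m) (\<lambda>I. I \<times> ({..<N} - I))"

lemma sum_swap_triples: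
  "(\<Sum>I\<in>subsets_of_size m. \<Sum>a\<in>I. \<Sum>b\<in>{..<N} - I. f I a b)
    = (\<Sum>(I, a, b)\<in>swap_triples m. f I a b)"
proof -
  have fin: "finite I" if "I \<in> subsets_of_size m" for I
    using that finite_subset by (auto simp: subsets_of_size_def)
  show ?thesis
    unfolding swap_triples_def
    by (subst sum.Sigma[symmetric])
       (auto simp: finite_subsets_of_size fin sum.cartesian_product intro!: sum.cong)
qed

lemma sum_swapped_triples:
  "(\<Sum>(I, a, b)\<in>swap_triples m. f I a b)
    = (\<Sum>(I, a, b)\<in>swap_triples m. f (insert b (I - {a})) b a)"
proof -
  define h where "h = (\<lambda>(I, a, b). (insert b (I - {a}), b, a :: nat))"
  have h_in: "h t \<in> swap_triples m" if tm: "t \<in> swap_triples m" for t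
  proof -
    obtain I a b where t: "t = (I, a, b)" by (cases t) auto
    have I: "I \<subseteq> {..<N}" "card I = m" "a \<in> I" "b < N" "b \<notin> I"
      using tm by (auto simp: t swap_triples_def subsets_of_size_def)
    have "finite I" using I finite_subset by auto
    then have "card (insert b (I - {a})) = m" using I
      by (metis card_Suc_Diff1 card_insert_disjoint finite_Diff insert_Diff insert_iff)
    then show ?thesis using I
      by (auto simp: t h_def swap_triples_def subsets_of_size_def)
  qed
  have h_h: "h (h t) = t" if tm: "t \<in> swap_triples m" for t
    using that by (auto simp: h_def swap_triples_def)
  show ?thesis
    by (rule sum.reindex_bij_witness[of _ h h]) (use h_in h_h in \<open>auto simp: h_def split: prod.splits\<close>)
qed

text \<open>
  The linear regression property of the exchangeable pair: the mean increment over all exchanges is a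
  multiple of the deviation itself. It uses that the rows outside \<open>I\<close> have the Gram matrix \<open>idm d - gram I\<close>.
\<close>

lemma swap_sum_deviation:
  assumes "I \<in> subsets_of_size m" "m \<le> N"
  shows "(\<Sum>a\<in>I. \<Sum>b\<in>{..<N} - I. outer a i j - outer b i j) = real N * deviation m I i j"
proof -
  have I: "I \<subseteq> {..<N}" "card I = m" "finite I"
    using assms finite_subset by (auto simp: subsets_of_size_def)
  have c: "card ({..<N} - I) = N - m" using I by (simp add: card_Diff_subset)
  have compl: "(\<Sum>b\<in>{..<N} - I. outer b i j) = idm d i j - gram I i j"
    using sum.subset_diff[OF I(1), of "\<lambda>b. outer b i j"] gram_all
    by (simp add: gram_def fun_eq_iff)
  have "(\<Sum>a\<in>I. \<Sum>b\<in>{..<N} - I. outer a i j - outer b i j)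
      = real (N - m) * gram I i j - real m * (idm d i j - gram I i j)"
    by (simp add: sum_subtractf c I compl sum_distrib_left[symmetric] gram_def)
  also have "\<dots> = real N * deviation m I i j"
    using N_pos \<open>m \<le> N\<close> by (simp add: deviation_def of_nat_diff field_simps)
  finally show ?thesis .
qed

definition moment :: "nat \<Rightarrow> nat \<Rightarrow> real" where
  "moment m p = (\<Sum>I\<in>subsets_of_size m.
     frob d (mpow d (deviation m I) p) (mpow d (deviation m I) p))"

text \<open>
  Write one factor of the even power of the deviation as a mean of increments. By exchangeability, its
  product with an odd power \<open>Q\<close> of the deviation can be replaced by half the product with the
  increment of \<open>Q\<close>, and \<open>odd_power_increment_bound\<close> turns the latter into second order terms.
\<close>

lemma moment_le_swaps:
  assumes "m \<le> N"
  shows "real N * moment m (Suc p) \<le> real (2 * p + 1) *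
    (\<Sum>I\<in>subsets_of_size m. \<Sum>a\<in>I. \<Sum>b\<in>{..<N} - I.
       frob d (mm d (\<lambda>i j. outer a i j - outer b i j) (mpow d (deviation m I) p))
              (mm d (\<lambda>i j. outer a i j - outer b i j) (mpow d (deviation m I) p)))"
proof -
  define n where "n = 2 * p + 1"
  define D where "D a b = (\<lambda>i j. outer a i j - outer b i j)" for a b
  define Y where "Y = deviation m"
  define P where "P I = mpow d (Y I) p" for I
  define Q where "Q I = mpow d (Y I) n" for I
  define swp where "swp I a b = insert b (I - {a})" for I and a b :: nat
  have key: "real N * frob d (mpow d (Y I) (Suc p)) (mpow d (Y I) (Suc p))
      = (\<Sum>a\<in>I. \<Sum>b\<in>{..<N} - I. frob d (D a b) (Q I))" if I: "I \<in> subsets_of_size m" for I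
  proof -
    have "frob d (mpow d (Y I) (Suc p)) (mpow d (Y I) (Suc p)) = frob d (mpow d (Y I) 1) (Q I)"
      unfolding Q_def n_def Y_def frob_mpow[OF deviation_symm] by (simp add: mult_2)
    also have "mpow d (Y I) 1 = Y I"
      by (simp add: mm_idm_right Y_def deviation_supp)
    finally have "real N * frob d (mpow d (Y I) (Suc p)) (mpow d (Y I) (Suc p))
        = frob d (\<lambda>i j. real N * Y I i j) (Q I)"
      by (simp only: frob_scale_left)
    also have "(\<lambda>i j. real N * Y I i j) = (\<lambda>i j. \<Sum>a\<in>I. \<Sum>b\<in>{..<N} - I. D a b i j)"
      by (simp add: D_def Y_def swap_sum_deviation[OF I assms])
    finally show ?thesis by (simp add: frob_sum_left)
  qed
  have sw: "(\<lambda>i j. Y I i j - Y (swp I a b) i j) = D a b"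
    if "(I, a, b) \<in> swap_triples m" for I a b
  proof (intro ext)
    fix i j
    have I: "finite I" "a \<in> I" "b \<notin> I"
      using that finite_subset by (auto simp: swap_triples_def subsets_of_size_def)
    have "gram (swp I a b) i j = gram I i j - outer a i j + outer b i j"
      using I by (simp add: gram_def swp_def sum_diff1)
    then show "Y I i j - Y (swp I a b) i j = D a b i j" by (simp add: Y_def deviation_def D_def)
  qed
  have neg: "frob d (D b a) M = - frob d (D a b) M" for a b M
    by (simp add: D_def frob_diff_left)
  \<comment> \<open>The exchange maps \<open>D a b\<close> to \<open>D b a = - D a b\<close>.\<close>
  have "real N * moment m (Suc p) = (\<Sum>(I, a, b)\<in>swap_triples m. frob d (D a b) (Q I))"
    unfolding moment_def sum_distrib_left sum_swap_triples[symmetric]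
    by (intro sum.cong refl) (use key in \<open>simp add: Y_def\<close>)
  moreover have "\<dots> = (\<Sum>(I, a, b)\<in>swap_triples m. frob d (D b a) (Q (swp I a b)))"
    by (subst sum_swapped_triples) (simp add: swp_def)
  moreover have "\<dots> = (\<Sum>(I, a, b)\<in>swap_triples m. - frob d (D a b) (Q (swp I a b)))"
    by (simp add: neg[symmetric] case_prod_unfold)
  ultimately have "2 * (real N * moment m (Suc p)) =
      (\<Sum>(I, a, b)\<in>swap_triples m. frob d (D a b) (\<lambda>i j. Q I i j - Q (swp I a b) i j))"
    by (simp add: frob_diff_right sum_subtractf sum_negf case_prod_unfold)
  also have "\<dots> \<le> (\<Sum>(I, a, b)\<in>swap_triples m. real n *
      (frob d (mm d (D a b) (P I)) (mm d (D a b) (P I))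
       + frob d (mm d (D a b) (P (swp I a b))) (mm d (D a b) (P (swp I a b)))))"
  proof (rule sum_mono, clarify)
    fix I a b assume "(I, a, b) \<in> swap_triples m"
    note s = sw[OF this, symmetric]
    show "frob d (D a b) (\<lambda>i j. Q I i j - Q (swp I a b) i j) \<le> real n *
      (frob d (mm d (D a b) (P I)) (mm d (D a b) (P I))
       + frob d (mm d (D a b) (P (swp I a b))) (mm d (D a b) (P (swp I a b))))"
      unfolding s P_def Q_def n_def Y_def
      by (rule odd_power_increment_bound; rule deviation_symm deviation_supp)
  qed
  also have "\<dots> = real n *
      ((\<Sum>(I, a, b)\<in>swap_triples m. frob d (mm d (D a b) (P I)) (mm d (D a b) (P I)))
       + (\<Sum>(I, a, b)\<in>swap_triples m.
            frob d (mm d (D a b) (P (swp I a b))) (mm d (D a b) (P (swp I a b)))))"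
    by (simp add: case_prod_unfold sum_distrib_left sum.distrib distrib_left)
  also have "(\<Sum>(I, a, b)\<in>swap_triples m.
            frob d (mm d (D a b) (P (swp I a b))) (mm d (D a b) (P (swp I a b))))
      = (\<Sum>(I, a, b)\<in>swap_triples m.
            frob d (mm d (D b a) (P (swp I a b))) (mm d (D b a) (P (swp I a b))))"
  proof -
    have "frob d (mm d (D a b) M) (mm d (D a b) M) = frob d (mm d (D b a) M) (mm d (D b a) M)" for a b M
      by (simp add: D_def mm_diff_left frob_diff_left frob_diff_right)
    then show ?thesis by (intro sum.cong refl) (clarify, blast)
  qed
  also have "\<dots> = (\<Sum>(I, a, b)\<in>swap_triples m. frob d (mm d (D a b) (P I)) (mm d (D a b) (P I)))"
    using sum_swapped_triples[of "\<lambda>I a b. frob d (mm d (D a b) (P I)) (mm d (D a b) (P I))" m]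
    by (simp add: swp_def)
  finally show ?thesis
    by (simp add: sum_swap_triples n_def D_def P_def Y_def)
qed

text \<open>
  The second order terms are controlled by the deviation itself: the square of an increment is at most
  \<open>2 l\<close> times the sum of the two rank one matrices exchanged. Those of the sampled indices add up to
  \<open>gram I\<close>, which is \<open>q\<close> times the identity plus the deviation, and the others to at most the identity.
  The term with the deviation is split by the arithmetic-geometric mean inequality with a weight chosen such that half of the
  higher moment can be moved to the other side.
\<close>

lemma moment_Suc_le:
  assumes "m \<le> N"
  defines "q \<equiv> real m / real N"
  assumes "b = 2 * real (2 * p + 1) * l"
  shows "moment m (Suc p) \<le> (b\<^sup>2 + 4 * b * q) * moment m p"
proof -
  define Y where "Y = deviation m"
  define e where "e I = frob d (mpow d (Y I) p) (mpow d (Y I) p)" for I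
  define e' where "e' I = frob d (mpow d (Y I) (Suc p)) (mpow d (Y I) (Suc p))" for I
  have b: "0 < b" using l_pos assms by simp
  have local: "(\<Sum>a\<in>I. \<Sum>b\<in>{..<N} - I.
       frob d (mm d (\<lambda>i j. outer a i j - outer b i j) (mpow d (Y I) p))
              (mm d (\<lambda>i j. outer a i j - outer b i j) (mpow d (Y I) p)))
     \<le> 2 * l * real N * (e' I / (2 * b) + b * e I / 2 + 2 * q * e I)"
    if I': "I \<in> subsets_of_size m" for I
  proof -
    define W where "W = mpow d (Y I) p"
    have I: "I \<subseteq> {..<N}" "card I = m" "finite I"
      using I' finite_subset by (auto simp: subsets_of_size_def)
    have c: "card ({..<N} - I) = N - m" using I by (simp add: card_Diff_subset)
    have "frob d (mm d (\<lambda>i j. outer a i j - outer b i j) W)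
              (mm d (\<lambda>i j. outer a i j - outer b i j) W)
         \<le> 2 * (l * row_energy W a) + 2 * (l * row_energy W b)"
      if "a \<in> I" "b \<in> {..<N} - I" for a b
    proof -
      have ab: "a < N" "b < N" using that I by auto
      show ?thesis
        unfolding mm_diff_left
        using frob_diff_le[of d "mm d (outer a) W" "mm d (outer b) W"]
          frob_outer_le[OF ab(1), of W] frob_outer_le[OF ab(2), of W] by linarith
    qed
    then have "(\<Sum>a\<in>I. \<Sum>b\<in>{..<N} - I.
       frob d (mm d (\<lambda>i j. outer a i j - outer b i j) W)
              (mm d (\<lambda>i j. outer a i j - outer b i j) W))
      \<le> (\<Sum>a\<in>I. \<Sum>b\<in>{..<N} - I. 2 * (l * row_energy W a) + 2 * (l * row_energy W b))"
      by (intro sum_mono)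
    also have "\<dots> = 2 * l * (real (N - m) * (\<Sum>a\<in>I. row_energy W a)
        + real m * (\<Sum>b\<in>{..<N} - I. row_energy W b))"
      by (simp add: sum.distrib c I sum_distrib_left[symmetric] algebra_simps)
    also have "\<dots> \<le> 2 * l * (real N * (\<Sum>a\<in>I. row_energy W a) + real m * e I)"
    proof -
      have "(\<Sum>b\<in>{..<N} - I. row_energy W b) \<le> (\<Sum>b<N. row_energy W b)"
        by (intro sum_mono2) (auto simp: row_energy_nonneg)
      also have "\<dots> = e I"
        unfolding sum_row_energy gram_all
        by (simp add: mm_idm_left supp_mpow W_def Y_def deviation_supp e_def)
      finally have "(\<Sum>b\<in>{..<N} - I. row_energy W b) \<le> e I" .
      moreover have "0 \<le> (\<Sum>a\<in>I. row_energy W a)" by (intro sum_nonneg row_energy_nonneg)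
      ultimately show ?thesis
        using l_pos by (intro mult_left_mono add_mono mult_right_mono) auto
    qed
    also have "(\<Sum>a\<in>I. row_energy W a) = frob d W (mm d (Y I) W) + q * e I"
    proof -
      \<comment> \<open>Replace the sampled Gram matrix by its mean plus the deviation.\<close>
      have "mm d (gram I) W i j = mm d (Y I) W i j + q * W i j" for i j
      proof -
        have "mm d (gram I) W i j = mm d (Y I) W i j + q * mm d (idm d) W i j"
          by (simp add: mm_def Y_def deviation_def q_def sum.distrib[symmetric] sum_distrib_left
              algebra_simps)
        then show ?thesis by (simp add: mm_idm_left supp_mpow W_def Y_def deviation_supp)
      qed
      then have "frob d W (mm d (gram I) W) = (\<Sum>i<d. \<Sum>j<d. W i j * mm d (Y I) W i j + q * (W i j * W i j))"
        by (simp add: frob_def distrib_left mult_ac)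
      also have "\<dots> = frob d W (mm d (Y I) W) + q * frob d W W"
        by (simp add: frob_def sum.distrib sum_distrib_left)
      finally show ?thesis by (simp add: sum_row_energy e_def W_def)
    qed
    also have "2 * l * (real N * (frob d W (mm d (Y I) W) + q * e I) + real m * e I)
        \<le> 2 * l * (real N * ((e' I / (2 * b) + b * e I / 2) + q * e I) + real m * e I)"
    proof -
      \<comment> \<open>The weight \<open>b\<close> makes the coefficient of \<open>e' I\<close> equal to one half after the multiplication by \<open>b\<close> below.\<close>
      have "0 \<le> frob d (\<lambda>i j. b * W i j - mm d (Y I) W i j) (\<lambda>i j. b * W i j - mm d (Y I) W i j)"
        by (rule frob_nonneg)
      also have "\<dots> = b\<^sup>2 * e I - 2 * b * frob d W (mm d (Y I) W) + e' I"
        unfolding frob_diff_left frob_diff_right frob_scale_left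
          frob_commute[of d _ "\<lambda>i j. b * W i j"]
        by (simp add: e_def e'_def W_def power2_eq_square)
      finally have "frob d W (mm d (Y I) W) \<le> e' I / (2 * b) + b * e I / 2"
        using b by (simp add: field_simps power2_eq_square)
      then show ?thesis using l_pos by (intro mult_left_mono add_right_mono) auto
    qed
    also have "real N * ((e' I / (2 * b) + b * e I / 2) + q * e I) + real m * e I
        = real N * (e' I / (2 * b) + b * e I / 2 + 2 * q * e I)"
    proof -
      have "real m = real N * q" using N_pos by (simp add: q_def)
      then show ?thesis by (simp add: algebra_simps)
    qed
    finally show ?thesis by (simp only: W_def mult.assoc)
  qed
  have "real N * moment m (Suc p) \<le> real (2 * p + 1) * (\<Sum>I\<in>subsets_of_size m.
      2 * l * real N * (e' I / (2 * b) + b * e I / 2 + 2 * q * e I))"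
    by (rule order_trans[OF moment_le_swaps[OF assms(1)]], intro mult_left_mono sum_mono)
       (use local in \<open>auto simp: Y_def\<close>)
  also have "\<dots> = real N * (b * (\<Sum>I\<in>subsets_of_size m. e' I / (2 * b) + b * e I / 2 + 2 * q * e I))"
  proof -
    have "real (2 * p + 1) * (2 * l * real N * Z) = real N * (b * Z)" for Z
      by (simp add: assms(3))
    then show ?thesis by (simp only: sum_distrib_left[symmetric])
  qed
  also have "(\<Sum>I\<in>subsets_of_size m. e' I / (2 * b) + b * e I / 2 + 2 * q * e I)
      = moment m (Suc p) / (2 * b) + b * moment m p / 2 + 2 * q * moment m p"
    by (simp only: sum.distrib moment_def e_def e'_def Y_def sum_distrib_left[symmetric]
        sum_divide_distrib[symmetric])
  finally have "moment m (Suc p) \<le> b * (moment m (Suc p) / (2 * b) + b * moment m p / 2 + 2 * q * moment m p)"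
    using N_pos by simp
  then have "b * moment m (Suc p) \<le> b * ((b\<^sup>2 + 4 * b * q) * moment m p)"
    using b by (simp add: field_simps power2_eq_square)
  then show ?thesis using b by simp
qed

end

lemma (in tight_frame) moment_le:
  assumes "m \<le> N" "0 \<le> \<kappa>" "\<kappa> \<le> 1" and P: "4 * real P * l \<le> \<kappa> * (real m / real N)"
  shows "moment m P \<le> (5 * \<kappa> * (real m / real N)\<^sup>2) ^ P * (real (card (subsets_of_size m)) * real d)"
proof -
  define q where "q = real m / real N"
  have q0: "0 \<le> q" by (simp add: q_def)
  have "moment m p \<le> (5 * \<kappa> * q\<^sup>2) ^ p * (real (card (subsets_of_size m)) * real d)" if "p \<le> P" for p
    using that
  proof (induction p)
    case 0
    have "frob d (idm d) (idm d) = real d"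
    proof -
      have "(\<Sum>j<d. idm d i j * idm d i j) = 1" if "i < d" for i
      proof -
        have "(\<Sum>j<d. idm d i j * idm d i j) = (\<Sum>j<d. if j = i then 1 else 0)"
          by (intro sum.cong refl) (use that in \<open>auto simp: idm_def\<close>)
        then show ?thesis using that by simp
      qed
      then show ?thesis by (simp add: frob_def)
    qed
    then show ?case by (simp add: moment_def)
  next
    case (Suc p)
    \<comment> \<open>All exponents below \<open>P\<close> satisfy \<open>b \<le> \<kappa> q\<close>, so the recursion has the constant factor \<open>5 \<kappa> q\<^sup>2\<close>.\<close>
    define b where "b = 2 * real (2 * p + 1) * l"
    have b0: "0 \<le> b" using l_pos by (simp add: b_def)
    have "b \<le> 4 * real P * l"
      unfolding b_def using Suc.prems l_pos by (intro mult_right_mono) auto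
    then have b: "b \<le> \<kappa> * q" using P by (simp add: q_def)
    have "b\<^sup>2 \<le> (\<kappa> * q)\<^sup>2" using b b0 by (rule power_mono)
    also have "\<dots> = \<kappa> * (\<kappa> * q\<^sup>2)" by (simp add: power2_eq_square)
    also have "\<dots> \<le> 1 * (\<kappa> * q\<^sup>2)"
      using assms(2,3) by (intro mult_right_mono) auto
    also have "\<dots> = \<kappa> * q\<^sup>2" by simp
    finally have "b\<^sup>2 \<le> \<kappa> * q\<^sup>2" .
    moreover have "b * q \<le> \<kappa> * q\<^sup>2"
      using mult_right_mono[OF b q0] by (simp add: power2_eq_square mult.assoc)
    ultimately have coef: "b\<^sup>2 + 4 * b * q \<le> 5 * \<kappa> * q\<^sup>2" by simp
    have pos: "0 \<le> moment m p" by (auto simp: moment_def intro!: sum_nonneg frob_nonneg)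
    have "moment m (Suc p) \<le> (b\<^sup>2 + 4 * b * q) * moment m p"
      unfolding q_def by (rule moment_Suc_le) (simp_all add: assms b_def)
    also have "\<dots> \<le> (5 * \<kappa> * q\<^sup>2) * moment m p"
      by (rule mult_right_mono[OF coef pos])
    also have "\<dots> \<le> (5 * \<kappa> * q\<^sup>2) * ((5 * \<kappa> * q\<^sup>2) ^ p * (real (card (subsets_of_size m)) * real d))"
      using Suc assms(2) by (intro mult_left_mono) auto
    finally show ?case by (simp add: mult.assoc)
  qed
  then show ?thesis by (simp add: q_def)
qed

text \<open>
  Iterating \<open>Y\<close> on \<open>w\<close> gives a log-convex sequence of norms, so the growth in the first step is at most
  the mean growth over \<open>P\<close> steps, which the Frobenius norm of the power bounds. This replaces the passage
  through the largest eigenvalue.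
\<close>

lemma quadratic_form_le_of_frob_mpow:
  assumes sY: "symm Y" "supp d Y" and "0 < P" "0 \<le> \<eta>"
    and fr: "frob d (mpow d Y P) (mpow d Y P) \<le> \<eta> ^ (2 * P)"
  shows "\<bar>vdot d w (app d Y w)\<bar> \<le> \<eta> * vdot d w w"
proof -
  define v where "v k = app d (mpow d Y k) w" for k
  define b where "b k = vdot d (v k) (v k)" for k
  have b_nonneg: "0 \<le> b k" for k by (simp add: b_def vdot_self_nonneg)
  have vS: "v (Suc k) = app d Y (v k)" for k by (simp add: v_def app_mm)
  have b0: "b 0 = vdot d w w" by (simp add: b_def v_def vdot_def app_idm)
  have logconv: "(b (Suc k))\<^sup>2 \<le> b k * b (Suc (Suc k))" for k
  proof -
    have "b (Suc k) = vdot d (v k) (v (Suc (Suc k)))"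
      using vdot_app_symm[OF sY(1), of d "v k" "v (Suc k)"] by (simp add: b_def vS)
    then show ?thesis using vdot_Cauchy_Schwarz[of d "v k" "v (Suc (Suc k))"] by (simp add: b_def)
  qed
  have ratio: "b 1 * b k \<le> b 0 * b (Suc k)" for k
  proof (induction k)
    case (Suc k)
    show ?case
    proof (cases "b k = 0")
      case True
      then have "b (Suc k) = 0" using logconv[of k] by simp
      then show ?thesis using b_nonneg by simp
    next
      case False
      then have pos: "0 < b k" using b_nonneg[of k] by simp
      have "b k * (b 1 * b (Suc k)) = (b 1 * b k) * b (Suc k)" by simp
      also have "\<dots> \<le> (b 0 * b (Suc k)) * b (Suc k)"
        by (rule mult_right_mono[OF Suc b_nonneg])
      also have "\<dots> = b 0 * (b (Suc k))\<^sup>2" by (simp add: power2_eq_square)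
      also have "\<dots> \<le> b 0 * (b k * b (Suc (Suc k)))"
        by (rule mult_left_mono[OF logconv b_nonneg])
      also have "\<dots> = b k * (b 0 * b (Suc (Suc k)))" by simp
      finally show ?thesis using pos by simp
    qed
  qed simp
  have pw: "b 1 ^ Suc k \<le> b 0 ^ k * b (Suc k)" for k
  proof (induction k)
    case (Suc k)
    have "b 1 ^ Suc (Suc k) \<le> b 1 * (b 0 ^ k * b (Suc k))"
      using mult_left_mono[OF Suc b_nonneg[of 1]] by simp
    also have "\<dots> = b 0 ^ k * (b 1 * b (Suc k))" by simp
    also have "\<dots> \<le> b 0 ^ k * (b 0 * b (Suc (Suc k)))"
      by (intro mult_left_mono ratio zero_le_power b_nonneg)
    finally show ?case by (simp add: mult_ac)
  qed simp
  have bP: "b P \<le> \<eta> ^ (2 * P) * b 0"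
  proof -
    have "b P \<le> (\<Sum>i<d. (\<Sum>j<d. (mpow d Y P i j)\<^sup>2) * (\<Sum>j<d. (w j)\<^sup>2))"
      unfolding b_def v_def vdot_def app_def power2_eq_square[symmetric]
      by (intro sum_mono Cauchy_Schwarz_ineq_sum)
    also have "\<dots> = frob d (mpow d Y P) (mpow d Y P) * b 0"
      by (simp add: frob_def b0 vdot_def sum_distrib_right power2_eq_square)
    also have "\<dots> \<le> \<eta> ^ (2 * P) * b 0" by (rule mult_right_mono[OF fr b_nonneg])
    finally show ?thesis .
  qed
  obtain n where n: "P = Suc n" using \<open>0 < P\<close> by (cases P) auto
  have "b 1 ^ Suc n \<le> b 0 ^ n * (\<eta> ^ (2 * P) * b 0)"
    using pw[of n] mult_left_mono[OF bP zero_le_power[OF b_nonneg[of 0], of n]] n by simp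
  also have "\<dots> = (\<eta>\<^sup>2 * b 0) ^ Suc n"
    by (simp add: n power_mult_distrib power_mult[symmetric] mult_ac power2_eq_square
        power_add[symmetric] mult_2_right)
  finally have b1: "b 1 \<le> \<eta>\<^sup>2 * b 0"
    by (rule power_le_imp_le_base) (simp add: b_nonneg)
  have "v 1 = app d Y w" by (simp add: v_def mm_idm_right sY)
  then have "(vdot d w (app d Y w))\<^sup>2 \<le> b 0 * b 1"
    using vdot_Cauchy_Schwarz[of d w "app d Y w"] by (simp only: b0) (simp add: b_def)
  also have "\<dots> \<le> b 0 * (\<eta>\<^sup>2 * b 0)" by (rule mult_left_mono[OF b1 b_nonneg])
  also have "\<dots> = (\<eta> * b 0)\<^sup>2" by (simp add: power2_eq_square)
  finally show ?thesis
    using b_nonneg[of 0] \<open>0 \<le> \<eta>\<close> by (simp add: abs_le_square_iff[symmetric] b0)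
qed

lemma (in tight_frame) deviation_quadratic_form:
  "vdot d w (app d (deviation m I) w)
    = (\<Sum>a\<in>I. (\<Sum>k<d. x a k * w k)\<^sup>2) - real m / real N * (\<Sum>k<d. (w k)\<^sup>2)"
proof -
  have gr: "app d (gram I) w i = (\<Sum>a\<in>I. x a i * (\<Sum>j<d. x a j * w j))" for i
    unfolding app_def gram_def outer_def sum_distrib_right sum_distrib_left
    by (subst sum.swap) (simp add: mult.assoc)
  have "app d (deviation m I) w i = app d (gram I) w i - real m / real N * app d (idm d) w i" for i
    by (simp add: app_def deviation_def left_diff_distrib sum_subtractf sum_distrib_left mult.assoc
        del: times_divide_eq_left)
  then have "vdot d w (app d (deviation m I) w)
      = (\<Sum>i<d. \<Sum>a\<in>I. w i * (x a i * (\<Sum>j<d. x a j * w j))) - real m / real N * (\<Sum>k<d. (w k)\<^sup>2)"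
    by (simp add: vdot_def app_idm gr right_diff_distrib sum_subtractf sum_distrib_left
        power2_eq_square mult_ac del: times_divide_eq_left)
  also have "(\<Sum>i<d. \<Sum>a\<in>I. w i * (x a i * (\<Sum>j<d. x a j * w j)))
      = (\<Sum>a\<in>I. (\<Sum>k<d. x a k * w k)\<^sup>2)"
  proof -
    have "(\<Sum>i<d. w i * (x a i * c)) = (\<Sum>k<d. x a k * w k) * c" for a c
      by (simp add: sum_distrib_left sum_distrib_right mult_ac)
    then show ?thesis by (subst sum.swap) (simp add: power2_eq_square)
  qed
  finally show ?thesis .
qed

text \<open>
  For rows \<open>x\<close> of a matrix with orthonormal columns, sampled at \<open>I\<close> and rescaled, this is the failure of
  the subspace embedding property with distortion \<open>\<eta>\<close>.
\<close>

definition distorted ::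
  "nat \<Rightarrow> nat \<Rightarrow> (nat \<Rightarrow> nat \<Rightarrow> real) \<Rightarrow> real \<Rightarrow> nat set \<Rightarrow> bool" where
  "distorted d N x \<eta> I \<longleftrightarrow> (\<exists>w. \<eta> * (\<Sum>k<d. (w k)\<^sup>2)
     < \<bar>real N / real (card I) * (\<Sum>a\<in>I. (\<Sum>k<d. x a k * w k)\<^sup>2) - (\<Sum>k<d. (w k)\<^sup>2)\<bar>)"

text \<open>
  Markov's inequality for the moment of order \<open>2 P\<close>. The factor \<open>1 / (5 e)\<close> in the size condition
  is chosen such that each of the \<open>P\<close> factors of the moment bound contributes \<open>e\<^sup>-\<^sup>1\<close>; the factor \<open>d\<close>
  is the trace of the identity.
\<close>

lemma (in tight_frame) prob_distorted_le:
  assumes m: "0 < m" "m \<le> N" and \<eta>: "0 < \<eta>" "\<eta> \<le> 1" and "0 < P"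
    and P: "4 * real P * l \<le> \<eta>\<^sup>2 / (5 * exp 1) * (real m / real N)"
  shows "measure_pmf.prob (index_law N m) {I. distorted d N x \<eta> I} \<le> real d * exp (- real P)"
proof -
  define q where "q = real m / real N"
  have q: "0 < q" using m N_pos by (simp add: q_def)
  define \<kappa> where "\<kappa> = \<eta>\<^sup>2 / (5 * exp (1::real))"
  have \<kappa>: "0 \<le> \<kappa>" "\<kappa> \<le> 1"
  proof -
    have "\<eta>\<^sup>2 \<le> 1" using \<eta> by (simp add: power_le_one)
    moreover have "(1::real) \<le> 5 * exp 1" using exp_ge_add_one_self[of "1::real"] by simp
    ultimately show "\<kappa> \<le> 1" by (simp add: \<kappa>_def divide_le_eq)
  qed (simp add: \<kappa>_def)
  define S where "S = subsets_of_size m"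
  define E where "E I = frob d (mpow d (deviation m I) P) (mpow d (deviation m I) P)" for I
  define B where "B = {I \<in> S. distorted d N x \<eta> I}"
  have fin: "finite S" by (simp add: S_def finite_subsets_of_size)
  have ne: "S \<noteq> {}"
  proof -
    have "{..<m} \<in> S" using m by (auto simp: S_def subsets_of_size_def)
    then show ?thesis by auto
  qed
  have E_nonneg: "0 \<le> E I" for I by (simp add: E_def frob_nonneg)
  have big: "(\<eta> * q) ^ (2 * P) \<le> E I" if "I \<in> B" for I
  proof (rule ccontr)
    assume "\<not> ?thesis"
    then have "E I \<le> (\<eta> * q) ^ (2 * P)" by simp
    note bound = quadratic_form_le_of_frob_mpow[OF deviation_symm deviation_supp \<open>0 < P\<close> _ this[unfolded E_def]]
    have "card I = m" using that by (simp add: B_def S_def subsets_of_size_def)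
    have "\<not> distorted d N x \<eta> I"
      unfolding distorted_def not_ex not_less
    proof
      fix w
      have "\<bar>(\<Sum>a\<in>I. (\<Sum>k<d. x a k * w k)\<^sup>2) - q * (\<Sum>k<d. (w k)\<^sup>2)\<bar> \<le> \<eta> * q * (\<Sum>k<d. (w k)\<^sup>2)"
        using bound[of w, unfolded deviation_quadratic_form] q \<eta>
        by (simp add: q_def vdot_def power2_eq_square[symmetric])
      then have "\<bar>(\<Sum>a\<in>I. (\<Sum>k<d. x a k * w k)\<^sup>2) - q * (\<Sum>k<d. (w k)\<^sup>2)\<bar> / q
          \<le> \<eta> * (\<Sum>k<d. (w k)\<^sup>2)"
        using q by (simp add: divide_le_eq mult_ac)
      also have "\<bar>(\<Sum>a\<in>I. (\<Sum>k<d. x a k * w k)\<^sup>2) - q * (\<Sum>k<d. (w k)\<^sup>2)\<bar> / q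
          = \<bar>((\<Sum>a\<in>I. (\<Sum>k<d. x a k * w k)\<^sup>2) - q * (\<Sum>k<d. (w k)\<^sup>2)) / q\<bar>"
        using q by (simp add: abs_divide)
      also have "((\<Sum>a\<in>I. (\<Sum>k<d. x a k * w k)\<^sup>2) - q * (\<Sum>k<d. (w k)\<^sup>2)) / q
          = real N / real (card I) * (\<Sum>a\<in>I. (\<Sum>k<d. x a k * w k)\<^sup>2) - (\<Sum>k<d. (w k)\<^sup>2)"
        using q m N_pos \<open>card I = m\<close> by (simp add: q_def field_simps)
      finally show "\<bar>real N / real (card I) * (\<Sum>a\<in>I. (\<Sum>k<d. x a k * w k)\<^sup>2) - (\<Sum>k<d. (w k)\<^sup>2)\<bar>
          \<le> \<eta> * (\<Sum>k<d. (w k)\<^sup>2)" .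
    qed
    then show False using that by (simp add: B_def)
  qed
  have "(\<eta> * q) ^ (2 * P) * real (card B) = (\<Sum>I\<in>B. (\<eta> * q) ^ (2 * P))" by simp
  also have "\<dots> \<le> (\<Sum>I\<in>B. E I)" by (intro sum_mono big)
  also have "\<dots> \<le> (\<Sum>I\<in>S. E I)" by (intro sum_mono2) (auto simp: fin B_def E_nonneg)
  also have "\<dots> = moment m P" by (simp add: moment_def E_def S_def)
  also have "\<dots> \<le> (5 * \<kappa> * q\<^sup>2) ^ P * (real (card S) * real d)"
    unfolding q_def S_def by (rule moment_le) (use m \<kappa> P in \<open>simp_all add: \<kappa>_def\<close>)
  also have "5 * \<kappa> * q\<^sup>2 = (\<eta> * q)\<^sup>2 * exp (- 1)"
    by (simp add: \<kappa>_def power_mult_distrib exp_minus field_simps)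
  also have "((\<eta> * q)\<^sup>2 * exp (- 1)) ^ P = (\<eta> * q) ^ (2 * P) * exp (- real P)"
    by (simp add: power_mult_distrib power_mult exp_of_nat_mult[symmetric])
  finally have "(\<eta> * q) ^ (2 * P) * real (card B)
      \<le> (\<eta> * q) ^ (2 * P) * (exp (- real P) * (real (card S) * real d))" by (simp add: mult.assoc)
  then have card_B: "real (card B) \<le> exp (- real P) * (real (card S) * real d)"
    using q \<eta> by simp
  have "measure_pmf.prob (index_law N m) {I. distorted d N x \<eta> I} = real (card B) / real (card S)"
    unfolding index_law_def S_def[unfolded subsets_of_size_def, symmetric]
    by (subst measure_pmf_of_set) (auto simp: fin ne B_def Int_def)
  also have "\<dots> \<le> real d * exp (- real P)"
    using card_B ne fin by (simp add: divide_le_eq card_gt_0_iff mult_ac)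
  finally show ?thesis .
qed

section \<open>Row norms after random signs\<close>

lemma power_Suc_diff_le:
  fixes A B :: real
  assumes "0 \<le> B" "B \<le> A"
  shows "A ^ p - B ^ p \<le> real p * (A - B) * A ^ (p - 1)"
proof (induction p)
  case (Suc p)
  have "A ^ Suc p - B ^ Suc p = A * (A ^ p - B ^ p) + (A - B) * B ^ p"
    by (simp add: algebra_simps)
  also have "\<dots> \<le> A * (real p * (A - B) * A ^ (p - 1)) + (A - B) * A ^ p"
    using Suc assms by (intro add_mono mult_left_mono power_mono) auto
  also have "\<dots> = real (Suc p) * (A - B) * A ^ (Suc p - 1)"
    by (cases p) (simp_all add: algebra_simps)
  finally show ?case .
qed simp

text \<open>
  For two points \<open>z + u\<close> and \<open>z - u\<close> with squared norms \<open>A\<close> and \<open>B\<close>, let \<open>h\<close> be the inner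
  product of \<open>z\<close> and \<open>u\<close>, and \<open>c\<close> the squared norm of \<open>u\<close>. The mean value theorem bounds \<open>A\<^sup>p - B\<^sup>p\<close> by the larger
  of the two points, and this is also the one whose inner product \<open>h + c\<close> or \<open>h - c\<close> with \<open>u\<close> is at
  least \<open>\<bar>h\<bar>\<close> in absolute value.
\<close>

lemma increment_times_power_diff_le:
  fixes A B h c :: real
  assumes "0 \<le> A" "0 \<le> B" "A - B = 4 * h" "0 \<le> c"
  shows "h * (A ^ p - B ^ p) \<le> 4 * real p * ((h + c)\<^sup>2 * A ^ (p - 1) + (h - c)\<^sup>2 * B ^ (p - 1))"
proof -
  have gen: "g * (C ^ p - D ^ p) \<le> 4 * real p * ((g + c)\<^sup>2 * C ^ (p - 1) + (g - c)\<^sup>2 * D ^ (p - 1))"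
    if "0 \<le> g" "0 \<le> C" "0 \<le> D" "C - D = 4 * g" for g C D :: real
  proof -
    have "g * (C ^ p - D ^ p) \<le> g * (real p * (C - D) * C ^ (p - 1))"
      using power_Suc_diff_le[of D C p] that by (intro mult_left_mono) auto
    also have "\<dots> = 4 * real p * (g\<^sup>2 * C ^ (p - 1))"
      using that by (simp add: power2_eq_square)
    also have "\<dots> \<le> 4 * real p * ((g + c)\<^sup>2 * C ^ (p - 1) + (g - c)\<^sup>2 * D ^ (p - 1))"
    proof (intro mult_left_mono)
      have "g\<^sup>2 \<le> (g + c)\<^sup>2" using that assms by (intro power_mono) auto
      then have "g\<^sup>2 * C ^ (p - 1) \<le> (g + c)\<^sup>2 * C ^ (p - 1)"
        using that by (intro mult_right_mono) auto
      moreover have "0 \<le> (g - c)\<^sup>2 * D ^ (p - 1)" using that by simp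
      ultimately show "g\<^sup>2 * C ^ (p - 1) \<le> (g + c)\<^sup>2 * C ^ (p - 1) + (g - c)\<^sup>2 * D ^ (p - 1)"
        by linarith
    qed simp
    finally show ?thesis .
  qed
  show ?thesis
  proof (cases "0 \<le> h")
    case True
    then show ?thesis using gen assms by simp
  next
    case False
    have "(h - c)\<^sup>2 = (- h + c)\<^sup>2" "(h + c)\<^sup>2 = (- h - c)\<^sup>2"
      by (simp_all add: power2_eq_square algebra_simps)
    moreover have "h * (A ^ p - B ^ p) = - h * (B ^ p - A ^ p)" by (simp add: algebra_simps)
    ultimately show ?thesis using gen[of "- h" B A] False assms by (simp add: add.commute)
  qed
qed

definition sign_vectors :: "nat \<Rightarrow> (nat \<Rightarrow> real) set" where
  "sign_vectors N = PiE_dflt {..<N} 1 (\<lambda>_. {- 1, 1})"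

lemma finite_sign_vectors: "finite (sign_vectors N)"
  unfolding sign_vectors_def by (rule finite_PiE_dflt) auto

lemma sign_vectors_sq: "s \<in> sign_vectors N \<Longrightarrow> s j * s j = 1"
  by (cases "j < N") (auto simp: sign_vectors_def PiE_dflt_def)

lemma flip_sign_vectors: "s \<in> sign_vectors N \<Longrightarrow> j < N \<Longrightarrow> s(j := - s j) \<in> sign_vectors N"
  by (force simp: sign_vectors_def PiE_dflt_def)

lemma sum_flip_sign:
  assumes "j < N"
  shows "(\<Sum>s\<in>sign_vectors N. f (s(j := - s j))) = (\<Sum>s\<in>sign_vectors N. f s)"
  by (rule sum.reindex_bij_witness[of _ "\<lambda>s. s(j := - s j)" "\<lambda>s. s(j := - s j)"])
     (auto simp: flip_sign_vectors assms)

lemma Pi_pmf_signs: "Pi_pmf {..<N} 1 (\<lambda>_. pmf_of_set {- 1, 1}) = pmf_of_set (sign_vectors N)"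
  unfolding sign_vectors_def by (rule Pi_pmf_of_set) auto

lemma sign_vectors_nonempty: "sign_vectors N \<noteq> {}"
proof -
  have "(\<lambda>_. 1) \<in> sign_vectors N" by (auto simp: sign_vectors_def PiE_dflt_def)
  then show ?thesis by auto
qed

text \<open>
  The matrices \<open>u\<^sub>j u\<^sub>j\<^sup>T\<close> sum to the identity of dimension \<open>d\<close>, that is, Parseval's identity holds for the
  family \<open>u\<close>.
\<close>

locale parseval =
  fixes d N :: nat and u :: "nat \<Rightarrow> nat \<Rightarrow> real"
  assumes parseval: "\<And>k k'. k < d \<Longrightarrow> k' < d \<Longrightarrow> (\<Sum>j<N. u j k * u j k') = idm d k k'"
begin

lemma sum_sq_vdot: "(\<Sum>j<N. (\<Sum>k<d. u j k * w k)\<^sup>2) = (\<Sum>k<d. (w k)\<^sup>2)"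
proof -
  have "(\<Sum>j<N. (\<Sum>k<d. u j k * w k)\<^sup>2) = (\<Sum>j<N. \<Sum>k<d. \<Sum>k'<d. w k * w k' * (u j k * u j k'))"
    by (simp add: power2_eq_square sum_product mult_ac)
  also have "\<dots> = (\<Sum>k<d. \<Sum>j<N. \<Sum>k'<d. w k * w k' * (u j k * u j k'))" by (rule sum.swap)
  also have "\<dots> = (\<Sum>k<d. \<Sum>k'<d. \<Sum>j<N. w k * w k' * (u j k * u j k'))"
    by (intro sum.cong refl sum.swap)
  also have "\<dots> = (\<Sum>k<d. \<Sum>k'<d. w k * w k' * idm d k k')"
    by (simp add: sum_distrib_left[symmetric] parseval)
  also have "\<dots> = (\<Sum>k<d. \<Sum>k'<d. if k' = k then (w k)\<^sup>2 else 0)"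
    by (intro sum.cong refl) (auto simp: idm_def power2_eq_square)
  finally show ?thesis by simp
qed

lemma sum_sq_entries: "(\<Sum>j<N. \<Sum>k<d. (u j k)\<^sup>2) = real d"
proof -
  have "(\<Sum>j<N. \<Sum>k<d. (u j k)\<^sup>2) = (\<Sum>k<d. \<Sum>j<N. u j k * u j k)"
    by (subst sum.swap) (simp add: power2_eq_square)
  also have "\<dots> = (\<Sum>k<d. 1)"
    by (intro sum.cong refl) (simp add: parseval idm_def)
  finally show ?thesis by simp
qed

definition rsum :: "(nat \<Rightarrow> real) \<Rightarrow> nat \<Rightarrow> real" where
  "rsum s k = (\<Sum>j<N. s j * u j k)"

definition rsq :: "(nat \<Rightarrow> real) \<Rightarrow> real" where
  "rsq s = (\<Sum>k<d. (rsum s k)\<^sup>2)"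

lemma rsq_nonneg: "0 \<le> rsq s"
  by (auto simp: rsq_def intro!: sum_nonneg)

lemma rsum_flip: "j < N \<Longrightarrow> rsum (s(j := - s j)) k = rsum s k - 2 * s j * u j k"
proof -
  assume j: "j < N"
  have "rsum s k = s j * u j k + (\<Sum>i\<in>{..<N} - {j}. s i * u i k)"
    unfolding rsum_def by (rule sum.remove) (use j in auto)
  moreover have "rsum (s(j := - s j)) k
      = - s j * u j k + (\<Sum>i\<in>{..<N} - {j}. (s(j := - s j)) i * u i k)"
    unfolding rsum_def using j by (subst sum.remove[of _ j]) auto
  moreover have "(\<Sum>i\<in>{..<N} - {j}. (s(j := - s j)) i * u i k) = (\<Sum>i\<in>{..<N} - {j}. s i * u i k)"
    by (intro sum.cong) auto
  ultimately show ?thesis by simp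
qed

text \<open>
  Write one factor of the power as the sum over \<open>j\<close> of the inner products of the random sum with its \<open>j\<close>-th
  summand, and antisymmetrize the \<open>j\<close>-th term under the flip of the \<open>j\<close>-th sign. The resulting
  differences are bounded by \<open>increment_times_power_diff_le\<close>, and Parseval's identity sums the bounds: the
  squared norms of the \<open>u\<^sub>j\<close> add up to \<open>d\<close>, the squared inner products to the squared norm.
\<close>

lemma rsq_moment_Suc_le:
  "(\<Sum>s\<in>sign_vectors N. rsq s ^ Suc p)
    \<le> (real d + 4 * real p) * (\<Sum>s\<in>sign_vectors N. rsq s ^ p)"
proof -
  define ip where "ip j s = (\<Sum>k<d. u j k * rsum s k)" for j s
  define c where "c j = (\<Sum>k<d. (u j k)\<^sup>2)" for j
  define F where "F j s = c j * rsq s ^ p + 4 * real p * ((ip j s)\<^sup>2 * rsq s ^ (p - 1))" for j s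
  have one: "(\<Sum>s\<in>sign_vectors N. s j * ip j s * rsq s ^ p) \<le> (\<Sum>s\<in>sign_vectors N. F j s)"
    if j: "j < N" for j
  proof -
    define G where "G s = s j * ip j s * rsq s ^ p" for s
    define fl where "fl s = s(j := - s j)" for s :: "nat \<Rightarrow> real"
    have pair: "G s + G (fl s) \<le> F j s + F j (fl s)" if s: "s \<in> sign_vectors N" for s
    proof -
      \<comment> \<open>With \<open>u = s\<^sub>j u\<^sub>j\<close>, the random sum is \<open>z + u\<close> and the one with the flipped sign \<open>z - u\<close>.\<close>
      define h where "h = s j * ip j s - c j"
      have sq: "s j * s j = 1" by (rule sign_vectors_sq[OF s])
      have c0: "0 \<le> c j" by (auto simp: c_def intro!: sum_nonneg)
      have ipf: "ip j (fl s) = ip j s - 2 * s j * c j"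
        by (simp add: ip_def fl_def rsum_flip[OF j] right_diff_distrib sum_subtractf c_def
            sum_distrib_left power2_eq_square mult_ac)
      have "rsq (fl s) = (\<Sum>k<d. (rsum s k)\<^sup>2 - 4 * s j * (u j k * rsum s k)
          + 4 * (s j * s j) * (u j k)\<^sup>2)"
        unfolding rsq_def fl_def
        by (intro sum.cong refl) (simp only: rsum_flip[OF j], simp add: power2_eq_square algebra_simps)
      also have "\<dots> = rsq s - 4 * s j * ip j s + 4 * (s j * s j) * c j"
        by (simp only: sum.distrib sum_subtractf rsq_def ip_def c_def sum_distrib_left)
      also have "\<dots> = rsq s - 4 * h" by (simp add: sq h_def)
      finally have B: "rsq s - rsq (fl s) = 4 * h" by simp
      have e1: "s j * ip j s = h + c j" by (simp add: h_def)
      have e2: "fl s j * ip j (fl s) = - (h - c j)"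
        using sq by (simp add: fl_def[of s] ipf[unfolded fl_def] h_def algebra_simps)
      have q1: "(ip j s)\<^sup>2 = (h + c j)\<^sup>2"
        unfolding e1[symmetric] using sq by (simp add: power_mult_distrib power2_eq_square)
      have q2: "(ip j (fl s))\<^sup>2 = (h - c j)\<^sup>2"
      proof -
        have "(fl s j * ip j (fl s))\<^sup>2 = (h - c j)\<^sup>2" by (simp only: e2 power2_minus)
        moreover have "(fl s j)\<^sup>2 = 1" using sq by (simp add: fl_def power2_eq_square)
        ultimately show ?thesis by (simp add: power_mult_distrib)
      qed
      have "G s + G (fl s) = c j * rsq s ^ p + c j * rsq (fl s) ^ p + h * (rsq s ^ p - rsq (fl s) ^ p)"
        unfolding G_def e1 e2 by (simp add: algebra_simps)
      also have "h * (rsq s ^ p - rsq (fl s) ^ p)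
          \<le> 4 * real p * ((h + c j)\<^sup>2 * rsq s ^ (p - 1) + (h - c j)\<^sup>2 * rsq (fl s) ^ (p - 1))"
        by (rule increment_times_power_diff_le[OF rsq_nonneg rsq_nonneg B c0])
      finally show ?thesis by (simp add: F_def q1 q2 algebra_simps)
    qed
    have "2 * (\<Sum>s\<in>sign_vectors N. G s) = (\<Sum>s\<in>sign_vectors N. G s + G (fl s))"
      using sum_flip_sign[OF j, of G] by (simp add: sum.distrib fl_def)
    also have "\<dots> \<le> (\<Sum>s\<in>sign_vectors N. F j s + F j (fl s))" by (intro sum_mono pair)
    also have "\<dots> = 2 * (\<Sum>s\<in>sign_vectors N. F j s)"
      using sum_flip_sign[OF j, of "F j"] by (simp add: sum.distrib fl_def)
    finally show ?thesis by (simp add: G_def)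
  qed
  have "(\<Sum>s\<in>sign_vectors N. rsq s ^ Suc p)
      = (\<Sum>s\<in>sign_vectors N. \<Sum>j<N. s j * ip j s * rsq s ^ p)"
  proof (intro sum.cong refl)
    fix s
    have "(\<Sum>j<N. s j * ip j s) = (\<Sum>j<N. \<Sum>k<d. s j * u j k * rsum s k)"
      by (simp add: ip_def sum_distrib_left mult.assoc)
    also have "\<dots> = (\<Sum>k<d. \<Sum>j<N. s j * u j k * rsum s k)" by (rule sum.swap)
    also have "\<dots> = rsq s"
      by (simp add: rsq_def power2_eq_square sum_distrib_right[symmetric] rsum_def)
    finally show "rsq s ^ Suc p = (\<Sum>j<N. s j * ip j s * rsq s ^ p)"
      by (simp add: sum_distrib_right[symmetric])
  qed
  also have "\<dots> = (\<Sum>j<N. \<Sum>s\<in>sign_vectors N. s j * ip j s * rsq s ^ p)" by (rule sum.swap)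
  also have "\<dots> \<le> (\<Sum>j<N. \<Sum>s\<in>sign_vectors N. F j s)" by (intro sum_mono one) simp
  also have "\<dots> = (\<Sum>s\<in>sign_vectors N. \<Sum>j<N. F j s)" by (rule sum.swap)
  also have "\<dots> = (\<Sum>s\<in>sign_vectors N. (real d + 4 * real p) * rsq s ^ p)"
  proof (intro sum.cong refl)
    fix s
    have ip2: "(\<Sum>j<N. (ip j s)\<^sup>2) = rsq s" by (simp add: ip_def sum_sq_vdot rsq_def)
    have c1: "(\<Sum>j<N. c j) = real d" by (simp add: c_def sum_sq_entries)
    have "(\<Sum>j<N. F j s) = (\<Sum>j<N. c j) * rsq s ^ p
        + 4 * real p * ((\<Sum>j<N. (ip j s)\<^sup>2) * rsq s ^ (p - 1))"
      by (simp add: F_def sum.distrib sum_distrib_left sum_distrib_right)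
    also have "\<dots> = (real d + 4 * real p) * rsq s ^ p"
      unfolding ip2 c1 by (cases p) (simp_all add: algebra_simps)
    finally show "(\<Sum>j<N. F j s) = (real d + 4 * real p) * rsq s ^ p" .
  qed
  finally show ?thesis by (simp add: sum_distrib_left)
qed

text \<open>
  Markov's inequality for the moment of order \<open>2 P\<close>; the factor \<open>e\<close> in the threshold produces the decay.
\<close>

lemma card_rsq_large_le:
  assumes "0 < d"
  shows "real (card {s \<in> sign_vectors N. exp 1 * (real d + 4 * real P) < rsq s})
    \<le> exp (- real P) * real (card (sign_vectors N))"
proof -
  define L where "L = real d + 4 * real P"
  have L: "0 < L" using assms by (simp add: L_def)
  have mom: "(\<Sum>s\<in>sign_vectors N. rsq s ^ p) \<le> L ^ p * real (card (sign_vectors N))" if "p \<le> P" for p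
    using that
  proof (induction p)
    case (Suc p)
    have "(\<Sum>s\<in>sign_vectors N. rsq s ^ Suc p) \<le> (real d + 4 * real p) * (\<Sum>s\<in>sign_vectors N. rsq s ^ p)"
      by (rule rsq_moment_Suc_le)
    also have "\<dots> \<le> L * (L ^ p * real (card (sign_vectors N)))"
      using Suc L by (intro mult_mono) (auto simp: L_def intro!: sum_nonneg zero_le_power rsq_nonneg)
    finally show ?case by (simp add: mult.assoc)
  qed simp
  define B where "B = {s \<in> sign_vectors N. exp 1 * L < rsq s}"
  have "(exp 1 * L) ^ P * real (card B) = (\<Sum>s\<in>B. (exp 1 * L) ^ P)" by simp
  also have "\<dots> \<le> (\<Sum>s\<in>B. rsq s ^ P)"
    using L by (intro sum_mono power_mono) (auto simp: B_def)
  also have "\<dots> \<le> (\<Sum>s\<in>sign_vectors N. rsq s ^ P)"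
    by (intro sum_mono2) (auto simp: B_def finite_sign_vectors rsq_nonneg)
  also have "\<dots> \<le> L ^ P * real (card (sign_vectors N))" by (rule mom) simp
  finally have "L ^ P * (exp (real P) * real (card B)) \<le> L ^ P * real (card (sign_vectors N))"
    by (simp add: power_mult_distrib exp_of_nat_mult[symmetric] mult_ac)
  then have "exp (real P) * real (card B) \<le> real (card (sign_vectors N))" using L by simp
  then show ?thesis
    by (simp add: B_def L_def exp_minus field_simps)
qed

end

text \<open>
  A union bound over an exceptional set of the first component and, outside of it, the conditional
  probability given the first component.
\<close>

lemma prob_pair_le:
  assumes "measure_pmf.prob p B \<le> a" "0 \<le> b"
    and "\<And>x. x \<in> set_pmf p \<Longrightarrow> x \<notin> B \<Longrightarrow> measure_pmf.prob q {y. (x, y) \<in> A} \<le> b"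
  shows "measure_pmf.prob (pair_pmf p q) A \<le> a + b"
proof -
  have "emeasure (measure_pmf (pair_pmf p q)) A = (\<integral>\<^sup>+ x. emeasure (measure_pmf q) {y. (x, y) \<in> A} \<partial>measure_pmf p)"
  proof -
    have "pair_pmf p q = bind_pmf p (\<lambda>x. map_pmf (Pair x) q)"
      by (simp add: pair_pmf_def map_pmf_def)
    then show ?thesis by (simp add: vimage_def)
  qed
  also have "\<dots> \<le> (\<integral>\<^sup>+ x. indicator B x + ennreal b \<partial>measure_pmf p)"
  proof (rule nn_integral_mono_AE, rule AE_pmfI)
    fix x assume x: "x \<in> set_pmf p"
    show "emeasure (measure_pmf q) {y. (x, y) \<in> A} \<le> indicator B x + ennreal b"
    proof (cases "x \<in> B")
      case True
      have "emeasure (measure_pmf q) {y. (x, y) \<in> A} \<le> 1" by (rule measure_pmf.emeasure_le_1)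
      also have "(1 :: ennreal) \<le> 1 + ennreal b" by simp
      finally show ?thesis using True by simp
    next
      case False
      then show ?thesis
        using assms(2) assms(3)[OF x] by (simp add: measure_pmf.emeasure_eq_measure ennreal_leI)
    qed
  qed
  also have "\<dots> = emeasure (measure_pmf p) B + ennreal b"
    by (subst nn_integral_add) auto
  also have "\<dots> = ennreal (measure_pmf.prob p B + b)"
    using assms(2) by (simp add: measure_pmf.emeasure_eq_measure ennreal_plus[symmetric] del: ennreal_plus)
  finally have "measure_pmf.prob (pair_pmf p q) A \<le> measure_pmf.prob p B + b"
    using assms(2) by (simp add: measure_pmf.emeasure_eq_measure del: ennreal_plus)
  then show ?thesis using assms(1) by simp
qed

text \<open>
  Both stages combined. Up to the signs of the entries of the \<open>i\<close>-th row of \<open>H\<close>, the \<open>i\<close>-th mixed row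
  is \<open>1 / sqrt N\<close> times a random signed sum of a Parseval family; a union bound over the \<open>N\<close> rows controls all
  their norms. For fixed signs, the mixed rows again have orthonormal columns, so the sampling bound applies.
\<close>

lemma (in parseval) prob_mixed_rows_distorted_le:
  fixes H :: "nat \<Rightarrow> nat \<Rightarrow> real"
  assumes d: "0 < d" and N: "0 < N"
    and H_sq: "\<And>i j. i < N \<Longrightarrow> j < N \<Longrightarrow> (H i j)\<^sup>2 = 1 / real N"
    and H_orth: "\<And>j j'. j < N \<Longrightarrow> j' < N \<Longrightarrow> (\<Sum>i<N. H i j * H i j') = (if j = j' then 1 else 0)"
    and m: "0 < m" "m \<le> N" and \<eta>: "0 < \<eta>" "\<eta> \<le> 1" and "0 < P"
    and P: "4 * real P * (exp 1 * (real d + 4 * real Q)) \<le> \<eta>\<^sup>2 / (5 * exp 1) * real m"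
  shows "measure_pmf.prob
      (pair_pmf (Pi_pmf {..<N} 1 (\<lambda>_. pmf_of_set {- 1, 1})) (index_law N m))
      {(s, I). distorted d N (\<lambda>i k. \<Sum>j<N. H i j * s j * u j k) \<eta> I}
    \<le> real N * exp (- real Q) + real d * exp (- real P)"
proof -
  define x where "x s i k = (if k < d then \<Sum>j<N. H i j * s j * u j k else 0)" for s i k
  define L where "L = exp 1 * (real d + 4 * real Q)"
  have L: "0 < L" using d by (simp add: L_def)
  define B where "B = {s. \<exists>i<N. L / real N < (\<Sum>k<d. (x s i k)\<^sup>2)}"
  have dist: "distorted d N (\<lambda>i k. \<Sum>j<N. H i j * s j * u j k) \<eta> I \<longleftrightarrow> distorted d N (x s) \<eta> I" for s I
    by (simp add: distorted_def x_def)
  have row: "real (card {s \<in> sign_vectors N. L / real N < (\<Sum>k<d. (x s i k)\<^sup>2)})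
      \<le> exp (- real Q) * real (card (sign_vectors N))" if i: "i < N" for i
  proof -
    define v where "v j k = sqrt (real N) * H i j * u j k" for j k
    have "(\<Sum>j<N. v j k * v j k') = idm d k k'" if "k < d" "k' < d" for k k'
    proof -
      have "(\<Sum>j<N. v j k * v j k') = (\<Sum>j<N. real N * (H i j)\<^sup>2 * (u j k * u j k'))"
      proof (intro sum.cong refl)
        fix j
        have "v j k * v j k' = (sqrt (real N) * sqrt (real N)) * (H i j)\<^sup>2 * (u j k * u j k')"
          by (simp only: v_def power2_eq_square mult_ac)
        then show "v j k * v j k' = real N * (H i j)\<^sup>2 * (u j k * u j k')" by simp
      qed
      also have "\<dots> = (\<Sum>j<N. u j k * u j k')"
        by (intro sum.cong refl) (use i N in \<open>simp add: H_sq\<close>)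
      finally show ?thesis using parseval that by simp
    qed
    then interpret v: parseval d N v by unfold_locales
    have "v.rsq s = real N * (\<Sum>k<d. (x s i k)\<^sup>2)" for s
    proof -
      have "v.rsum s k = sqrt (real N) * x s i k" if "k < d" for k
        using that by (simp add: v.rsum_def v_def x_def sum_distrib_left mult_ac)
      then show ?thesis by (simp add: v.rsq_def power_mult_distrib sum_distrib_left)
    qed
    then have "{s \<in> sign_vectors N. L / real N < (\<Sum>k<d. (x s i k)\<^sup>2)} = {s \<in> sign_vectors N. L < v.rsq s}"
      using N by (simp add: field_simps)
    then show ?thesis using v.card_rsq_large_le[OF d, of Q] by (simp add: L_def)
  qed
  have "measure_pmf.prob (pmf_of_set (sign_vectors N)) B \<le> real N * exp (- real Q)"
  proof -
    have "sign_vectors N \<inter> B = (\<Union>i<N. {s \<in> sign_vectors N. L / real N < (\<Sum>k<d. (x s i k)\<^sup>2)})"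
      by (auto simp: B_def)
    then have "real (card (sign_vectors N \<inter> B))
        \<le> (\<Sum>i<N. real (card {s \<in> sign_vectors N. L / real N < (\<Sum>k<d. (x s i k)\<^sup>2)}))"
      using card_UN_le[of "{..<N}" "\<lambda>i. {s \<in> sign_vectors N. L / real N < (\<Sum>k<d. (x s i k)\<^sup>2)}"]
      by (simp flip: of_nat_sum)
    also have "\<dots> \<le> (\<Sum>i<N. exp (- real Q) * real (card (sign_vectors N)))"
      by (intro sum_mono row) simp
    finally show ?thesis
      using sign_vectors_nonempty[of N] finite_sign_vectors[of N]
      by (simp add: measure_pmf_of_set divide_le_eq card_gt_0_iff)
  qed
  moreover have "measure_pmf.prob (index_law N m) {I. distorted d N (x s) \<eta> I} \<le> real d * exp (- real P)"
    if s: "s \<in> sign_vectors N" "s \<notin> B" for s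
  proof -
    interpret tight_frame d N "x s" "L / real N"
    proof
      fix k k' assume k: "k < d" "k' < d"
      have "(\<Sum>i<N. x s i k * x s i k')
          = (\<Sum>i<N. \<Sum>j<N. \<Sum>j'<N. (H i j * H i j') * (s j * s j' * u j k * u j' k'))"
        unfolding x_def if_P[OF k(1)] if_P[OF k(2)] sum_product
        by (intro sum.cong refl) (simp add: mult_ac)
      also have "\<dots> = (\<Sum>j<N. \<Sum>i<N. \<Sum>j'<N. (H i j * H i j') * (s j * s j' * u j k * u j' k'))"
        by (rule sum.swap)
      also have "\<dots> = (\<Sum>j<N. \<Sum>j'<N. \<Sum>i<N. (H i j * H i j') * (s j * s j' * u j k * u j' k'))"
        by (intro sum.cong refl sum.swap)
      also have "\<dots> = (\<Sum>j<N. \<Sum>j'<N. if j' = j then u j k * u j k' else 0)"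
        by (intro sum.cong refl) (use sign_vectors_sq[OF s(1)] in
            \<open>auto simp: sum_distrib_right[symmetric] H_orth\<close>)
      also have "\<dots> = idm d k k'" using parseval[OF k] by simp
      finally show "(\<Sum>i<N. x s i k * x s i k') = idm d k k'" .
    next
      fix i assume "i < N"
      with s(2) have "\<not> L / real N < (\<Sum>k<d. (x s i k)\<^sup>2)" unfolding B_def by blast
      then show "(\<Sum>k<d. (x s i k)\<^sup>2) \<le> L / real N" by simp
    qed (use N L in \<open>auto simp: x_def\<close>)
    show ?thesis
    proof (rule prob_distorted_le[OF m \<eta> \<open>0 < P\<close>])
      show "4 * real P * (L / real N) \<le> \<eta>\<^sup>2 / (5 * exp 1) * (real m / real N)"
        using divide_right_mono[OF P, of "real N"] by (simp add: L_def)
    qed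
  qed
  ultimately show ?thesis
    unfolding Pi_pmf_signs
    by (intro prob_pair_le[of _ B]) (auto simp: dist finite_sign_vectors sign_vectors_nonempty)
qed

section \<open>Square roots of positive semidefinite matrices\<close>

text \<open>
  The Taylor coefficients of \<open>1 - sqrt (1 - x)\<close>. The recursion expresses that \<open>f = 1 - sqrt (1 - x)\<close> solves
  \<open>f\<^sup>2 = 2 f - x\<close>, and it shows at once that the coefficients are nonnegative.
\<close>

fun sqrt_coeff :: "nat \<Rightarrow> real" where
  "sqrt_coeff n = (if n = 0 then 0 else if n = 1 then 1 / 2
     else (\<Sum>k\<in>{1..<n}. sqrt_coeff k * sqrt_coeff (n - k)) / 2)"

declare sqrt_coeff.simps [simp del]

lemma sqrt_coeff_nonneg: "0 \<le> sqrt_coeff n"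
proof (induction n rule: less_induct)
  case (less n)
  have "0 \<le> (\<Sum>k\<in>{1..<n}. sqrt_coeff k * sqrt_coeff (n - k))"
    using less by (intro sum_nonneg mult_nonneg_nonneg) auto
  then show ?case by (subst sqrt_coeff.simps) auto
qed

lemma sqrt_coeff_0: "sqrt_coeff 0 = 0"
  by (simp add: sqrt_coeff.simps)

lemma sqrt_coeff_index_pos: "sqrt_coeff n \<noteq> 0 \<Longrightarrow> Suc 0 \<le> n"
  by (cases n) (simp_all add: sqrt_coeff_0)

lemma sqrt_coeff_convolution:
  "(\<Sum>k\<le>n. sqrt_coeff k * sqrt_coeff (n - k)) = 2 * sqrt_coeff n - (if n = 1 then 1 else 0)"
proof (cases "n \<le> 1")
  case True
  then have "n = 0 \<or> n = 1" by auto
  then show ?thesis by (auto simp: sqrt_coeff_0) (simp add: sqrt_coeff.simps)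
next
  case False
  have "(\<Sum>k\<le>n. sqrt_coeff k * sqrt_coeff (n - k)) = (\<Sum>k\<in>{1..<n}. sqrt_coeff k * sqrt_coeff (n - k))"
    by (rule sum.mono_neutral_right) (auto simp: sqrt_coeff_0 not_le not_less)
  then show ?thesis using False by (subst sqrt_coeff.simps[of n]) auto
qed

text \<open>
  By the recursion, twice the partial sum up to \<open>n + 1\<close> is at most \<open>1\<close> plus the square of the partial
  sum up to \<open>n\<close>.
\<close>

lemma sum_sqrt_coeff_le_1: "(\<Sum>k\<le>n. sqrt_coeff k) \<le> 1"
proof (induction n)
  case (Suc n)
  define T where "T = {(i, j). i + j \<le> Suc n \<and> 1 \<le> i \<and> 1 \<le> (j :: nat)}"
  have fin: "finite {(i, j). i + j \<le> Suc n}"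
    by (rule finite_subset[of _ "{..Suc n} \<times> {..Suc n}"]) auto
  have "(\<Sum>k\<le>Suc n. \<Sum>i\<le>k. sqrt_coeff i * sqrt_coeff (k - i))
      = (\<Sum>(i, j)\<in>{(i, j). i + j \<le> Suc n}. sqrt_coeff i * sqrt_coeff j)"
    by (rule sum.triangle_reindex_eq[symmetric])
  also have "\<dots> = (\<Sum>(i, j)\<in>T. sqrt_coeff i * sqrt_coeff j)"
    using fin by (intro sum.mono_neutral_right) (auto simp: T_def dest: sqrt_coeff_index_pos)
  also have "\<dots> \<le> (\<Sum>(i, j)\<in>{..n} \<times> {..n}. sqrt_coeff i * sqrt_coeff j)"
    by (intro sum_mono2) (auto simp: T_def intro!: mult_nonneg_nonneg sqrt_coeff_nonneg)
  also have "\<dots> = (\<Sum>k\<le>n. sqrt_coeff k) * (\<Sum>k\<le>n. sqrt_coeff k)"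
    by (simp add: sum_product sum.cartesian_product)
  also have "\<dots> \<le> 1 * 1"
    using Suc by (intro mult_mono sum_nonneg) (auto simp: sqrt_coeff_nonneg)
  finally have "(\<Sum>k\<le>Suc n. 2 * sqrt_coeff k - (if k = 1 then 1 else 0)) \<le> 1"
    by (simp only: sqrt_coeff_convolution)
  then show ?case by (simp add: sum_subtractf sum_distrib_left[symmetric] del: sum.atMost_Suc)
qed (simp add: sqrt_coeff_0)

lemma summable_sqrt_coeff: "summable sqrt_coeff"
  and suminf_sqrt_coeff_le_1: "suminf sqrt_coeff \<le> 1"
proof -
  have le: "(\<Sum>k<n. sqrt_coeff k) \<le> 1" for n
    using sum_sqrt_coeff_le_1[of "n - 1"] by (cases n) (auto simp: lessThan_Suc_atMost)
  show s: "summable sqrt_coeff"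
    by (rule summableI_nonneg_bounded[OF sqrt_coeff_nonneg le])
  show "suminf sqrt_coeff \<le> 1" by (rule suminf_le_const[OF s le])
qed

text \<open>
  Insert \<open>E\<close> into the power series of \<open>1 - sqrt (1 - x)\<close>. Since \<open>0 \<le> E \<le> 1\<close> as quadratic forms, all powers of \<open>E\<close>
  are contractions, and the absolute convergence of the series at \<open>1\<close> makes the series of
  the entries converge. The Cauchy product turns the recursion of the coefficients into
  \<open>P\<^sup>2 = 2 P - E\<close>, that is \<open>(1 - P)\<^sup>2 = 1 - E\<close>.
\<close>

lemma contraction_sqrt_exists:
  assumes E: "symm E" "supp d E"
    and lo: "\<And>w. 0 \<le> vdot d w (app d E w)" and hi: "\<And>w. vdot d w (app d E w) \<le> vdot d w w"
  shows "\<exists>R. symm R \<and> supp d R \<and> (\<forall>w. 0 \<le> vdot d w (app d R w)) \<and>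
    mm d R R = (\<lambda>i j. idm d i j - E i j)"
proof -
  define a where "a k i j = sqrt_coeff k * mpow d E k i j" for k i j
  define P where "P i j = (\<Sum>k. a k i j)" for i j
  have contr: "vdot d (app d E w) (app d E w) \<le> vdot d w w" for w
  proof -
    \<comment> \<open>Expand \<open>vdot d z (app d E z)\<close> for \<open>z = w - E w\<close>; it is nonnegative.\<close>
    define y z where "y = app d E w" and "z = (\<lambda>i. w i - y i)"
    have "vdot d z (app d E z) = vdot d w y - 2 * vdot d y y + vdot d y (app d E y)"
    proof -
      have "vdot d w (app d E y) = vdot d y y"
        using vdot_app_symm[OF E(1), of d w y] by (simp add: y_def)
      then show ?thesis
        by (simp add: z_def app_diff vdot_diff_left vdot_diff_right y_def[symmetric])
    qed
    then have "vdot d y y \<le> vdot d w y" using lo[of z] hi[of y] by linarith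
    also have "\<dots> \<le> vdot d w w" using hi[of w] by (simp add: y_def)
    finally show ?thesis by (simp add: y_def)
  qed
  have pow_contr: "vdot d (app d (mpow d E k) w) (app d (mpow d E k) w) \<le> vdot d w w" for k w
  proof (induction k)
    case 0
    show ?case by (simp add: vdot_def app_idm)
  next
    case (Suc k)
    then show ?case using contr[of "app d (mpow d E k) w"] by (simp add: app_mm)
  qed
  have entry: "\<bar>mpow d E k i j\<bar> \<le> 1" for k i j
  proof (cases "i < d \<and> j < d")
    case True
    define w :: "nat \<Rightarrow> real" where "w = (\<lambda>l. if l = j then 1 else 0)"
    have col: "app d (mpow d E k) w l = mpow d E k l j" for l
    proof -
      have "app d (mpow d E k) w l = (\<Sum>m<d. if m = j then mpow d E k l m else 0)"
        unfolding app_def w_def by (intro sum.cong) auto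
      then show ?thesis using True by simp
    qed
    have "(mpow d E k i j)\<^sup>2 \<le> (\<Sum>l<d. (mpow d E k l j)\<^sup>2)"
      using True by (intro member_le_sum) auto
    also have "\<dots> \<le> vdot d w w"
      using pow_contr[of k w] by (simp add: vdot_def[of d "app d (mpow d E k) w"] col power2_eq_square)
    also have "\<dots> = (\<Sum>l<d. if l = j then 1 else 0)"
      unfolding vdot_def w_def by (intro sum.cong) auto
    also have "\<dots> = 1" using True by simp
    finally show ?thesis by (simp add: abs_square_le_1)
  next
    case False
    then show ?thesis using supp_mpow[OF E(2), of k] by (auto simp: supp_def not_less)
  qed
  have summ: "summable (\<lambda>k. \<bar>a k i j\<bar>)" for i j
  proof (rule summable_comparison_test'[OF summable_sqrt_coeff])
    fix k
    show "norm \<bar>a k i j\<bar> \<le> sqrt_coeff k"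
      using mult_left_mono[OF entry[of k i j] sqrt_coeff_nonneg[of k]]
      by (simp add: a_def abs_mult sqrt_coeff_nonneg)
  qed
  have summ': "summable (\<lambda>k. a k i j)" for i j
    using summ by (rule summable_rabs_cancel)
  have mmP: "mm d P P i j = 2 * P i j - E i j" for i j
  proof -
    have cp: "P i l * P l j = (\<Sum>n. \<Sum>k\<le>n. a k i l * a (n - k) l j)" for l
      unfolding P_def by (rule Cauchy_product) (use summ in \<open>simp_all\<close>)
    have cs: "summable (\<lambda>n. \<Sum>k\<le>n. a k i l * a (n - k) l j)" for l
      by (rule summable_Cauchy_product) (use summ in \<open>simp_all\<close>)
    have "mm d P P i j = (\<Sum>n. \<Sum>l<d. \<Sum>k\<le>n. a k i l * a (n - k) l j)"
      unfolding mm_def cp by (rule suminf_sum[symmetric]) (rule cs)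
    also have "(\<lambda>n. \<Sum>l<d. \<Sum>k\<le>n. a k i l * a (n - k) l j) = (\<lambda>n. 2 * a n i j - (if n = 1 then E i j else 0))"
    proof
      fix n
      have "(\<Sum>l<d. \<Sum>k\<le>n. a k i l * a (n - k) l j) = (\<Sum>k\<le>n. \<Sum>l<d. a k i l * a (n - k) l j)"
        by (rule sum.swap)
      also have "\<dots> = (\<Sum>k\<le>n. sqrt_coeff k * sqrt_coeff (n - k) * mpow d E n i j)"
      proof (intro sum.cong refl)
        fix k assume "k \<in> {..n}"
        then have "mpow d E n i j = mm d (mpow d E k) (mpow d E (n - k)) i j"
          by (simp add: mpow_add E)
        then show "(\<Sum>l<d. a k i l * a (n - k) l j) = sqrt_coeff k * sqrt_coeff (n - k) * mpow d E n i j"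
          by (simp add: a_def mm_def sum_distrib_left mult_ac)
      qed
      also have "\<dots> = (2 * sqrt_coeff n - (if n = 1 then 1 else 0)) * mpow d E n i j"
        by (simp only: sum_distrib_right[symmetric] sqrt_coeff_convolution)
      also have "\<dots> = 2 * a n i j - (if n = 1 then E i j else 0)"
        by (auto simp: a_def left_diff_distrib mm_idm_right E)
      finally show "(\<Sum>l<d. \<Sum>k\<le>n. a k i l * a (n - k) l j) = 2 * a n i j - (if n = 1 then E i j else 0)" .
    qed
    also have "(\<Sum>n. 2 * a n i j - (if n = 1 then E i j else 0)) = 2 * P i j - E i j"
    proof (rule sums_unique[symmetric])
      have "(\<lambda>n. 2 * a n i j) sums (2 * P i j)"
        unfolding P_def by (intro sums_mult summable_sums summ')
      moreover have "(\<lambda>n. if n = 1 then E i j else 0) sums E i j"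
        using sums_single[of 1 "\<lambda>_. E i j"] by simp
      ultimately show "(\<lambda>n. 2 * a n i j - (if n = 1 then E i j else 0)) sums (2 * P i j - E i j)"
        by (rule sums_diff)
    qed
    finally show ?thesis .
  qed
  have P_symm: "P i j = P j i" for i j
  proof -
    have "mpow d E k i j = mpow d E k j i" for k
      using symm_mpow[OF E(2,1)] unfolding symm_def by blast
    then show ?thesis by (simp add: P_def a_def)
  qed
  have P_supp: "supp d P"
    using supp_mpow[OF E(2)] by (simp add: supp_def P_def a_def)
  have P_le: "vdot d w (app d P w) \<le> vdot d w w" for w
  proof -
    have avP: "app d P w i = (\<Sum>k. \<Sum>j<d. a k i j * w j)" for i
    proof -
      have "app d P w i = (\<Sum>j<d. \<Sum>k. a k i j * w j)"
        unfolding app_def P_def by (intro sum.cong refl suminf_mult2 summ')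
      also have "\<dots> = (\<Sum>k. \<Sum>j<d. a k i j * w j)"
        by (rule suminf_sum[symmetric]) (intro summable_mult2 summ')
      finally show ?thesis .
    qed
    have sm: "summable (\<lambda>k. \<Sum>j<d. a k i j * w j)" for i
      by (intro summable_sum summable_mult2 summ')
    have "vdot d w (app d P w) = (\<Sum>k. \<Sum>i<d. w i * (\<Sum>j<d. a k i j * w j))"
    proof -
      have "vdot d w (app d P w) = (\<Sum>i<d. \<Sum>k. w i * (\<Sum>j<d. a k i j * w j))"
        unfolding vdot_def avP by (intro sum.cong refl suminf_mult[symmetric] sm)
      also have "\<dots> = (\<Sum>k. \<Sum>i<d. w i * (\<Sum>j<d. a k i j * w j))"
        by (rule suminf_sum[symmetric]) (intro summable_mult sm)
      finally show ?thesis .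
    qed
    also have "\<dots> \<le> (\<Sum>k. sqrt_coeff k * vdot d w w)"
    proof (rule suminf_le)
      fix k
      have "(\<Sum>i<d. w i * (\<Sum>j<d. a k i j * w j)) = sqrt_coeff k * vdot d w (app d (mpow d E k) w)"
        by (simp add: a_def vdot_def app_def sum_distrib_left mult_ac)
      also have "\<dots> \<le> sqrt_coeff k * vdot d w w"
      proof -
        have "(vdot d w (app d (mpow d E k) w))\<^sup>2
            \<le> vdot d w w * vdot d (app d (mpow d E k) w) (app d (mpow d E k) w)"
          by (rule vdot_Cauchy_Schwarz)
        also have "\<dots> \<le> (vdot d w w)\<^sup>2"
          unfolding power2_eq_square by (intro mult_left_mono pow_contr vdot_self_nonneg)
        finally have "vdot d w (app d (mpow d E k) w) \<le> vdot d w w"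
          by (rule power2_le_imp_le[OF _ vdot_self_nonneg])
        then show ?thesis by (rule mult_left_mono[OF _ sqrt_coeff_nonneg])
      qed
      finally show "(\<Sum>i<d. w i * (\<Sum>j<d. a k i j * w j)) \<le> sqrt_coeff k * vdot d w w" .
    next
      show "summable (\<lambda>k. \<Sum>i<d. w i * (\<Sum>j<d. a k i j * w j))"
        by (intro summable_sum summable_mult sm)
      show "summable (\<lambda>k. sqrt_coeff k * vdot d w w)"
        by (intro summable_mult2 summable_sqrt_coeff)
    qed
    also have "\<dots> = suminf sqrt_coeff * vdot d w w"
      by (rule suminf_mult2[symmetric, OF summable_sqrt_coeff])
    also have "\<dots> \<le> 1 * vdot d w w"
      by (intro mult_right_mono suminf_sqrt_coeff_le_1 vdot_self_nonneg)
    finally show ?thesis by simp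
  qed
  define R where "R = (\<lambda>i j. idm d i j - P i j)"
  have "symm R" unfolding symm_def
  proof (intro allI)
    show "R i j = R j i" for i j
      unfolding R_def P_symm[of i j] by (simp add: idm_def)
  qed
  moreover have "supp d R" using P_supp supp_idm[of d] by (auto simp: supp_def R_def)
  moreover have "0 \<le> vdot d w (app d R w)" for w
  proof -
    have "app d R w i = app d (idm d) w i - app d P w i" for i
      by (simp add: app_def R_def left_diff_distrib sum_subtractf)
    then have "vdot d w (app d R w) = vdot d w w - vdot d w (app d P w)"
      by (simp add: vdot_def app_idm right_diff_distrib sum_subtractf)
    then show ?thesis using P_le[of w] by simp
  qed
  moreover have "mm d R R = (\<lambda>i j. idm d i j - E i j)"
    by (simp add: R_def mm_diff_left mm_diff_right mm_idm_left mm_idm_right supp_idm P_supp mmP)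
  ultimately show ?thesis by blast
qed

lemma psd_sqrt_exists:
  assumes H: "symm H" "supp d H" and psd: "\<And>w. 0 \<le> vdot d w (app d H w)"
  shows "\<exists>R. symm R \<and> supp d R \<and> (\<forall>w. 0 \<le> vdot d w (app d R w)) \<and> mm d R R = H"
proof -
  define b where "b = 1 + (\<Sum>i<d. \<Sum>j<d. \<bar>H i j\<bar>)"
  have b: "0 < b" unfolding b_def by (intro add_pos_nonneg sum_nonneg) auto
  have le: "vdot d w (app d H w) \<le> b * vdot d w w" for w
  proof -
    have "vdot d w (app d H w) = (\<Sum>i<d. \<Sum>j<d. w i * (H i j * w j))"
      by (simp add: vdot_def app_def sum_distrib_left)
    also have "\<dots> \<le> (\<Sum>i<d. \<Sum>j<d. \<bar>H i j\<bar> * vdot d w w)"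
    proof (intro sum_mono)
      fix i j assume ij: "i \<in> {..<d}" "j \<in> {..<d}"
      have sq: "(w k)\<^sup>2 \<le> vdot d w w" if "k < d" for k
        unfolding vdot_def power2_eq_square[symmetric] using that by (intro member_le_sum) auto
      have "\<bar>w i * w j\<bar> \<le> ((w i)\<^sup>2 + (w j)\<^sup>2) / 2"
        using sum_squares_bound[of "\<bar>w i\<bar>" "\<bar>w j\<bar>"] by (simp add: abs_mult)
      also have "\<dots> \<le> vdot d w w" using sq[of i] sq[of j] ij by simp
      finally have "\<bar>H i j\<bar> * \<bar>w i * w j\<bar> \<le> \<bar>H i j\<bar> * vdot d w w" by (rule mult_left_mono) simp
      moreover have "w i * (H i j * w j) \<le> \<bar>H i j\<bar> * \<bar>w i * w j\<bar>"
        unfolding abs_mult[symmetric] by (metis abs_ge_self mult.commute mult.left_commute)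
      ultimately show "w i * (H i j * w j) \<le> \<bar>H i j\<bar> * vdot d w w" by linarith
    qed
    also have "\<dots> \<le> b * vdot d w w"
      using vdot_self_nonneg[of d w] by (simp add: b_def sum_distrib_right[symmetric] distrib_right)
    finally show ?thesis .
  qed
  define E where "E = (\<lambda>i j. idm d i j - H i j / b)"
  have avE: "vdot d w (app d E w) = vdot d w w - vdot d w (app d H w) / b" for w
  proof -
    have "app d E w i = app d (idm d) w i - app d H w i / b" for i
      by (simp add: app_def E_def left_diff_distrib sum_subtractf sum_divide_distrib)
    then show ?thesis
      by (simp add: vdot_def app_idm right_diff_distrib sum_subtractf sum_divide_distrib)
  qed
  have "\<exists>R. symm R \<and> supp d R \<and> (\<forall>w. 0 \<le> vdot d w (app d R w)) \<and>
      mm d R R = (\<lambda>i j. idm d i j - E i j)"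
  proof (rule contraction_sqrt_exists)
    have "H i j = H j i" for i j using H(1) unfolding symm_def by blast
    then have "E i j = E j i" for i j
      unfolding E_def by (metis idm_def)
    then show "symm E" unfolding symm_def by blast
    show "supp d E" using H(2) supp_idm[of d] by (auto simp: E_def supp_def)
    show "0 \<le> vdot d w (app d E w)" for w using le[of w] b by (simp add: avE field_simps)
    show "vdot d w (app d E w) \<le> vdot d w w" for w using psd[of w] b by (simp add: avE)
  qed
  then obtain R where R: "symm R" "supp d R" "\<And>w. 0 \<le> vdot d w (app d R w)"
    "mm d R R = (\<lambda>i j. idm d i j - E i j)" by blast
  define Q where "Q = (\<lambda>i j. sqrt b * R i j)"
  have "symm Q" using R(1) unfolding Q_def symm_def by metis
  moreover have "supp d Q" using R(2) by (auto simp: Q_def supp_def)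
  moreover have "0 \<le> vdot d w (app d Q w)" for w
  proof -
    have "vdot d w (app d Q w) = sqrt b * vdot d w (app d R w)"
      by (simp add: vdot_def app_def Q_def sum_distrib_left mult_ac)
    then show ?thesis using R(3) b by simp
  qed
  moreover have "mm d Q Q = H"
  proof (intro ext)
    fix i j
    have "mm d Q Q i j = (sqrt b * sqrt b) * mm d R R i j"
      by (simp only: mm_def Q_def sum_distrib_left mult_ac)
    also have "\<dots> = H i j" using b by (simp add: R(4) E_def)
    finally show "mm d Q Q i j = H i j" .
  qed
  ultimately show ?thesis by blast
qed

text \<open>
  Otherwise a small step from \<open>w\<close> in the direction \<open>- A w\<close> would make the form negative.
\<close>

lemma psd_form_zero:
  assumes A: "symm A" and psd: "\<And>w. 0 \<le> vdot d w (app d A w)"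
    and "vdot d w (app d A w) = 0" "i < d"
  shows "app d A w i = 0"
proof -
  define y where "y = app d A w"
  have "0 \<le> - 2 * t * vdot d y y + t\<^sup>2 * vdot d y (app d A y)" for t
  proof -
    have "app d A (\<lambda>i. w i - t * y i) = (\<lambda>i. y i - t * app d A y i)"
      by (simp add: app_def y_def right_diff_distrib sum_subtractf sum_distrib_left mult_ac)
    moreover have "vdot d w (app d A y) = vdot d y y"
      using vdot_app_symm[OF A, of d w y] by (simp add: y_def)
    moreover have "vdot d (\<lambda>i. t * u i) v = t * vdot d u v" "vdot d v (\<lambda>i. t * u i) = t * vdot d v u" for u v
      by (simp_all add: vdot_def sum_distrib_left mult_ac)
    ultimately show ?thesis
      using psd[of "\<lambda>i. w i - t * y i"] assms(3)
      by (simp add: vdot_diff_left vdot_diff_right y_def[symmetric] power2_eq_square algebra_simps)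
  qed
  note q = this
  have "vdot d y y = 0"
  proof (rule ccontr)
    assume "vdot d y y \<noteq> 0"
    then have pos: "0 < vdot d y y" using vdot_self_nonneg[of d y] by simp
    define c where "c = vdot d y (app d A y) + 1"
    have c: "0 < c" "vdot d y (app d A y) \<le> c" using psd[of y] by (auto simp: c_def)
    define t where "t = vdot d y y / c"
    have "t\<^sup>2 * vdot d y (app d A y) \<le> t\<^sup>2 * c" using c by (intro mult_left_mono) auto
    also have "t\<^sup>2 * c = t * vdot d y y" using c by (simp add: t_def power2_eq_square)
    finally have "0 \<le> - t * vdot d y y" using q[of t] by linarith
    moreover have "0 < t * vdot d y y" using pos c by (simp add: t_def)
    ultimately show False by simp
  qed
  then have "\<forall>i\<in>{..<d}. y i * y i = 0"
    unfolding vdot_def by (subst (asm) sum_nonneg_eq_0_iff) auto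
  then show ?thesis using \<open>i < d\<close> by (auto simp: y_def)
qed

lemma frob_mm_columns: "frob d D (mm d A D) = (\<Sum>j<d. vdot d (\<lambda>i. D i j) (app d A (\<lambda>i. D i j)))"
  unfolding frob_def vdot_def app_def mm_def by (rule sum.swap)

text \<open>
  With \<open>D = R - T\<close>, the equation \<open>R\<^sup>2 = T\<^sup>2\<close> reads \<open>R D + D T = 0\<close>. Pairing it with \<open>D\<close> gives a sum of two
  nonnegative terms, so both vanish; then \<open>R\<close> annihilates every column of \<open>D\<close>.
\<close>

lemma psd_sqrt_unique:
  assumes R: "symm R" "supp d R" "\<And>w. 0 \<le> vdot d w (app d R w)"
    and T: "symm T" "supp d T" "\<And>w. 0 \<le> vdot d w (app d T w)"
    and eq: "mm d R R = mm d T T"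
    and inj: "\<And>w i. (\<And>i. i < d \<Longrightarrow> app d R w i = 0) \<Longrightarrow> i < d \<Longrightarrow> w i = 0"
  shows "R = T"
proof -
  define D where "D = (\<lambda>i j. R i j - T i j)"
  have D: "symm D" "supp d D" using R T unfolding symm_def supp_def D_def by (metis, metis diff_self)
  have "(\<lambda>i j. mm d R D i j + mm d D T i j) = (\<lambda>i j. 0)"
    by (simp add: D_def mm_diff_left mm_diff_right eq)
  then have "frob d D (mm d R D) + frob d D (mm d D T) = 0"
    by (simp add: frob_def fun_eq_iff sum.distrib[symmetric] distrib_left[symmetric])
  moreover have "frob d D (mm d D T) = frob d D (mm d T D)"
  proof -
    have Dt: "(\<lambda>i j. D j i) = D" using D(1) unfolding symm_def by (intro ext) blast
    have mt: "(\<lambda>i j. mm d D T j i) = mm d T D"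
      by (intro ext) (rule symm_mm_transpose[OF D(1) T(1)])
    show ?thesis using frob_transpose[of d D "mm d D T"] unfolding Dt mt by simp
  qed
  moreover have "0 \<le> frob d D (mm d T D)"
    unfolding frob_mm_columns by (intro sum_nonneg T(3))
  moreover have "0 \<le> frob d D (mm d R D)"
    unfolding frob_mm_columns by (intro sum_nonneg R(3))
  ultimately have "frob d D (mm d R D) = 0" by linarith
  then have "\<forall>j\<in>{..<d}. vdot d (\<lambda>i. D i j) (app d R (\<lambda>i. D i j)) = 0"
    unfolding frob_mm_columns by (subst (asm) sum_nonneg_eq_0_iff) (auto simp: R(3))
  then have "D i j = 0" if "i < d" "j < d" for i j
    using that by (intro inj[of "\<lambda>i. D i j"] psd_form_zero[OF R(1,3)]) auto
  then have "D i j = 0" for i j using D(2) unfolding supp_def by (meson not_less)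
  then show ?thesis by (intro ext) (simp add: D_def)
qed

section \<open>Norms and quadratic forms\<close>

unbundle no vec_syntax

abbreviation dot :: "real Matrix.vec \<Rightarrow> real Matrix.vec \<Rightarrow> real" (infixl "\<odot>" 70) where
  "u \<odot> v \<equiv> scalar_prod u v"

abbreviation sqn :: "real Matrix.vec \<Rightarrow> real" where
  "sqn v \<equiv> scalar_prod v v"

lemma dot_self_nonneg: "0 \<le> (v \<odot> v :: real)"
  by (auto simp: scalar_prod_def intro!: sum_nonneg)

lemma dot_self_eq_0: "v \<in> carrier_vec n \<Longrightarrow> v \<odot> v = 0 \<longleftrightarrow> v = 0\<^sub>v n"
proof
  assume v: "v \<in> carrier_vec n" and "v \<odot> v = 0"
  then have "\<forall>i\<in>{0..<n}. v $ i * v $ i = 0"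
    unfolding scalar_prod_def by (subst (asm) sum_nonneg_eq_0_iff) auto
  then show "v = 0\<^sub>v n" using v by (intro eq_vecI) auto
qed simp

lemma dot_Cauchy_Schwarz:
  assumes "u \<in> carrier_vec n" "v \<in> carrier_vec n"
  shows "(u \<odot> v)\<^sup>2 \<le> (u \<odot> u) * (v \<odot> v)"
  using assms Cauchy_Schwarz_ineq_sum[of "\<lambda>i. u $ i" "\<lambda>i. v $ i" "{0..<n}"]
  by (simp add: scalar_prod_def power2_eq_square)

lemma eucl_norm_L2: "v \<in> carrier_vec n \<Longrightarrow> eucl_norm v = L2_set (\<lambda>i. v $ i) {0..<n}"
  by (simp add: eucl_norm_def L2_set_def scalar_prod_def power2_eq_square)

lemma eucl_norm_nonneg: "0 \<le> eucl_norm v"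
  by (simp add: eucl_norm_def dot_self_nonneg)

lemma eucl_norm_sq: "(eucl_norm v)\<^sup>2 = v \<odot> v"
  by (simp add: eucl_norm_def dot_self_nonneg)

lemma eucl_norm_add_le:
  assumes "u \<in> carrier_vec n" "v \<in> carrier_vec n"
  shows "eucl_norm (u + v) \<le> eucl_norm u + eucl_norm v"
proof -
  have "eucl_norm (u + v) = L2_set (\<lambda>i. u $ i + v $ i) {0..<n}"
    using assms by (subst eucl_norm_L2[of _ n]) (auto simp: L2_set_def intro!: sum.cong)
  also have "\<dots> \<le> L2_set (\<lambda>i. u $ i) {0..<n} + L2_set (\<lambda>i. v $ i) {0..<n}"
    by (rule L2_set_triangle_ineq)
  finally show ?thesis using assms by (simp add: eucl_norm_L2)
qed

lemma eucl_norm_minus_commute: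
  assumes "u \<in> carrier_vec n" "v \<in> carrier_vec n"
  shows "eucl_norm (u - v) = eucl_norm (v - u)"
proof -
  have "sqn (u - v) = sqn (v - u)"
    using assms by (auto simp: scalar_prod_def algebra_simps intro!: sum.cong)
  then show ?thesis by (simp add: eucl_norm_def)
qed

lemma dot_mat_symm:
  assumes "A \<in> carrier_mat d d" "transpose_mat A = A" "u \<in> carrier_vec d" "v \<in> carrier_vec d"
  shows "u \<odot> (A *\<^sub>v v) = (A *\<^sub>v u) \<odot> v"
  using transpose_vec_mult_scalar[of A d d v u] assms by simp

lemma gram_quadratic_form:
  assumes "A \<in> carrier_mat m d" "v \<in> carrier_vec d"
  shows "v \<odot> ((transpose_mat A * A) *\<^sub>v v) = sqn (A *\<^sub>v v)"
proof -
  have "v \<odot> ((transpose_mat A * A) *\<^sub>v v) = v \<odot> (transpose_mat A *\<^sub>v (A *\<^sub>v v))"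
    using assms by (subst assoc_mult_mat_vec[of _ d m _ d]) auto
  also have "\<dots> = (transpose_mat A *\<^sub>v (A *\<^sub>v v)) \<odot> v"
    using assms by (intro comm_scalar_prod[of _ d]) auto
  also have "\<dots> = sqn (A *\<^sub>v v)"
    using assms by (intro transpose_vec_mult_scalar[of _ m d]) auto
  finally show ?thesis .
qed

section \<open>The square root of a positive definite matrix\<close>

definition entries :: "real mat \<Rightarrow> nat \<Rightarrow> nat \<Rightarrow> real" where
  "entries A i j = (if i < dim_row A \<and> j < dim_col A then A $$ (i, j) else 0)"

lemma supp_entries: "A \<in> carrier_mat d d \<Longrightarrow> supp d (entries A)"
  by (auto simp: supp_def entries_def)

lemma symm_entries: "A \<in> carrier_mat d d \<Longrightarrow> transpose_mat A = A \<Longrightarrow> symm (entries A)"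
  unfolding symm_def
proof (intro allI)
  fix i j assume A: "A \<in> carrier_mat d d" "transpose_mat A = A"
  have "A $$ (i, j) = A $$ (j, i)" if "i < d" "j < d"
    using that A index_transpose_mat(1)[of i A j] by simp
  then show "entries A i j = entries A j i" using A(1) by (auto simp: entries_def)
qed

lemma entries_mult:
  assumes "A \<in> carrier_mat d d" "B \<in> carrier_mat d d"
  shows "entries (A * B) = mm d (entries A) (entries B)"
proof (intro ext)
  fix i j
  show "entries (A * B) i j = mm d (entries A) (entries B) i j"
  proof (cases "i < d \<and> j < d")
    case True
    then show ?thesis using assms
      by (auto simp: entries_def mm_def scalar_prod_def atLeast0LessThan intro!: sum.cong)
  next
    case False
    then show ?thesis using assms by (auto simp: entries_def mm_def intro!: sum.neutral)
  qed
qed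

lemma entries_inject:
  assumes "A \<in> carrier_mat d d" "B \<in> carrier_mat d d" "entries A = entries B"
  shows "A = B"
proof (rule eq_matI)
  fix i j assume "i < dim_row B" "j < dim_col B"
  then show "A $$ (i, j) = B $$ (i, j)"
    using fun_cong[OF fun_cong[OF assms(3), of i], of j] assms(1,2) by (simp add: entries_def)
qed (use assms in auto)

lemma mult_vec_entries:
  assumes "A \<in> carrier_mat d d" "i < d"
  shows "(A *\<^sub>v Matrix.vec d w) $ i = app d (entries A) w i"
  using assms by (auto simp: app_def entries_def scalar_prod_def atLeast0LessThan intro!: sum.cong)

lemma quadratic_form_entries:
  assumes "A \<in> carrier_mat d d"
  shows "Matrix.vec d w \<odot> (A *\<^sub>v Matrix.vec d w) = vdot d w (app d (entries A) w)"
  unfolding scalar_prod_def vdot_def using assms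
  by (auto simp: atLeast0LessThan mult_vec_entries simp del: index_mult_mat_vec intro!: sum.cong)

text \<open>
  Existence and uniqueness of the root justify the definite description. Definiteness is used for the
  uniqueness: it makes every root injective.
\<close>

lemma psd_sqrt_spec:
  assumes H: "H \<in> carrier_mat d d" "transpose_mat H = H"
    and pos: "\<And>v. v \<in> carrier_vec d \<Longrightarrow> v \<noteq> 0\<^sub>v d \<Longrightarrow> 0 < v \<odot> (H *\<^sub>v v)"
  shows "psd_sqrt H \<in> carrier_mat d d" "transpose_mat (psd_sqrt H) = psd_sqrt H"
    "psd_sqrt H * psd_sqrt H = H"
proof -
  define good where "good R \<longleftrightarrow> R \<in> carrier_mat d d \<and> transpose_mat R = R \<and>
      (\<forall>v \<in> carrier_vec d. 0 \<le> v \<odot> (R *\<^sub>v v)) \<and> R * R = H" for R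
  have goodD: "symm (entries R)" "supp d (entries R)" "0 \<le> vdot d w (app d (entries R) w)"
    "mm d (entries R) (entries R) = entries H" if "good R" for R w
    using that unfolding good_def
    by (auto simp: symm_entries supp_entries entries_mult[symmetric] quadratic_form_entries[symmetric])
  have psd: "0 \<le> vdot d w (app d (entries H) w)" for w
  proof (cases "Matrix.vec d w = 0\<^sub>v d")
    case True
    then show ?thesis using H by (simp add: quadratic_form_entries[symmetric])
  next
    case False
    then show ?thesis using pos[of "Matrix.vec d w"] H by (simp add: quadratic_form_entries[symmetric])
  qed
  obtain R0 where R0: "symm R0" "supp d R0" "\<And>w. 0 \<le> vdot d w (app d R0 w)" "mm d R0 R0 = entries H"
    using psd_sqrt_exists[OF symm_entries[OF H] supp_entries[OF H(1)] psd] by blast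
  define R where "R = Matrix.mat d d (\<lambda>(i, j). R0 i j)"
  have Rc: "R \<in> carrier_mat d d" by (simp add: R_def)
  have eR: "entries R = R0"
    using R0(2) by (auto simp: entries_def R_def supp_def not_less intro!: ext)
  have "good R"
    unfolding good_def
  proof (intro conjI ballI)
    show "transpose_mat R = R"
    proof (rule eq_matI)
      fix i j assume "i < dim_row R" "j < dim_col R"
      moreover have "R0 i j = R0 j i" using R0(1) unfolding symm_def by blast
      ultimately show "transpose_mat R $$ (i, j) = R $$ (i, j)" by (simp add: R_def)
    qed (simp_all add: R_def)
    show "0 \<le> v \<odot> (R *\<^sub>v v)" if "v \<in> carrier_vec d" for v
    proof -
      have "Matrix.vec d (\<lambda>i. v $ i) = v" using that by auto
      then show ?thesis
        using quadratic_form_entries[OF Rc, of "\<lambda>i. v $ i"] R0(3)[of "\<lambda>i. v $ i"] eR by simp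
    qed
    show "R * R = H"
      by (rule entries_inject[of _ d]) (use Rc H in \<open>auto simp: entries_mult[OF Rc Rc] eR R0(4)\<close>)
  qed (rule Rc)
  moreover have "T = R" if "good T" for T
  proof (rule entries_inject[of _ d])
    show "entries T = entries R"
    proof (rule psd_sqrt_unique[OF goodD(1,2,3)[OF that] goodD(1,2,3)[OF \<open>good R\<close>]])
      show "mm d (entries T) (entries T) = mm d (entries R) (entries R)"
        using goodD(4)[OF that] goodD(4)[OF \<open>good R\<close>] by simp
      fix w :: "nat \<Rightarrow> real" and i
      assume z: "\<And>i. i < d \<Longrightarrow> app d (entries T) w i = 0" and "i < d"
      have "app d (entries H) w = app d (entries T) (app d (entries T) w)"
        by (simp add: goodD(4)[OF that, symmetric] app_mm)
      then have "vdot d w (app d (entries H) w) = 0"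
        using z by (simp add: vdot_def app_def[of d "entries T" "app d (entries T) w"])
      then have "Matrix.vec d w = 0\<^sub>v d"
        using pos[of "Matrix.vec d w"] H by (force simp: quadratic_form_entries[symmetric])
      then show "w i = 0" using \<open>i < d\<close> by (metis index_vec index_zero_vec(1))
    qed
  qed (use that Rc in \<open>auto simp: good_def\<close>)
  ultimately have "(THE R. good R) = R" by (intro the_equality) blast+
  moreover have "psd_sqrt H = (THE R. good R)"
    unfolding psd_sqrt_def good_def carrier_matD(1)[OF H(1)] ..
  ultimately have "good (psd_sqrt H)" using \<open>good R\<close> by simp
  then show "psd_sqrt H \<in> carrier_mat d d" "transpose_mat (psd_sqrt H) = psd_sqrt H"
    "psd_sqrt H * psd_sqrt H = H" unfolding good_def by blast+
qed

section \<open>Conjugate gradients\<close>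

lemma quadratic_form_diff:
  assumes B: "B \<in> carrier_mat d d" "transpose_mat B = B" and uv: "u \<in> carrier_vec d" "v \<in> carrier_vec d"
  shows "(u - t \<cdot>\<^sub>v v) \<odot> (B *\<^sub>v (u - t \<cdot>\<^sub>v v))
    = u \<odot> (B *\<^sub>v u) - 2 * t * (v \<odot> (B *\<^sub>v u)) + t\<^sup>2 * (v \<odot> (B *\<^sub>v v))"
proof -
  have c: "B *\<^sub>v u \<in> carrier_vec d" "B *\<^sub>v v \<in> carrier_vec d" using B uv by auto
  have "B *\<^sub>v (u - t \<cdot>\<^sub>v v) = B *\<^sub>v u - t \<cdot>\<^sub>v (B *\<^sub>v v)"
    using B uv by (simp add: mult_minus_distrib_mat_vec[of _ d d] mult_mat_vec[of _ d d])
  moreover have "u \<odot> (B *\<^sub>v v) = v \<odot> (B *\<^sub>v u)"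
    using dot_mat_symm[OF B uv] comm_scalar_prod[OF c(1) uv(2)] by simp
  ultimately show ?thesis using uv c
    by (simp add: minus_scalar_prod_distrib[of _ d] scalar_prod_minus_distrib[of _ d]
        power2_eq_square algebra_simps)
qed

text \<open>
  Two identities between the current residual \<open>r\<close> and direction \<open>p\<close> are enough: \<open>r \<odot> p = r \<odot> r\<close>, and
  \<open>p - r\<close> is conjugate to \<open>p\<close>. They hold at the start, where \<open>p = r\<close>, and are preserved without
  reference to the residuals and directions of earlier steps.
\<close>

definition cg_inv where
  "cg_inv d B g s \<longleftrightarrow> (case s of (u, r, p) \<Rightarrow>
     u \<in> carrier_vec d \<and> r \<in> carrier_vec d \<and> p \<in> carrier_vec d \<and> r = g - B *\<^sub>v u \<and>
     r \<odot> p = r \<odot> r \<and> p \<odot> (B *\<^sub>v r) = p \<odot> (B *\<^sub>v p))"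

context
  fixes B :: "real mat" and d :: nat and lo hi :: real and g :: "real Matrix.vec"
  assumes B: "B \<in> carrier_mat d d" "transpose_mat B = B" and g: "g \<in> carrier_vec d"
    and lo: "0 < lo" "lo \<le> hi"
    and bounds: "\<And>v. v \<in> carrier_vec d \<Longrightarrow> lo * (v \<odot> v) \<le> v \<odot> (B *\<^sub>v v)"
      "\<And>v. v \<in> carrier_vec d \<Longrightarrow> v \<odot> (B *\<^sub>v v) \<le> hi * (v \<odot> v)"
begin

text \<open>
  The step length makes the new residual orthogonal to \<open>p\<close>. Because of \<open>r \<odot> (B *\<^sub>v p) = p \<odot> (B *\<^sub>v p)\<close> it is also orthogonal
  to \<open>r\<close>, which makes the new direction conjugate to \<open>p\<close>. Conjugacy of \<open>p - r\<close> and \<open>p\<close> implies that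
  the curvature along \<open>p\<close> is at most the curvature along \<open>r\<close>.
\<close>

lemma cg_step:
  assumes inv: "cg_inv d B g (u, r, p)" and r0: "r \<noteq> 0\<^sub>v d"
  defines "\<alpha> \<equiv> (r \<odot> r) / (p \<odot> (B *\<^sub>v p))"
  defines "r' \<equiv> r - \<alpha> \<cdot>\<^sub>v (B *\<^sub>v p)"
  defines "\<gamma> \<equiv> (r' \<odot> r') / (r \<odot> r)"
  shows "0 < r \<odot> r" "0 < p \<odot> (B *\<^sub>v p)" "p \<odot> (B *\<^sub>v p) \<le> r \<odot> (B *\<^sub>v r)"
    "cg_inv d B g (u + \<alpha> \<cdot>\<^sub>v p, r', r' + \<gamma> \<cdot>\<^sub>v p)"
proof -
  have c: "u \<in> carrier_vec d" "r \<in> carrier_vec d" "p \<in> carrier_vec d"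
    and req: "r = g - B *\<^sub>v u" and rp: "r \<odot> p = r \<odot> r" and pBr: "p \<odot> (B *\<^sub>v r) = p \<odot> (B *\<^sub>v p)"
    using inv by (auto simp: cg_inv_def)
  have cB: "B *\<^sub>v p \<in> carrier_vec d" "B *\<^sub>v r \<in> carrier_vec d" "B *\<^sub>v u \<in> carrier_vec d"
    using B c by auto
  have c': "r' \<in> carrier_vec d" using c cB by (simp add: r'_def)
  show rr: "0 < r \<odot> r" using r0 dot_self_eq_0[OF c(2)] dot_self_nonneg[of r] by simp
  have "p \<noteq> 0\<^sub>v d" using rr rp c by auto
  then have "0 < p \<odot> p" using dot_self_eq_0[OF c(3)] dot_self_nonneg[of p] by simp
  then show pBp: "0 < p \<odot> (B *\<^sub>v p)"
    using bounds(1)[OF c(3)] lo by (smt (verit) mult_pos_pos)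
  have rBp: "r \<odot> (B *\<^sub>v p) = p \<odot> (B *\<^sub>v p)"
    using dot_mat_symm[OF B c(2,3)] comm_scalar_prod[OF cB(2) c(3)] pBr by simp
  have "0 \<le> (r - 1 \<cdot>\<^sub>v p) \<odot> (B *\<^sub>v (r - 1 \<cdot>\<^sub>v p))"
    using bounds(1)[of "r - 1 \<cdot>\<^sub>v p"] lo c dot_self_nonneg[of "r - 1 \<cdot>\<^sub>v p"]
    by (smt (verit) minus_carrier_vec mult_nonneg_nonneg smult_carrier_vec)
  then show "p \<odot> (B *\<^sub>v p) \<le> r \<odot> (B *\<^sub>v r)"
    unfolding quadratic_form_diff[OF B c(2,3)] by (simp add: pBr)
  have \<alpha>: "\<alpha> * (p \<odot> (B *\<^sub>v p)) = r \<odot> r" using pBp by (simp add: \<alpha>_def)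
  have \<alpha>0: "0 < \<alpha>" using pBp rr by (simp add: \<alpha>_def)
  have r'p: "r' \<odot> p = 0"
  proof -
    have "r' \<odot> p = r \<odot> p - \<alpha> * ((B *\<^sub>v p) \<odot> p)"
      using c cB by (simp add: r'_def minus_scalar_prod_distrib[of _ d])
    then show ?thesis using \<alpha> rp comm_scalar_prod[OF cB(1) c(3)] by simp
  qed
  have r'r: "r \<odot> r' = 0"
    using c cB \<alpha> rBp by (simp add: r'_def scalar_prod_minus_distrib[of _ d])
  have pBr': "r' \<odot> (B *\<^sub>v p) = - (r' \<odot> r') / \<alpha>"
  proof -
    have "r' \<odot> r' = r' \<odot> r - \<alpha> * (r' \<odot> (B *\<^sub>v p))"
      using c cB c' by (subst (2) r'_def) (simp add: scalar_prod_minus_distrib[of _ d])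
    then show ?thesis using r'r \<alpha>0 comm_scalar_prod[OF c' c(2)] by (simp add: field_simps)
  qed
  define p' where "p' = r' + \<gamma> \<cdot>\<^sub>v p"
  have cp': "p' \<in> carrier_vec d" using c c' by (simp add: p'_def)
  have conj: "p' \<odot> (B *\<^sub>v p) = 0"
  proof -
    have "p' \<odot> (B *\<^sub>v p) = r' \<odot> (B *\<^sub>v p) + \<gamma> * (p \<odot> (B *\<^sub>v p))"
      using c c' cB by (simp add: p'_def add_scalar_prod_distrib[of _ d])
    also have "\<gamma> * (p \<odot> (B *\<^sub>v p)) = (r' \<odot> r') / \<alpha>"
      using rr pBp by (simp add: \<gamma>_def \<alpha>_def)
    finally show ?thesis by (simp add: pBr')
  qed
  have f1: "r' \<odot> p' = r' \<odot> r'"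
    using c c' r'p by (simp add: p'_def scalar_prod_add_distrib[of _ d])
  have f2: "p' \<odot> (B *\<^sub>v r') = p' \<odot> (B *\<^sub>v p')"
  proof -
    have "B *\<^sub>v p' = B *\<^sub>v r' + \<gamma> \<cdot>\<^sub>v (B *\<^sub>v p)"
      using B c c' by (simp add: p'_def mult_add_distrib_mat_vec[of _ d d] mult_mat_vec[of _ d d])
    moreover have "B *\<^sub>v r' \<in> carrier_vec d" using B c' by auto
    ultimately show ?thesis using cp' cB conj by (simp add: scalar_prod_add_distrib[of _ d])
  qed
  have f3: "r' = g - B *\<^sub>v (u + \<alpha> \<cdot>\<^sub>v p)"
  proof -
    have "B *\<^sub>v (u + \<alpha> \<cdot>\<^sub>v p) = B *\<^sub>v u + \<alpha> \<cdot>\<^sub>v (B *\<^sub>v p)"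
      using B c by (simp add: mult_add_distrib_mat_vec[of _ d d] mult_mat_vec[of _ d d])
    then show ?thesis using g cB by (auto simp: r'_def req intro!: eq_vecI)
  qed
  have cu: "u + \<alpha> \<cdot>\<^sub>v p \<in> carrier_vec d" using c by simp
  show "cg_inv d B g (u + \<alpha> \<cdot>\<^sub>v p, r', r' + \<gamma> \<cdot>\<^sub>v p)"
    unfolding cg_inv_def prod.case p'_def[symmetric] by (intro conjI cu c' cp' f1 f2 f3)
qed

text \<open>
  The energy drops by the square of \<open>r \<odot> r\<close> over the curvature along \<open>p\<close>. As this curvature is at most the one along the
  residual, the drop is at least that of a steepest descent step, which is at least the fraction
  \<open>lo / hi\<close> of the energy.
\<close>

lemma cg_energy_step:
  assumes ustar: "ustar \<in> carrier_vec d" "B *\<^sub>v ustar = g"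
    and inv: "cg_inv d B g (u, r, p)" and r0: "r \<noteq> 0\<^sub>v d"
  defines "\<alpha> \<equiv> (r \<odot> r) / (p \<odot> (B *\<^sub>v p))"
  shows "(ustar - (u + \<alpha> \<cdot>\<^sub>v p)) \<odot> (B *\<^sub>v (ustar - (u + \<alpha> \<cdot>\<^sub>v p)))
    \<le> (1 - lo / hi) * ((ustar - u) \<odot> (B *\<^sub>v (ustar - u)))"
proof -
  have c: "u \<in> carrier_vec d" "r \<in> carrier_vec d" "p \<in> carrier_vec d"
    and req: "r = g - B *\<^sub>v u" and rp: "r \<odot> p = r \<odot> r"
    using inv by (auto simp: cg_inv_def)
  note st = cg_step[OF inv r0]
  define e where "e = ustar - u"
  have ce: "e \<in> carrier_vec d" using ustar c by (simp add: e_def)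
  have Be: "B *\<^sub>v e = r"
    using B ustar c by (simp add: e_def req mult_minus_distrib_mat_vec[of _ d d])
  have "ustar - (u + \<alpha> \<cdot>\<^sub>v p) = e - \<alpha> \<cdot>\<^sub>v p"
    using ustar c by (auto simp: e_def intro!: eq_vecI)
  then have "(ustar - (u + \<alpha> \<cdot>\<^sub>v p)) \<odot> (B *\<^sub>v (ustar - (u + \<alpha> \<cdot>\<^sub>v p)))
      = e \<odot> r - 2 * \<alpha> * (p \<odot> r) + \<alpha>\<^sup>2 * (p \<odot> (B *\<^sub>v p))"
    by (simp only: quadratic_form_diff[OF B ce c(3)] Be)
  also have "\<dots> = e \<odot> r - (r \<odot> r)\<^sup>2 / (p \<odot> (B *\<^sub>v p))"
    using st(2) comm_scalar_prod[OF c(3,2)] rp by (simp add: \<alpha>_def power2_eq_square)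
  also have "\<dots> \<le> e \<odot> r - (r \<odot> r) / hi"
  proof -
    have "p \<odot> (B *\<^sub>v p) \<le> hi * (r \<odot> r)" using st(3) bounds(2)[OF c(2)] by linarith
    then have "(r \<odot> r) / hi \<le> (r \<odot> r)\<^sup>2 / (p \<odot> (B *\<^sub>v p))"
      using st(1,2) lo by (simp add: divide_le_eq le_divide_eq power2_eq_square mult_ac)
    then show ?thesis by simp
  qed
  also have "\<dots> \<le> e \<odot> r - lo * (e \<odot> r) / hi"
  proof -
    have er: "lo * (e \<odot> e) \<le> e \<odot> r" using bounds(1)[OF ce] Be by simp
    have "lo * (e \<odot> r) \<le> r \<odot> r"
    proof (cases "e \<odot> r \<le> 0")
      case True
      then have "lo * (e \<odot> r) \<le> 0" using lo by (simp add: mult_le_0_iff)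
      then show ?thesis using st(1) by linarith
    next
      case False
      have "lo * (e \<odot> r)\<^sup>2 \<le> lo * ((e \<odot> e) * (r \<odot> r))"
        using dot_Cauchy_Schwarz[OF ce c(2)] lo by simp
      also have "\<dots> = (lo * (e \<odot> e)) * (r \<odot> r)" by simp
      also have "\<dots> \<le> (e \<odot> r) * (r \<odot> r)"
        using er st(1) by (intro mult_right_mono) auto
      finally have "(e \<odot> r) * (lo * (e \<odot> r)) \<le> (e \<odot> r) * (r \<odot> r)"
        by (simp add: power2_eq_square mult_ac)
      then show ?thesis using False by simp
    qed
    then show ?thesis using lo by (simp add: divide_right_mono)
  qed
  also have "\<dots> = (1 - lo / hi) * (e \<odot> r)" by (simp add: algebra_simps)
  finally show ?thesis by (simp add: e_def[symmetric] Be)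
qed

lemma cg_error_bound:
  assumes u0: "u0 \<in> carrier_vec d" and ustar: "ustar \<in> carrier_vec d" "B *\<^sub>v ustar = g"
  shows "cg B g u0 k \<in> carrier_vec d"
    "(ustar - cg B g u0 k) \<odot> (B *\<^sub>v (ustar - cg B g u0 k))
      \<le> (1 - lo / hi) ^ k * ((ustar - u0) \<odot> (B *\<^sub>v (ustar - u0)))"
proof -
  have ratio: "0 \<le> 1 - lo / hi" using lo by (simp add: divide_le_eq)
  have "cg_inv d B g (cg_state B g u0 k) \<and>
    (ustar - fst (cg_state B g u0 k)) \<odot> (B *\<^sub>v (ustar - fst (cg_state B g u0 k)))
      \<le> (1 - lo / hi) ^ k * ((ustar - u0) \<odot> (B *\<^sub>v (ustar - u0)))"
  proof (induction k)
    case 0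
    show ?case using u0 g B by (auto simp: cg_inv_def Let_def)
  next
    case (Suc k)
    obtain u r p where s: "cg_state B g u0 k = (u, r, p)" by (cases "cg_state B g u0 k") auto
    have inv: "cg_inv d B g (u, r, p)" and
      IH: "(ustar - u) \<odot> (B *\<^sub>v (ustar - u))
        \<le> (1 - lo / hi) ^ k * ((ustar - u0) \<odot> (B *\<^sub>v (ustar - u0)))"
      using Suc s by auto
    have c: "u \<in> carrier_vec d" "r \<in> carrier_vec d" and req: "r = g - B *\<^sub>v u"
      using inv by (auto simp: cg_inv_def)
    have dr: "dim_vec r = d" using c by simp
    show ?case
    proof (cases "r = 0\<^sub>v d")
      case True
      have "B *\<^sub>v (ustar - u) = 0\<^sub>v d"
        using B ustar c True req by (simp add: mult_minus_distrib_mat_vec[of _ d d])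
      then have "(ustar - u) \<odot> (B *\<^sub>v (ustar - u)) = 0" using ustar c by simp
      moreover have "0 \<le> (ustar - u0) \<odot> (B *\<^sub>v (ustar - u0))"
        using bounds(1)[of "ustar - u0"] ustar u0 lo dot_self_nonneg[of "ustar - u0"]
        by (smt (verit) minus_carrier_vec mult_nonneg_nonneg)
      moreover have "cg_state B g u0 (Suc k) = (u, r, p)" using True by (simp add: s Let_def)
      ultimately show ?thesis using inv ratio by simp
    next
      case False
      then have st: "cg_state B g u0 (Suc k) =
        (let \<alpha> = scalar_prod r r / scalar_prod p (B *\<^sub>v p);
            r' = r - \<alpha> \<cdot>\<^sub>v (B *\<^sub>v p);
            \<gamma> = scalar_prod r' r' / scalar_prod r r
        in (u + \<alpha> \<cdot>\<^sub>v p, r', r' + \<gamma> \<cdot>\<^sub>v p))"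
        by (simp add: s dr)
      have "(ustar - fst (cg_state B g u0 (Suc k))) \<odot> (B *\<^sub>v (ustar - fst (cg_state B g u0 (Suc k))))
          \<le> (1 - lo / hi) * ((ustar - u) \<odot> (B *\<^sub>v (ustar - u)))"
        unfolding st Let_def using cg_energy_step[OF ustar inv False] by simp
      also have "\<dots> \<le> (1 - lo / hi) * ((1 - lo / hi) ^ k * ((ustar - u0) \<odot> (B *\<^sub>v (ustar - u0))))"
        by (rule mult_left_mono[OF IH ratio])
      finally show ?thesis
        unfolding st Let_def using cg_step(4)[OF inv False] by (simp add: mult.assoc)
    qed
  qed
  then show "cg B g u0 k \<in> carrier_vec d"
    "(ustar - cg B g u0 k) \<odot> (B *\<^sub>v (ustar - cg B g u0 k))
      \<le> (1 - lo / hi) ^ k * ((ustar - u0) \<odot> (B *\<^sub>v (ustar - u0)))"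
    by (auto simp: cg_def cg_inv_def split: prod.splits)
qed

end

section \<open>Rank and inverses\<close>

text \<open>
  The rank is the dimension of the span of the set of columns, so the columns have to be shown distinct
  before linear independence of this set can be compared with injectivity.
\<close>

lemma full_rank_iff_injective:
  fixes A :: "real mat"
  assumes A: "A \<in> carrier_mat n d"
  shows "vec_space.rank n A = d \<longleftrightarrow> (\<forall>v \<in> carrier_vec d. A *\<^sub>v v = 0\<^sub>v n \<longrightarrow> v = 0\<^sub>v d)"
proof -
  interpret vec_space "TYPE(real)" n .
  show ?thesis
  proof
    assume rk: "rank A = d"
    have "distinct (cols A)"
    proof (rule ccontr)
      assume "\<not> distinct (cols A)"
      then have lt: "card (set (cols A)) < d"
        using A card_length[of "cols A"] card_distinct[of "cols A"] by (metis carrier_matD(2) cols_length order_le_imp_less_or_eq)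
      obtain S where S: "maximal S (\<lambda>T. T \<subseteq> set (cols A) \<and> lin_indpt T)"
        using maximal_exists[of "(\<lambda>T. T \<subseteq> set (cols A) \<and> lin_indpt T)" "card (set (cols A))" "{}"]
        by (meson List.finite_set card_mono empty_iff empty_subsetI finite_lin_indpt2 rev_finite_subset)
      then have "card S \<le> card (set (cols A))" by (simp add: card_mono maximal_def)
      then show False using lt rk rank_card_indpt[OF A S] by simp
    qed
    then show "\<forall>v \<in> carrier_vec d. A *\<^sub>v v = 0\<^sub>v n \<longrightarrow> v = 0\<^sub>v d"
      using full_rank_lin_indpt[OF A rk] lin_depI[OF A] by blast
  next
    assume inj: "\<forall>v \<in> carrier_vec d. A *\<^sub>v v = 0\<^sub>v n \<longrightarrow> v = 0\<^sub>v d"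
    have "distinct (cols A)"
      unfolding distinct_conv_nth
    proof (intro allI impI notI)
      fix i j assume ij: "i < length (cols A)" "j < length (cols A)" "i \<noteq> j" "cols A ! i = cols A ! j"
      then have ij': "i < d" "j < d" "col A i = col A j" using A by auto
      define v where "v = unit_vec d i - (unit_vec d j :: real Matrix.vec)"
      have "A *\<^sub>v v = A *\<^sub>v unit_vec d i - A *\<^sub>v unit_vec d j"
        using A by (simp add: v_def mult_minus_distrib_mat_vec[of _ n d])
      also have "\<dots> = 0\<^sub>v n"
      proof -
        have unit: "A *\<^sub>v unit_vec d k = col A k" if "k < d" for k
          using A that by (intro eq_vecI) auto
        show ?thesis using ij' A by (simp add: unit) 
      qed
      finally have "v = 0\<^sub>v d" using inj by (simp add: v_def)
      then have "v $ i = 0" using ij' by simp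
      then show False using ij' \<open>i \<noteq> j\<close> by (simp add: v_def)
    qed
    moreover have "lin_indpt (set (cols A))"
      using inj lin_depE[OF A _ calculation] by blast
    ultimately show "rank A = d" by (rule lin_indpt_full_rank[OF A])
  qed
qed

lemma injective_imp_inverse:
  fixes A :: "real mat"
  assumes A: "A \<in> carrier_mat d d" and inj: "\<And>v. v \<in> carrier_vec d \<Longrightarrow> A *\<^sub>v v = 0\<^sub>v d \<Longrightarrow> v = 0\<^sub>v d"
  obtains W where "mat_inverse A = Some W" "W \<in> carrier_mat d d" "A * W = 1\<^sub>m d" "W * A = 1\<^sub>m d"
proof -
  have "det A \<noteq> 0" using det_0_iff_vec_prod_zero_field[OF A] inj by blast
  then have "A \<in> Units (ring_mat TYPE(real) d ())" by (rule det_non_zero_imp_unit[OF A])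
  then have "mat_inverse A \<noteq> None" using mat_inverse(1)[OF A, of "()"] by blast
  then obtain W where W: "mat_inverse A = Some W" by blast
  from that[OF W] mat_inverse(2)[OF A W] show ?thesis by blast
qed

lemma gram_symm: "A \<in> carrier_mat m d \<Longrightarrow> transpose_mat (transpose_mat A * A) = transpose_mat A * (A :: real mat)"
  by (subst transpose_mult[of _ d m]) auto

lemma gram_pos:
  fixes A :: "real mat"
  assumes A: "A \<in> carrier_mat m d" and inj: "\<And>v. v \<in> carrier_vec d \<Longrightarrow> A *\<^sub>v v = 0\<^sub>v m \<Longrightarrow> v = 0\<^sub>v d"
    and v: "v \<in> carrier_vec d" "v \<noteq> 0\<^sub>v d"
  shows "0 < v \<odot> ((transpose_mat A * A) *\<^sub>v v)"
proof -
  have "A *\<^sub>v v \<noteq> 0\<^sub>v m" using inj v by blast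
  then have "sqn (A *\<^sub>v v) \<noteq> 0" using dot_self_eq_0[of "A *\<^sub>v v" m] A v by auto
  then show ?thesis using gram_quadratic_form[OF A v(1)] dot_self_nonneg[of "A *\<^sub>v v"] by simp
qed

text \<open>
  The square root \<open>R\<close> of \<open>A\<^sup>T A\<close> and its inverse \<open>W\<close>: the columns of \<open>A W\<close> are orthonormal, and \<open>R\<close> carries the
  seminorm given by \<open>A\<close> to the Euclidean norm. It serves to whiten \<open>X\<close> and to unfold the preconditioned
  method.
\<close>

lemma gram_sqrt:
  fixes A :: "real mat"
  assumes A: "A \<in> carrier_mat m d" and inj: "\<And>v. v \<in> carrier_vec d \<Longrightarrow> A *\<^sub>v v = 0\<^sub>v m \<Longrightarrow> v = 0\<^sub>v d"
  defines "R \<equiv> psd_sqrt (transpose_mat A * A)"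
  obtains W where "R \<in> carrier_mat d d" "transpose_mat R = R" "R * R = transpose_mat A * A"
    "mat_inverse R = Some W" "W \<in> carrier_mat d d" "transpose_mat W = W" "R * W = 1\<^sub>m d" "W * R = 1\<^sub>m d"
    "\<And>v. v \<in> carrier_vec d \<Longrightarrow> sqn (R *\<^sub>v v) = sqn (A *\<^sub>v v)"
proof -
  have H: "transpose_mat A * A \<in> carrier_mat d d" using A by auto
  note R = psd_sqrt_spec[OF H gram_symm[OF A] gram_pos[OF A inj], folded R_def]
  have nrm: "sqn (R *\<^sub>v v) = sqn (A *\<^sub>v v)" if v: "v \<in> carrier_vec d" for v
    using gram_quadratic_form[OF R(1) v] gram_quadratic_form[OF A v] R(2,3) by simp
  have "v = 0\<^sub>v d" if v: "v \<in> carrier_vec d" "R *\<^sub>v v = 0\<^sub>v d" for v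
  proof -
    have "sqn (A *\<^sub>v v) = 0" using nrm[OF v(1)] v(2) by simp
    then show ?thesis using dot_self_eq_0[of "A *\<^sub>v v" m] A v inj by auto
  qed
  then obtain W where W: "mat_inverse R = Some W" "W \<in> carrier_mat d d" "R * W = 1\<^sub>m d" "W * R = 1\<^sub>m d"
    using injective_imp_inverse[OF R(1)] by blast
  have "transpose_mat W * R = 1\<^sub>m d"
    using transpose_mult[OF R(1) W(2)] W(3) R(2) by simp
  then have "transpose_mat W = transpose_mat W * (R * W)" using W by simp
  also have "\<dots> = (transpose_mat W * R) * W" using W R by (simp add: assoc_mult_mat[of _ d d _ d _ d])
  also have "\<dots> = W" using \<open>transpose_mat W * R = 1\<^sub>m d\<close> W by simp
  finally show thesis using that R W nrm by blast
qed

section \<open>The Walsh-Hadamard matrix\<close>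

lemma walsh_hadamard_carrier: "walsh_hadamard n \<in> carrier_mat (2 ^ n) (2 ^ n)"
proof (induction n)
  case (Suc n)
  then show ?case by (simp add: Let_def mult_2)
qed simp

lemma walsh_hadamard_Suc_entry:
  fixes n M :: nat defines "M \<equiv> 2 ^ n"
  assumes ij: "i < 2 * M" "j < 2 * M"
  shows "walsh_hadamard (Suc n) $$ (i, j) = 1 / sqrt 2 * (if M \<le> i \<and> M \<le> j then - 1 else 1)
    * walsh_hadamard n $$ (if i < M then i else i - M, if j < M then j else j - M)"
proof -
  define H where "H = walsh_hadamard n"
  have H: "H \<in> carrier_mat M M" using walsh_hadamard_carrier by (simp add: H_def M_def)
  have "walsh_hadamard (Suc n) = (1 / sqrt 2) \<cdot>\<^sub>m four_block_mat H H H (- H)"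
    by (simp add: H_def Let_def)
  then show ?thesis using ij H by (auto simp: H_def[symmetric])
qed

lemma walsh_hadamard_entry_sq:
  "i < 2 ^ n \<Longrightarrow> j < 2 ^ n \<Longrightarrow> (walsh_hadamard n $$ (i, j))\<^sup>2 = 1 / 2 ^ n"
proof (induction n arbitrary: i j)
  case (Suc n)
  define i' j' where "i' = (if i < 2 ^ n then i else i - 2 ^ n)" and "j' = (if j < 2 ^ n then j else j - 2 ^ n)"
  have "i' < 2 ^ n" "j' < 2 ^ n" using Suc.prems by (auto simp: i'_def j'_def)
  then have IH: "(walsh_hadamard n $$ (i', j'))\<^sup>2 = 1 / 2 ^ n" by (rule Suc.IH)
  have "walsh_hadamard (Suc n) $$ (i, j) = 1 / sqrt 2 * (if 2 ^ n \<le> i \<and> 2 ^ n \<le> j then - 1 else 1)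
      * walsh_hadamard n $$ (i', j')"
    unfolding i'_def j'_def using Suc.prems by (intro walsh_hadamard_Suc_entry) auto
  then show ?case by (simp add: power_mult_distrib power_divide IH del: walsh_hadamard.simps)
qed simp

lemma sum_lessThan_add: "(\<Sum>i<M + (k :: nat). f i :: real) = (\<Sum>i<M. f i) + (\<Sum>i<k. f (M + i))"
  by (induction k) simp_all

text \<open>
  The two halves of a column of the next matrix are equal up to the sign \<open>sg\<close>. For two columns with the
  same sign the inner products of the halves add up, otherwise they cancel.
\<close>

lemma walsh_hadamard_orthonormal:
  "j < 2 ^ n \<Longrightarrow> j' < 2 ^ n \<Longrightarrow>
    (\<Sum>i<2 ^ n. walsh_hadamard n $$ (i, j) * walsh_hadamard n $$ (i, j')) = (if j = j' then 1 else 0)"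
proof (induction n arbitrary: j j')
  case (Suc n)
  define M where "M = (2 :: nat) ^ n"
  define H where "H = walsh_hadamard n"
  define sg :: "nat \<Rightarrow> real" where "sg j = (if M \<le> j then - 1 else 1)" for j
  define k k' where "k = (if j < M then j else j - M)" and "k' = (if j' < M then j' else j' - M)"
  have jj: "j < 2 * M" "j' < 2 * M" using Suc.prems by (simp_all add: M_def)
  then have kk: "k < M" "k' < M" by (auto simp: k_def k'_def)
  have top: "walsh_hadamard (Suc n) $$ (i, l) = 1 / sqrt 2 * H $$ (i, if l < M then l else l - M)"
    if "i < M" "l < 2 * M" for i l
    using walsh_hadamard_Suc_entry[of i n l] that by (simp add: M_def H_def del: walsh_hadamard.simps)
  have bot: "walsh_hadamard (Suc n) $$ (M + i, l) = 1 / sqrt 2 * sg l * H $$ (i, if l < M then l else l - M)"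
    if "i < M" "l < 2 * M" for i l
    using walsh_hadamard_Suc_entry[of "M + i" n l] that by (simp add: M_def H_def sg_def del: walsh_hadamard.simps)
  have "(\<Sum>i<2 ^ Suc n. walsh_hadamard (Suc n) $$ (i, j) * walsh_hadamard (Suc n) $$ (i, j'))
      = (\<Sum>i<M. walsh_hadamard (Suc n) $$ (i, j) * walsh_hadamard (Suc n) $$ (i, j'))
      + (\<Sum>i<M. walsh_hadamard (Suc n) $$ (M + i, j) * walsh_hadamard (Suc n) $$ (M + i, j'))"
  proof -
    have "(2 :: nat) ^ Suc n = M + M" by (simp add: M_def)
    then show ?thesis by (simp only: sum_lessThan_add)
  qed
  also have "\<dots> = (\<Sum>i<M. (1 + sg j * sg j') / 2 * (H $$ (i, k) * H $$ (i, k')))"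
    unfolding sum.distrib[symmetric]
  proof (intro sum.cong refl)
    fix i assume "i \<in> {..<M}"
    then have i: "i < M" by simp
    show "walsh_hadamard (Suc n) $$ (i, j) * walsh_hadamard (Suc n) $$ (i, j')
        + walsh_hadamard (Suc n) $$ (M + i, j) * walsh_hadamard (Suc n) $$ (M + i, j')
        = (1 + sg j * sg j') / 2 * (H $$ (i, k) * H $$ (i, k'))"
      unfolding top[OF i jj(1)] top[OF i jj(2)] bot[OF i jj(1)] bot[OF i jj(2)]
        k_def[symmetric] k'_def[symmetric]
      by (simp add: field_simps)
  qed
  also have "\<dots> = (1 + sg j * sg j') / 2 * (if k = k' then 1 else 0)"
    using Suc.IH[of k k'] kk by (simp only: sum_distrib_left[symmetric] H_def M_def)
  also have "\<dots> = (if j = j' then 1 else 0)"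
    using jj by (auto simp: sg_def k_def k'_def split: if_splits)
  finally show ?case .
qed simp

section \<open>Quadratic forms of the sketches\<close>

lemma sum_pick:
  assumes "finite I"
  shows "(\<Sum>a<card I. f (pick I a) :: real) = (\<Sum>i\<in>I. f i)"
proof (rule sum.reindex_bij_betw)
  have "pick I ` {..<card I} = I"
  proof
    show "pick I ` {..<card I} \<subseteq> I" using pick_in_set_le by auto
    show "I \<subseteq> pick I ` {..<card I}"
    proof
      fix i assume i: "i \<in> I"
      then have "{a \<in> I. a < i} \<subset> I" by auto
      then have "card {a \<in> I. a < i} < card I" using assms by (rule psubset_card_mono[rotated])
      then show "i \<in> pick I ` {..<card I}" 
        by (intro image_eqI[of i "pick I" "card {a \<in> I. a < i}"]) (simp_all add: pick_card_in_set[OF i])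
    qed
  qed
  then show "bij_betw (pick I) {..<card I} I"
    unfolding bij_betw_def using assms by (metis card_lessThan eq_card_imp_inj_on finite_lessThan)
qed

text \<open>
  The norms of sketched vectors no longer depend on the order in which the rows in \<open>I\<close> are listed, so a sum
  over \<open>I\<close> replaces the enumeration of \<open>I\<close> by \<open>pick\<close>.
\<close>

lemma srht_quadratic_form:
  fixes n defines "N \<equiv> (2 :: nat) ^ n"
  assumes I: "I \<subseteq> {..<N}" "card I = m" and p: "p permutes {..<N}"
  shows "srht n m (s, p) I \<in> carrier_mat m N"
    "y \<in> carrier_vec N \<Longrightarrow> sqn (srht n m (s, p) I *\<^sub>v y)
      = real N / real m * (\<Sum>i\<in>I. (\<Sum>j<N. walsh_hadamard n $$ (i, j) * s j * y $ p j)\<^sup>2)"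
proof -
  define H where "H = walsh_hadamard n"
  define Pm where "Pm = permutation_matrix N p"
  define M where "M = H * mat_diag N s * Pm"
  have H: "H \<in> carrier_mat N N" using walsh_hadamard_carrier by (simp add: H_def N_def)
  have Pm: "Pm \<in> carrier_mat N N" by (simp add: Pm_def permutation_matrix_def)
  have D: "mat_diag N s \<in> carrier_mat N N" by (simp add: mat_diag_def)
  have M: "M \<in> carrier_mat N N" unfolding M_def by (rule mult_carrier_mat[OF mult_carrier_mat[OF H D] Pm])
  have finI: "finite I" using I finite_subset by auto
  have setI: "{i. i < N \<and> i \<in> I} = I" using I by auto
  have sub: "submatrix M I UNIV \<in> carrier_mat m N"
    using M I by (auto simp: setI dim_submatrix intro!: carrier_matI)
  have eq: "srht n m (s, p) I = sqrt (real N / real m) \<cdot>\<^sub>m submatrix M I UNIV"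
    by (simp add: M_def H_def Pm_def N_def)
  then show car: "srht n m (s, p) I \<in> carrier_mat m N" using sub by simp
  assume y: "y \<in> carrier_vec N"
  have My: "(M *\<^sub>v y) $ i = (\<Sum>j<N. H $$ (i, j) * s j * y $ p j)" if i: "i < N" for i
  proof -
    have pj: "p j < N" if "j < N" for j using permutes_in_image[OF p] that by auto
    have Py: "(Pm *\<^sub>v y) $ j = y $ p j" if "j < N" for j
    proof -
      have "(Pm *\<^sub>v y) $ j = (\<Sum>k\<in>{0..<N}. (if k = p j then 1 else 0) * y $ k)"
        using that y unfolding Pm_def permutation_matrix_def by (simp add: scalar_prod_def)
      also have "\<dots> = (\<Sum>k\<in>{0..<N}. if k = p j then y $ k else 0)"
        by (intro sum.cong refl) simp
      finally have "(Pm *\<^sub>v y) $ j = (\<Sum>k\<in>{0..<N}. if k = p j then y $ k else 0)" .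
      then show ?thesis using pj[OF that] by simp
    qed
    have HD: "H * mat_diag N s \<in> carrier_mat N N" using H D by auto
    have "(M *\<^sub>v y) = (H * mat_diag N s) *\<^sub>v (Pm *\<^sub>v y)"
      unfolding M_def by (rule assoc_mult_mat_vec[OF HD Pm y])
    moreover have "((H * mat_diag N s) *\<^sub>v (Pm *\<^sub>v y)) $ i = (\<Sum>j<N. H $$ (i, j) * s j * y $ p j)"
      unfolding mat_diag_mult_right[OF H] using i Pm y
      by (auto simp: scalar_prod_def Py atLeast0LessThan simp del: index_mult_mat_vec(1)
          simp: index_mult_mat_vec(1)[of i "Matrix.mat N N (\<lambda>(i, j). H $$ (i, j) * s j)"]
          intro!: sum.cong)
    ultimately show ?thesis by simp
  qed
  have row: "(submatrix M I UNIV *\<^sub>v y) $ a = (M *\<^sub>v y) $ pick I a" if "a < m" for a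
  proof -
    have pa: "pick I a < N" using pick_in_set_le[of a I] that I by auto
    have "submatrix M I UNIV $$ (a, k) = M $$ (pick I a, k)" if "k < N" for k
      using that \<open>a < m\<close> M I by (subst submatrix_index) (auto simp: setI pick_UNIV)
    then show ?thesis using that pa M sub y
      by (auto simp: scalar_prod_def intro!: sum.cong)
  qed
  have "sqn (srht n m (s, p) I *\<^sub>v y)
      = (\<Sum>a<m. (srht n m (s, p) I *\<^sub>v y) $ a * (srht n m (s, p) I *\<^sub>v y) $ a)"
    using car by (auto simp: scalar_prod_def atLeast0LessThan simp del: srht.simps)
  also have "\<dots> = (\<Sum>a<m. real N / real m * ((M *\<^sub>v y) $ pick I a)\<^sup>2)"
  proof (intro sum.cong refl)
    fix a assume a: "a \<in> {..<m}"
    have "(srht n m (s, p) I *\<^sub>v y) $ a = sqrt (real N / real m) * (submatrix M I UNIV *\<^sub>v y) $ a"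
      using a sub y unfolding eq by (auto simp: scalar_prod_def sum_distrib_left mult.assoc)
    then have "(srht n m (s, p) I *\<^sub>v y) $ a * (srht n m (s, p) I *\<^sub>v y) $ a
        = (sqrt (real N / real m) * sqrt (real N / real m)) * ((M *\<^sub>v y) $ pick I a)\<^sup>2"
      using row[of a] a by (simp add: power2_eq_square del: srht.simps real_sqrt_mult_self)
    then show "(srht n m (s, p) I *\<^sub>v y) $ a * (srht n m (s, p) I *\<^sub>v y) $ a
        = real N / real m * ((M *\<^sub>v y) $ pick I a)\<^sup>2" by simp
  qed
  also have "\<dots> = real N / real m * (\<Sum>i\<in>I. ((M *\<^sub>v y) $ i)\<^sup>2)"
    unfolding sum_distrib_left[symmetric]
    using sum_pick[OF finI, of "\<lambda>i. ((M *\<^sub>v y) $ i)\<^sup>2"] I(2) by simp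
  also have "(\<Sum>i\<in>I. ((M *\<^sub>v y) $ i)\<^sup>2)
      = (\<Sum>i\<in>I. (\<Sum>j<N. walsh_hadamard n $$ (i, j) * s j * y $ p j)\<^sup>2)"
    by (intro sum.cong refl) (use I My in \<open>auto simp: H_def\<close>)
  finally show "sqn (srht n m (s, p) I *\<^sub>v y)
      = real N / real m * (\<Sum>i\<in>I. (\<Sum>j<N. walsh_hadamard n $$ (i, j) * s j * y $ p j)\<^sup>2)" .
qed

text \<open>
  The subspace embedding property of \<open>S\<close> for the range of \<open>X\<close>, stated for squared norms.
\<close>

definition embeds :: "real \<Rightarrow> real mat \<Rightarrow> real mat \<Rightarrow> bool" where
  "embeds \<eta> S X \<longleftrightarrow> (\<forall>v \<in> carrier_vec (dim_col X).
     \<bar>sqn (S *\<^sub>v (X *\<^sub>v v)) - sqn (X *\<^sub>v v)\<bar> \<le> \<eta> * sqn (X *\<^sub>v v))"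

lemma prob_pmf_mono:
  assumes "\<And>x. x \<in> set_pmf p \<Longrightarrow> x \<in> A \<Longrightarrow> x \<in> B"
  shows "measure_pmf.prob p A \<le> measure_pmf.prob p B"
  by (rule measure_pmf.finite_measure_mono_AE) (use assms in \<open>auto simp: AE_measure_pmf_iff\<close>)

text \<open>
  The permutation is brought to the front in order to condition on it.
\<close>

lemma pair_pair_pmf_rotate:
  "pair_pmf (pair_pmf q1 q2) q3 = map_pmf (\<lambda>(p, s, I). ((s, p), I)) (pair_pmf q2 (pair_pmf q1 q3))"
  unfolding pair_pmf_def map_bind_pmf bind_assoc_pmf bind_return_pmf
  by (subst bind_commute_pmf) (simp add: bind_return_pmf map_pmf_def bind_assoc_pmf)

text \<open>
  For a fixed permutation, the whitened rows of \<open>X\<close> in the permuted order are a Parseval family, and the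
  sketch embeds \<open>X\<close> if the sampled mixed rows do not distort any vector.
  The bound is uniform in the permutation, so it holds for a random one.
\<close>

lemma prob_srht_not_embeds_le:
  fixes n d m :: nat and X :: "real mat" defines "N \<equiv> (2 :: nat) ^ n"
  assumes d: "0 < d" and X: "X \<in> carrier_mat N d"
    and inj: "\<And>v. v \<in> carrier_vec d \<Longrightarrow> X *\<^sub>v v = 0\<^sub>v N \<Longrightarrow> v = 0\<^sub>v d"
    and m: "0 < m" "m \<le> N" and \<eta>: "0 < \<eta>" "\<eta> \<le> 1" and P: "0 < P"
    and PQ: "4 * real P * (exp 1 * (real d + 4 * real Q)) \<le> \<eta>\<^sup>2 / (5 * exp 1) * real m"
  shows "measure_pmf.prob (pair_pmf (sign_perm_law N) (index_law N m))
      {(g, I). \<not> embeds \<eta> (srht n m g I) X} \<le> real N * exp (- real Q) + real d * exp (- real P)"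
proof -
  define b where "b = real N * exp (- real Q) + real d * exp (- real P)"
  have N: "0 < N" by (simp add: N_def)
  have fin: "finite {I. I \<subseteq> {..<N} \<and> card I = m}"
    by (rule finite_subset[of _ "Pow {..<N}"]) auto
  have ne: "{I. I \<subseteq> {..<N} \<and> card I = m} \<noteq> {}"
  proof -
    have "{..<m} \<in> {I. I \<subseteq> {..<N} \<and> card I = m}" using m by auto
    then show ?thesis by (metis empty_iff)
  qed
  have set_idx: "I \<subseteq> {..<N}" "card I = m" if "I \<in> set_pmf (index_law N m)" for I
    using that fin ne by (auto simp: index_law_def)
  obtain R W where RW: "R \<in> carrier_mat d d" "R * R = transpose_mat X * X"
      "W \<in> carrier_mat d d" "transpose_mat W = W" "R * W = 1\<^sub>m d" "W * R = 1\<^sub>m d"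
      "\<And>v. v \<in> carrier_vec d \<Longrightarrow> sqn (R *\<^sub>v v) = sqn (X *\<^sub>v v)"
    using gram_sqrt[OF X inj] by metis
  define U where "U = X * W"
  have U: "U \<in> carrier_mat N d" using X RW by (simp add: U_def)
  have UU: "transpose_mat U * U = 1\<^sub>m d"
  proof -
    have "transpose_mat U = W * transpose_mat X"
      unfolding U_def using transpose_mult[OF X RW(3)] RW(4) by simp
    then have "transpose_mat U * U = W * transpose_mat X * (X * W)" by (simp add: U_def)
    also have "\<dots> = W * (transpose_mat X * (X * W))"
      by (rule assoc_mult_mat[of _ d d _ N _ d]) (use X RW in auto)
    also have "transpose_mat X * (X * W) = (transpose_mat X * X) * W"
      by (rule assoc_mult_mat[symmetric, of _ d N _ d _ d]) (use X RW in auto)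
    also have "\<dots> = R * (R * W)"
      unfolding RW(2)[symmetric] by (rule assoc_mult_mat[of _ d d _ d _ d]) (use RW in auto)
    also have "W * (R * (R * W)) = 1\<^sub>m d" using RW by simp
    finally show ?thesis .
  qed
  have XU: "X *\<^sub>v v = U *\<^sub>v (R *\<^sub>v v)" if "v \<in> carrier_vec d" for v
  proof -
    have "U *\<^sub>v (R *\<^sub>v v) = X *\<^sub>v (W *\<^sub>v (R *\<^sub>v v))"
      unfolding U_def by (rule assoc_mult_mat_vec[OF X RW(3)]) (use RW that in auto)
    also have "W *\<^sub>v (R *\<^sub>v v) = (W * R) *\<^sub>v v"
      by (rule assoc_mult_mat_vec[symmetric, OF RW(3,1) that])
    finally show ?thesis using RW(6) that by simp
  qed
  have main: "measure_pmf.prob (pair_pmf (Pi_pmf {..<N} 1 (\<lambda>_. pmf_of_set {- 1, 1})) (index_law N m))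
      {(s, I). \<not> embeds \<eta> (srht n m (s, p) I) X} \<le> b" if p: "p permutes {..<N}" for p
  proof -
    define u where "u j k = U $$ (p j, k)" for j k
    define Hf where "Hf i j = walsh_hadamard n $$ (i, j)" for i j
    have pj: "p j < N" if "j < N" for j using permutes_in_image[OF p] that by auto
    have par: "(\<Sum>j<N. u j k * u j k') = idm d k k'" if k: "k < d" "k' < d" for k k'
    proof -
      have "(\<Sum>j<N. u j k * u j k') = (\<Sum>j<N. U $$ (j, k) * U $$ (j, k'))"
        unfolding u_def by (rule sum.permute[OF p, symmetric, unfolded o_def])
      also have "\<dots> = (transpose_mat U * U) $$ (k, k')"
        using k U by (auto simp: scalar_prod_def atLeast0LessThan)
      finally show ?thesis using k by (simp add: UU idm_def)
    qed
    then interpret parseval d N u by unfold_locales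
    have bound: "measure_pmf.prob (pair_pmf (Pi_pmf {..<N} 1 (\<lambda>_. pmf_of_set {- 1, 1})) (index_law N m))
        {(s, I). distorted d N (\<lambda>i k. \<Sum>j<N. Hf i j * s j * u j k) \<eta> I} \<le> b"
      unfolding b_def
    proof (rule prob_mixed_rows_distorted_le[OF d N _ _ m \<eta> P PQ])
      show "(Hf i j)\<^sup>2 = 1 / real N" if "i < N" "j < N" for i j
        using walsh_hadamard_entry_sq[of i n j] that by (simp add: Hf_def N_def)
      show "(\<Sum>i<N. Hf i j * Hf i j') = (if j = j' then 1 else 0)" if "j < N" "j' < N" for j j'
        using walsh_hadamard_orthonormal[of j n j'] that by (simp add: Hf_def N_def)
    qed
    have good: "embeds \<eta> (srht n m (s, p) I) X"
      if I: "I \<subseteq> {..<N}" "card I = m" and nd: "\<not> distorted d N (\<lambda>i k. \<Sum>j<N. Hf i j * s j * u j k) \<eta> I" for s I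
      unfolding embeds_def
    proof
      fix v :: "real Matrix.vec" assume "v \<in> carrier_vec (dim_col X)"
      then have v: "v \<in> carrier_vec d" using X by simp
      define w where "w = R *\<^sub>v v"
      have w: "w \<in> carrier_vec d" using RW v by (simp add: w_def)
      have Xv: "X *\<^sub>v v \<in> carrier_vec N" using X v by simp
      have Xvi: "(X *\<^sub>v v) $ p j = (\<Sum>k<d. u j k * w $ k)" if "j < N" for j
        using pj[OF that] U w unfolding XU[OF v] w_def[symmetric]
        by (auto simp: u_def scalar_prod_def atLeast0LessThan intro!: sum.cong)
      have "(\<Sum>j<N. walsh_hadamard n $$ (i, j) * s j * (X *\<^sub>v v) $ p j)
          = (\<Sum>k<d. (\<Sum>j<N. Hf i j * s j * u j k) * w $ k)" for i
      proof -
        have "(\<Sum>j<N. walsh_hadamard n $$ (i, j) * s j * (X *\<^sub>v v) $ p j)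
            = (\<Sum>j<N. \<Sum>k<d. Hf i j * s j * u j k * w $ k)"
          by (intro sum.cong refl) (simp add: Xvi Hf_def sum_distrib_left mult.assoc)
        also have "\<dots> = (\<Sum>k<d. \<Sum>j<N. Hf i j * s j * u j k * w $ k)" by (rule sum.swap)
        finally show ?thesis by (simp add: sum_distrib_right)
      qed
      then have SX: "sqn (srht n m (s, p) I *\<^sub>v (X *\<^sub>v v))
          = real N / real m * (\<Sum>i\<in>I. (\<Sum>k<d. (\<Sum>j<N. Hf i j * s j * u j k) * w $ k)\<^sup>2)"
        using srht_quadratic_form(2)[of I n m p "X *\<^sub>v v" s] I p Xv by (simp add: N_def del: srht.simps)
      have "sqn (X *\<^sub>v v) = w \<odot> w" using RW(7)[OF v] by (simp add: w_def)
      also have "\<dots> = (\<Sum>k<d. (w $ k)\<^sup>2)"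
        using w by (simp add: scalar_prod_def atLeast0LessThan power2_eq_square)
      finally show "\<bar>sqn (srht n m (s, p) I *\<^sub>v (X *\<^sub>v v))
          - sqn (X *\<^sub>v v)\<bar> \<le> \<eta> * sqn (X *\<^sub>v v)"
        using nd unfolding distorted_def SX by (simp add: I(2) not_less)
    qed
    show ?thesis
    proof (rule order_trans[OF prob_pmf_mono bound])
      fix t assume t: "t \<in> set_pmf (pair_pmf (Pi_pmf {..<N} 1 (\<lambda>_. pmf_of_set {- 1, 1})) (index_law N m))"
        and bad: "t \<in> {(s, I). \<not> embeds \<eta> (srht n m (s, p) I) X}"
      obtain s I where sI: "t = (s, I)" by (cases t)
      then have "I \<in> set_pmf (index_law N m)" using t by simp
      then show "t \<in> {(s, I). distorted d N (\<lambda>i k. \<Sum>j<N. Hf i j * s j * u j k) \<eta> I}"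
        using good[OF set_idx, of I s] bad unfolding sI by blast
    qed
  qed
  have finp: "finite {p. p permutes {..<N}}" by (rule finite_permutations) simp
  have nep: "{p. p permutes {..<N}} \<noteq> {}" using permutes_id by blast
  have "measure_pmf.prob (pair_pmf (sign_perm_law N) (index_law N m)) {(g, I). \<not> embeds \<eta> (srht n m g I) X}
      = measure_pmf.prob (pair_pmf (pmf_of_set {p. p permutes {..<N}})
          (pair_pmf (Pi_pmf {..<N} 1 (\<lambda>_. pmf_of_set {- 1, 1})) (index_law N m)))
          {(p, s, I). \<not> embeds \<eta> (srht n m (s, p) I) X}"
    unfolding sign_perm_law_def pair_pair_pmf_rotate by (simp add: vimage_def case_prod_unfold)
  also have "\<dots> \<le> 0 + b"
  proof (rule prob_pair_le[of _ "{}"])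
    show "0 \<le> b" by (simp add: b_def)
    fix p assume "p \<in> set_pmf (pmf_of_set {p. p permutes {..<N}})"
    then have "p permutes {..<N}" using finp nep by simp
    from main[OF this] show "measure_pmf.prob (pair_pmf (Pi_pmf {..<N} 1 (\<lambda>_. pmf_of_set {- 1, 1})) (index_law N m))
        {y. (p, y) \<in> {(p, s, I). \<not> embeds \<eta> (srht n m (s, p) I) X}} \<le> b"
      by (simp add: case_prod_unfold del: srht.simps)
  qed simp
  finally show ?thesis by (simp add: b_def)
qed

section \<open>Preconditioned conjugate gradients and least squares\<close>

text \<open>
  With \<open>R\<close> the square root of \<open>Z\<^sup>T Z\<close> and \<open>W\<close> its inverse, the preconditioned matrix \<open>B\<close> is the Gram matrix of \<open>A W\<close>.
  Since \<open>Z W\<close> preserves norms, comparing \<open>A\<close> with \<open>Z\<close> amounts to bounding the form of \<open>B\<close>; and the energy of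
  the error of the conjugate gradient iterate is the squared norm of \<open>A\<close> applied to the error of \<open>y\<close>.
\<close>

lemma pcg_error_bound:
  fixes A Z :: "real mat" and k :: nat
  assumes A: "A \<in> carrier_mat m d" and b: "b \<in> carrier_vec m" and Z: "Z \<in> carrier_mat r d"
    and injZ: "\<And>v. v \<in> carrier_vec d \<Longrightarrow> Z *\<^sub>v v = 0\<^sub>v r \<Longrightarrow> v = 0\<^sub>v d"
    and lohi: "0 < lo" "lo \<le> hi"
    and lo: "\<And>v. v \<in> carrier_vec d \<Longrightarrow> lo * sqn (Z *\<^sub>v v) \<le> sqn (A *\<^sub>v v)"
    and hi: "\<And>v. v \<in> carrier_vec d \<Longrightarrow> sqn (A *\<^sub>v v) \<le> hi * sqn (Z *\<^sub>v v)"
    and sol: "x \<in> carrier_vec d" "(transpose_mat A * A) *\<^sub>v x = transpose_mat A *\<^sub>v b"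
    and u0: "u0 \<in> carrier_vec d"
  defines "y \<equiv> pcg A b (transpose_mat Z * Z) u0 k"
  shows "y \<in> carrier_vec d"
    "sqn (A *\<^sub>v (x - y)) \<le> (1 - lo / hi) ^ k * sqn (A *\<^sub>v (x - u0))"
proof -
  define R where "R = psd_sqrt (transpose_mat Z * Z)"
  obtain W where R: "R \<in> carrier_mat d d" and minv: "mat_inverse R = Some W"
    and W: "W \<in> carrier_mat d d" "transpose_mat W = W" and inv: "R * W = 1\<^sub>m d" "W * R = 1\<^sub>m d"
    and nrm: "\<And>v. v \<in> carrier_vec d \<Longrightarrow> sqn (R *\<^sub>v v) = sqn (Z *\<^sub>v v)"
    unfolding R_def using gram_sqrt[OF Z injZ] by metis
  have RW: "R *\<^sub>v (W *\<^sub>v v) = v" and WR: "W *\<^sub>v (R *\<^sub>v v) = v" if "v \<in> carrier_vec d" for v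
    using assoc_mult_mat_vec[OF R W(1) that] assoc_mult_mat_vec[OF W(1) R that] inv that by simp_all
  define G where "G = transpose_mat A * A"
  have G: "G \<in> carrier_mat d d" using A by (simp add: G_def)
  define B where "B = W * G * W"
  have AW: "A * W \<in> carrier_mat m d" using A W by simp
  have Bgram: "B = transpose_mat (A * W) * (A * W)"
  proof -
    have "transpose_mat (A * W) * (A * W) = (W * transpose_mat A) * (A * W)"
      using transpose_mult[OF A W(1)] W(2) by simp
    also have "\<dots> = W * (transpose_mat A * (A * W))"
      by (rule assoc_mult_mat[of _ d d _ m _ d]) (use A W in auto)
    also have "transpose_mat A * (A * W) = G * W"
      unfolding G_def by (rule assoc_mult_mat[symmetric, of _ d m _ d _ d]) (use A W in auto)
    also have "W * (G * W) = B"
      unfolding B_def by (rule assoc_mult_mat[symmetric, of _ d d _ d _ d]) (use G W in auto)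
    finally show ?thesis by simp
  qed
  have B: "B \<in> carrier_mat d d" "transpose_mat B = B"
    using gram_symm[OF AW] AW by (simp_all add: Bgram)
  have Bq: "v \<odot> (B *\<^sub>v v) = sqn (A *\<^sub>v (W *\<^sub>v v))" if "v \<in> carrier_vec d" for v
    using gram_quadratic_form[OF AW that] assoc_mult_mat_vec[OF A W(1) that] by (simp add: Bgram)
  define g where "g = W *\<^sub>v (transpose_mat A *\<^sub>v b)"
  have g: "g \<in> carrier_vec d" using A W b by (simp add: g_def)
  have bounds: "lo * (v \<odot> v) \<le> v \<odot> (B *\<^sub>v v)" "v \<odot> (B *\<^sub>v v) \<le> hi * (v \<odot> v)" if v: "v \<in> carrier_vec d" for v
  proof -
    have Wv: "W *\<^sub>v v \<in> carrier_vec d" using W v by simp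
    have "v \<odot> v = sqn (Z *\<^sub>v (W *\<^sub>v v))" using nrm[OF Wv] RW[OF v] by simp
    then show "lo * (v \<odot> v) \<le> v \<odot> (B *\<^sub>v v)" "v \<odot> (B *\<^sub>v v) \<le> hi * (v \<odot> v)"
      using lo[OF Wv] hi[OF Wv] Bq[OF v] by simp_all
  qed
  have Rx: "R *\<^sub>v x \<in> carrier_vec d" and Ru: "R *\<^sub>v u0 \<in> carrier_vec d" using R sol u0 by auto
  have Bx: "B *\<^sub>v (R *\<^sub>v x) = g"
  proof -
    have "B *\<^sub>v (R *\<^sub>v x) = (W * G) *\<^sub>v (W *\<^sub>v (R *\<^sub>v x))"
      unfolding B_def by (rule assoc_mult_mat_vec) (use W G Rx in auto)
    also have "\<dots> = W *\<^sub>v (G *\<^sub>v x)" unfolding WR[OF sol(1)] by (rule assoc_mult_mat_vec[OF W(1) G sol(1)])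
    finally show ?thesis using sol(2) by (simp add: G_def g_def)
  qed
  define c where "c = cg B g (R *\<^sub>v u0) k"
  note cg = cg_error_bound[OF B g lohi bounds Ru Rx Bx, of k, folded c_def]
  have y: "y = W *\<^sub>v c"
    unfolding y_def pcg_def R_def[symmetric] Let_def minv option.sel
    by (simp add: c_def B_def g_def G_def)
  then show "y \<in> carrier_vec d" using W cg(1) by simp
  have e: "W *\<^sub>v (R *\<^sub>v x - c) = x - y" "W *\<^sub>v (R *\<^sub>v x - R *\<^sub>v u0) = x - u0"
    using W Rx Ru cg(1) sol(1) u0 by (simp_all add: mult_minus_distrib_mat_vec[of _ d d] WR y)
  have "sqn (A *\<^sub>v (x - y)) = (R *\<^sub>v x - c) \<odot> (B *\<^sub>v (R *\<^sub>v x - c))"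
    using Bq[of "R *\<^sub>v x - c"] Rx cg(1) e(1) by simp
  also have "\<dots> \<le> (1 - lo / hi) ^ k * ((R *\<^sub>v x - R *\<^sub>v u0) \<odot> (B *\<^sub>v (R *\<^sub>v x - R *\<^sub>v u0)))"
    by (rule cg(2))
  also have "(R *\<^sub>v x - R *\<^sub>v u0) \<odot> (B *\<^sub>v (R *\<^sub>v x - R *\<^sub>v u0)) = sqn (A *\<^sub>v (x - u0))"
    using Bq[of "R *\<^sub>v x - R *\<^sub>v u0"] Rx Ru e(2) by simp
  finally show "sqn (A *\<^sub>v (x - y)) \<le> (1 - lo / hi) ^ k * sqn (A *\<^sub>v (x - u0))" .
qed

text \<open>
  The normal equations give a linear solution operator \<open>L\<close>, and Pythagoras' theorem shows that \<open>L b\<close> is the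
  only minimizer, hence the one chosen by the definition.
\<close>

lemma least_squares_properties:
  assumes A: "A \<in> carrier_mat m d" and inj: "\<And>v. v \<in> carrier_vec d \<Longrightarrow> A *\<^sub>v v = 0\<^sub>v m \<Longrightarrow> v = 0\<^sub>v d"
  obtains L where "L \<in> carrier_mat d m"
    "\<And>b. b \<in> carrier_vec m \<Longrightarrow> least_squares A b = L *\<^sub>v b"
    "\<And>b. b \<in> carrier_vec m \<Longrightarrow> (transpose_mat A * A) *\<^sub>v (L *\<^sub>v b) = transpose_mat A *\<^sub>v b"
    "\<And>b u. b \<in> carrier_vec m \<Longrightarrow> u \<in> carrier_vec d \<Longrightarrow> eucl_norm (A *\<^sub>v (L *\<^sub>v b) - b) \<le> eucl_norm (A *\<^sub>v u - b)"
proof -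
  define G where "G = transpose_mat A * A"
  have G: "G \<in> carrier_mat d d" using A by (simp add: G_def)
  have "v = 0\<^sub>v d" if "v \<in> carrier_vec d" "G *\<^sub>v v = 0\<^sub>v d" for v
    using gram_pos[OF A inj that(1)] that by (cases "v = 0\<^sub>v d") (auto simp: G_def)
  then obtain V where V: "V \<in> carrier_mat d d" "G * V = 1\<^sub>m d"
    using injective_imp_inverse[OF G] by metis
  define L where "L = V * transpose_mat A"
  have L: "L \<in> carrier_mat d m" using V A by (simp add: L_def)
  have normal: "G *\<^sub>v (L *\<^sub>v b) = transpose_mat A *\<^sub>v b" if b: "b \<in> carrier_vec m" for b
  proof -
    have Atb: "transpose_mat A *\<^sub>v b \<in> carrier_vec d" using A b by simp
    have "L *\<^sub>v b = V *\<^sub>v (transpose_mat A *\<^sub>v b)"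
      unfolding L_def by (rule assoc_mult_mat_vec[OF V(1)]) (use A b in auto)
    then have "G *\<^sub>v (L *\<^sub>v b) = (G * V) *\<^sub>v (transpose_mat A *\<^sub>v b)"
      using assoc_mult_mat_vec[OF G V(1) Atb] by simp
    then show ?thesis using V Atb by simp
  qed
  have pyth: "sqn (A *\<^sub>v u - b) = sqn (A *\<^sub>v (L *\<^sub>v b) - b)
      + sqn (A *\<^sub>v (u - L *\<^sub>v b))"
    if b: "b \<in> carrier_vec m" and u: "u \<in> carrier_vec d" for b u
  proof -
    define x where "x = L *\<^sub>v b"
    have x: "x \<in> carrier_vec d" using L b by (simp add: x_def)
    define e f where "e = A *\<^sub>v x - b" and "f = A *\<^sub>v (u - x)"
    have Ax: "A *\<^sub>v x \<in> carrier_vec m" using A x by simp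
    have ef: "e \<in> carrier_vec m" "f \<in> carrier_vec m" using A x u b by (simp_all add: e_def f_def)
    have "transpose_mat A *\<^sub>v e = transpose_mat A *\<^sub>v (A *\<^sub>v x) - transpose_mat A *\<^sub>v b"
      unfolding e_def by (rule mult_minus_distrib_mat_vec[of _ d m]) (use A Ax b in auto)
    also have "transpose_mat A *\<^sub>v (A *\<^sub>v x) = G *\<^sub>v x"
      unfolding G_def by (rule assoc_mult_mat_vec[symmetric, of _ d m]) (use A x in auto)
    finally have "transpose_mat A *\<^sub>v e = 0\<^sub>v d" using normal[OF b] A b by (simp add: x_def)
    then have "e \<odot> f = 0"
      unfolding f_def using transpose_vec_mult_scalar[OF A _ ef(1), of "u - x"] u x by simp
    moreover have "f \<odot> e = e \<odot> f" by (rule comm_scalar_prod[OF ef(2,1)])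
    moreover have "A *\<^sub>v u - b = e + f"
      using A x u b Ax by (auto simp: e_def f_def mult_minus_distrib_mat_vec[of _ m d] intro!: eq_vecI)
    ultimately have "sqn (A *\<^sub>v u - b) = e \<odot> e + f \<odot> f"
      using ef by (simp add: add_scalar_prod_distrib[of _ m] scalar_prod_add_distrib[of _ m])
    then show ?thesis by (simp add: e_def f_def x_def)
  qed
  have "least_squares A b = L *\<^sub>v b" if b: "b \<in> carrier_vec m" for b
  proof -
    define F where "F = (\<lambda>u. 1 / 2 * (eucl_norm (A *\<^sub>v u - b))\<^sup>2)"
    have Lb: "L *\<^sub>v b \<in> carrier_vec d" using L b by simp
    have F: "F u = F (L *\<^sub>v b) + 1 / 2 * sqn (A *\<^sub>v (u - L *\<^sub>v b))"
      if "u \<in> carrier_vec d" for u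
      unfolding F_def eucl_norm_sq pyth[OF b that] by simp
    have F_le: "F (L *\<^sub>v b) \<le> F u" if "u \<in> carrier_vec d" for u
      unfolding F[OF that] using dot_self_nonneg[of "A *\<^sub>v (u - L *\<^sub>v b)"] by simp
    have "is_arg_min F (\<lambda>u. u \<in> carrier_vec d) (L *\<^sub>v b)"
      unfolding is_arg_min_def using Lb F_le leD by blast
    then have am: "is_arg_min F (\<lambda>u. u \<in> carrier_vec d) (arg_min F (\<lambda>u. u \<in> carrier_vec d))"
      unfolding arg_min_def by (rule someI)
    define u where "u = arg_min F (\<lambda>u. u \<in> carrier_vec d)"
    have u: "u \<in> carrier_vec d" and le: "F u \<le> F (L *\<^sub>v b)"
      using am Lb unfolding is_arg_min_def u_def[symmetric] by (blast, meson not_le)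
    have du: "u - L *\<^sub>v b \<in> carrier_vec d" using u Lb by simp
    have "sqn (A *\<^sub>v (u - L *\<^sub>v b)) = 0"
      using le F[OF u] dot_self_nonneg[of "A *\<^sub>v (u - L *\<^sub>v b)"] by linarith
    then have "A *\<^sub>v (u - L *\<^sub>v b) = 0\<^sub>v m" using dot_self_eq_0[of "A *\<^sub>v (u - L *\<^sub>v b)" m] A du by simp
    then have "u - L *\<^sub>v b = 0\<^sub>v d" by (rule inj[OF du])
    then have "(u - L *\<^sub>v b) $ i = 0" if "i < d" for i using that by simp
    then have "u = L *\<^sub>v b"
      using u Lb L by (intro eq_vecI) auto
    then show ?thesis using A unfolding least_squares_def arg_min_on_def F_def u_def by simp
  qed
  moreover have "eucl_norm (A *\<^sub>v (L *\<^sub>v b) - b) \<le> eucl_norm (A *\<^sub>v u - b)"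
    if "b \<in> carrier_vec m" "u \<in> carrier_vec d" for b u
    unfolding eucl_norm_def pyth[OF that] using dot_self_nonneg by simp
  ultimately show thesis using that[OF L] normal by (simp add: G_def)
qed

section \<open>Measurability of the iterates\<close>

text \<open>
  Measurability is required componentwise, as these vectors carry no measurable structure of their own.
\<close>

definition vec_measurable :: "'z measure \<Rightarrow> nat \<Rightarrow> ('z \<Rightarrow> real Matrix.vec) \<Rightarrow> bool" where
  "vec_measurable M n f \<longleftrightarrow> (\<forall>z. f z \<in> carrier_vec n) \<and> (\<forall>i<n. (\<lambda>z. f z $ i) \<in> borel_measurable M)"

lemma vec_measurable_carrier: "vec_measurable M n f \<Longrightarrow> f z \<in> carrier_vec n"
  by (simp add: vec_measurable_def)

lemma vec_measurable_const: "c \<in> carrier_vec n \<Longrightarrow> vec_measurable M n (\<lambda>z. c)"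
  by (simp add: vec_measurable_def)

lemma vec_measurable_add:
  assumes "vec_measurable M n f" "vec_measurable M n g" shows "vec_measurable M n (\<lambda>z. f z + g z)"
proof -
  have "(f z + g z) $ i = f z $ i + g z $ i" if "i < n" for z i
    using vec_measurable_carrier[OF assms(2), of z] that by simp
  then show ?thesis using assms by (auto simp: vec_measurable_def intro!: borel_measurable_add)
qed

lemma vec_measurable_diff:
  assumes "vec_measurable M n f" "vec_measurable M n g" shows "vec_measurable M n (\<lambda>z. f z - g z)"
proof -
  have "(f z - g z) $ i = f z $ i - g z $ i" if "i < n" for z i
    using vec_measurable_carrier[OF assms(2), of z] that by simp
  then show ?thesis using assms by (auto simp: vec_measurable_def intro!: borel_measurable_diff)
qed

lemma vec_measurable_smult:
  assumes "c \<in> borel_measurable M" "vec_measurable M n f" shows "vec_measurable M n (\<lambda>z. c z \<cdot>\<^sub>v f z)"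
proof -
  have "(c z \<cdot>\<^sub>v f z) $ i = c z * f z $ i" if "i < n" for z i
    using vec_measurable_carrier[OF assms(2), of z] that by simp
  then show ?thesis using assms by (auto simp: vec_measurable_def intro!: borel_measurable_times)
qed

lemma vec_measurable_dot:
  assumes "vec_measurable M n f" "vec_measurable M n g" shows "(\<lambda>z. f z \<odot> g z) \<in> borel_measurable M"
proof -
  have "f z \<odot> g z = (\<Sum>i\<in>{0..<n}. f z $ i * g z $ i)" for z
    using vec_measurable_carrier[OF assms(2), of z] by (simp add: scalar_prod_def)
  then show ?thesis using assms by (auto simp: vec_measurable_def intro!: borel_measurable_sum borel_measurable_times)
qed

lemma vec_measurable_mult_mat:
  assumes "A \<in> carrier_mat m n" "vec_measurable M n f" shows "vec_measurable M m (\<lambda>z. A *\<^sub>v f z)"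
proof -
  have "(A *\<^sub>v f z) $ i = (\<Sum>j\<in>{0..<n}. A $$ (i, j) * f z $ j)" if "i < m" for z i
    using vec_measurable_carrier[OF assms(2), of z] that assms(1) by (auto simp: scalar_prod_def intro!: sum.cong)
  moreover have "A *\<^sub>v f z \<in> carrier_vec m" for z
    using vec_measurable_carrier[OF assms(2), of z] assms(1) by simp
  ultimately show ?thesis using assms(2) by (auto simp: vec_measurable_def intro!: borel_measurable_sum borel_measurable_times)
qed

lemma vec_measurable_if:
  assumes "c \<in> borel_measurable M" "vec_measurable M n f" "vec_measurable M n g"
  shows "vec_measurable M n (\<lambda>z. if c z = (0 :: real) then f z else g z)"
proof -
  have "(if c z = 0 then f z else g z) $ i = (if c z = 0 then f z $ i else g z $ i)" for z i by simp
  moreover have "Measurable.pred M (\<lambda>z. c z = 0)" using assms(1) by measurable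
  ultimately show ?thesis using assms(2,3) by (auto simp: vec_measurable_def intro!: measurable_If)
qed

lemma vec_measurable_eucl_norm: "vec_measurable M n f \<Longrightarrow> (\<lambda>z. eucl_norm (f z)) \<in> borel_measurable M"
proof -
  assume "vec_measurable M n f"
  then have [measurable]: "(\<lambda>z. f z \<odot> f z) \<in> borel_measurable M" by (intro vec_measurable_dot)
  show ?thesis unfolding eucl_norm_def by measurable
qed

text \<open>
  The test for a vanishing residual is expressed by the measurable function \<open>r \<odot> r\<close>; division by zero is harmless,
  since division is measurable as a total function.
\<close>

lemma vec_measurable_cg_state:
  assumes B: "B \<in> carrier_mat d d" and g: "vec_measurable M d g" and u0: "vec_measurable M d u0"
  shows "vec_measurable M d (\<lambda>z. fst (cg_state B (g z) (u0 z) k)) \<and>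
    vec_measurable M d (\<lambda>z. fst (snd (cg_state B (g z) (u0 z) k))) \<and>
    vec_measurable M d (\<lambda>z. snd (snd (cg_state B (g z) (u0 z) k)))"
proof (induction k)
  case 0
  show ?case using vec_measurable_diff[OF g vec_measurable_mult_mat[OF B u0]] u0 by (simp add: Let_def)
next
  case (Suc k)
  define u r p where "u z = fst (cg_state B (g z) (u0 z) k)"
    and "r z = fst (snd (cg_state B (g z) (u0 z) k))"
    and "p z = snd (snd (cg_state B (g z) (u0 z) k))" for z
  define \<alpha> where "\<alpha> z = (r z \<odot> r z) / (p z \<odot> (B *\<^sub>v p z))" for z
  define r' where "r' z = r z - \<alpha> z \<cdot>\<^sub>v (B *\<^sub>v p z)" for z
  define \<gamma> where "\<gamma> z = (r' z \<odot> r' z) / (r z \<odot> r z)" for z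
  have m: "vec_measurable M d u" "vec_measurable M d r" "vec_measurable M d p"
    using Suc by (simp_all add: u_def[abs_def] r_def[abs_def] p_def[abs_def])
  have rr: "(\<lambda>z. r z \<odot> r z) \<in> borel_measurable M" by (rule vec_measurable_dot[OF m(2,2)])
  have \<alpha>: "\<alpha> \<in> borel_measurable M"
    unfolding \<alpha>_def[abs_def] by (intro borel_measurable_divide rr vec_measurable_dot[OF m(3)] vec_measurable_mult_mat[OF B m(3)])
  have r': "vec_measurable M d r'"
    unfolding r'_def[abs_def] by (intro vec_measurable_diff vec_measurable_smult \<alpha> m vec_measurable_mult_mat[OF B])
  have \<gamma>: "\<gamma> \<in> borel_measurable M"
    unfolding \<gamma>_def[abs_def] by (intro borel_measurable_divide rr vec_measurable_dot[OF r' r'])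
  have step: "cg_state B (g z) (u0 z) (Suc k)
      = (if r z \<odot> r z = 0 then u z else u z + \<alpha> z \<cdot>\<^sub>v p z,
         if r z \<odot> r z = 0 then r z else r' z,
         if r z \<odot> r z = 0 then p z else r' z + \<gamma> z \<cdot>\<^sub>v p z)" for z
  proof -
    have s: "cg_state B (g z) (u0 z) k = (u z, r z, p z)" by (simp add: u_def r_def p_def)
    have rz: "r z \<in> carrier_vec d" by (rule vec_measurable_carrier[OF m(2)])
    show ?thesis
      using dot_self_eq_0[OF rz] rz by (simp add: s Let_def \<alpha>_def r'_def \<gamma>_def)
  qed
  show ?case
    unfolding step fst_conv snd_conv
    by (intro conjI vec_measurable_if rr m r' vec_measurable_add vec_measurable_smult \<alpha> \<gamma>)
qed

lemma vec_measurable_pcg: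
  assumes A: "A \<in> carrier_mat m d" and Z: "Z \<in> carrier_mat r d"
    and injZ: "\<And>v. v \<in> carrier_vec d \<Longrightarrow> Z *\<^sub>v v = 0\<^sub>v r \<Longrightarrow> v = 0\<^sub>v d"
    and b: "vec_measurable M m b" and u0: "vec_measurable M d u0"
  shows "vec_measurable M d (\<lambda>z. pcg A (b z) (transpose_mat Z * Z) (u0 z) k)"
proof -
  define R where "R = psd_sqrt (transpose_mat Z * Z)"
  obtain W where R: "R \<in> carrier_mat d d" and minv: "mat_inverse R = Some W" and W: "W \<in> carrier_mat d d"
    unfolding R_def using gram_sqrt[OF Z injZ] by metis
  have B: "W * (transpose_mat A * A) * W \<in> carrier_mat d d"
    by (rule mult_carrier_mat[OF mult_carrier_mat[OF W] W]) (use A in auto)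
  have At: "transpose_mat A \<in> carrier_mat d m" using A by simp
  show ?thesis
    unfolding pcg_def R_def[symmetric] Let_def minv option.sel cg_def
    by (intro vec_measurable_mult_mat[OF W] conjunct1[OF vec_measurable_cg_state[OF B]] vec_measurable_mult_mat[OF At]
        vec_measurable_mult_mat[OF R] b u0)
qed

section \<open>Prediction errors on the event that all sketches are embeddings\<close>

definition xdist :: "real mat \<Rightarrow> real Matrix.vec \<Rightarrow> real Matrix.vec \<Rightarrow> real" where
  "xdist X u v = eucl_norm (X *\<^sub>v (u - v))"

lemma xdist_nonneg: "0 \<le> xdist X u v"
  by (simp add: xdist_def eucl_norm_nonneg)

lemma xdist_commute:
  assumes "X \<in> carrier_mat N d" "u \<in> carrier_vec d" "v \<in> carrier_vec d"
  shows "xdist X u v = xdist X v u"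
  using assms eucl_norm_minus_commute[of "X *\<^sub>v u" N "X *\<^sub>v v"]
  by (simp add: xdist_def mult_minus_distrib_mat_vec[of _ N d])

lemma xdist_triangle:
  assumes X: "X \<in> carrier_mat N d" and "u \<in> carrier_vec d" "v \<in> carrier_vec d" "w \<in> carrier_vec d"
  shows "xdist X u w \<le> xdist X u v + xdist X v w"
proof -
  have "u - w = (u - v) + (v - w)" using assms by (intro eq_vecI) auto
  then have "X *\<^sub>v (u - w) = X *\<^sub>v (u - v) + X *\<^sub>v (v - w)"
    using assms by (simp add: mult_add_distrib_mat_vec[of _ N d])
  then show ?thesis
    unfolding xdist_def using assms eucl_norm_add_le[of "X *\<^sub>v (u - v)" N "X *\<^sub>v (v - w)"] by simp
qed

lemma embeds_bounds:
  assumes "embeds \<eta> S X" and X: "X \<in> carrier_mat N d" and S: "S \<in> carrier_mat m N" and v: "v \<in> carrier_vec d"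
  shows "(1 - \<eta>) * sqn (X *\<^sub>v v) \<le> sqn ((S * X) *\<^sub>v v)"
    "sqn ((S * X) *\<^sub>v v) \<le> (1 + \<eta>) * sqn (X *\<^sub>v v)"
proof -
  have "\<bar>sqn (S *\<^sub>v (X *\<^sub>v v)) - sqn (X *\<^sub>v v)\<bar> \<le> \<eta> * sqn (X *\<^sub>v v)"
    using assms(1) X v unfolding embeds_def by simp
  then show "(1 - \<eta>) * sqn (X *\<^sub>v v) \<le> sqn ((S * X) *\<^sub>v v)"
    "sqn ((S * X) *\<^sub>v v) \<le> (1 + \<eta>) * sqn (X *\<^sub>v v)"
    unfolding assoc_mult_mat_vec[OF S X v] by (simp_all add: algebra_simps abs_le_iff)
qed

lemma embeds_injective:
  assumes e: "embeds \<eta> S X" "\<eta> < 1" and X: "X \<in> carrier_mat N d" and S: "S \<in> carrier_mat m N"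
    and inj: "\<And>v. v \<in> carrier_vec d \<Longrightarrow> X *\<^sub>v v = 0\<^sub>v N \<Longrightarrow> v = 0\<^sub>v d"
    and v: "v \<in> carrier_vec d" "(S * X) *\<^sub>v v = 0\<^sub>v m"
  shows "v = 0\<^sub>v d"
proof -
  have "(1 - \<eta>) * sqn (X *\<^sub>v v) \<le> 0"
    using embeds_bounds(1)[OF e(1) X S v(1)] v(2) by simp
  then have "sqn (X *\<^sub>v v) = 0"
    using e(2) dot_self_nonneg[of "X *\<^sub>v v"] by (simp add: mult_le_0_iff)
  then have "X *\<^sub>v v = 0\<^sub>v N" using dot_self_eq_0[of "X *\<^sub>v v" N] X v(1) by simp
  then show ?thesis by (rule inj[OF v(1)])
qed

locale embedded_design =
  fixes N d r :: nat and X S' :: "real mat"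
  assumes X: "X \<in> carrier_mat N d"
    and X_inj: "\<And>v. v \<in> carrier_vec d \<Longrightarrow> X *\<^sub>v v = 0\<^sub>v N \<Longrightarrow> v = 0\<^sub>v d"
    and S': "S' \<in> carrier_mat r N" and S'_embeds: "embeds (1 / 100) S' X"
begin

definition H :: "real mat" where
  "H = transpose_mat (S' * X) * (S' * X)"

lemma precond_carrier: "S' * X \<in> carrier_mat r d"
  using S' X by simp

lemma precond_inj: "v \<in> carrier_vec d \<Longrightarrow> (S' * X) *\<^sub>v v = 0\<^sub>v r \<Longrightarrow> v = 0\<^sub>v d"
  by (rule embeds_injective[OF S'_embeds _ X S' X_inj]) simp_all

lemma invertible_H: "invertible_mat H"
proof -
  have H: "H \<in> carrier_mat d d" using precond_carrier by (simp add: H_def)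
  have "v = 0\<^sub>v d" if "v \<in> carrier_vec d" "H *\<^sub>v v = 0\<^sub>v d" for v
    using gram_pos[OF precond_carrier precond_inj that(1)] that by (cases "v = 0\<^sub>v d") (auto simp: H_def)
  then obtain W where "W \<in> carrier_mat d d" "H * W = 1\<^sub>m d" "W * H = 1\<^sub>m d"
    using injective_imp_inverse[OF H] by metis
  then show ?thesis
    using H unfolding invertible_mat_def inverts_mat_def square_mat.simps by (metis carrier_matD)
qed

context
  fixes m :: nat and S :: "real mat"
  assumes S: "S \<in> carrier_mat m N" and S_embeds: "embeds (1 / 100) S X"
begin

lemma sketched_carrier: "S * X \<in> carrier_mat m d"
  using S X by simp

lemma sketched_inj: "v \<in> carrier_vec d \<Longrightarrow> (S * X) *\<^sub>v v = 0\<^sub>v m \<Longrightarrow> v = 0\<^sub>v d"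
  by (rule embeds_injective[OF S_embeds _ X S X_inj]) simp_all

lemma full_rank_sketch: "vec_space.rank m (S * X) = d"
  using full_rank_iff_injective[OF sketched_carrier] sketched_inj by blast

text \<open>
  Errors are measured with respect to the solution \<open>x\<close> of the sketched problem. On the passage from
  the sketched to the true norms the factors \<open>100 / 99\<close> and \<open>101 / 100\<close> are lost once; since
  \<open>101 / 99 * (400 / 10201) \<le> 1 / 16\<close> and \<open>k \<ge> 1\<close>, the decay of the energy absorbs them.
\<close>

lemma pcg_contraction:
  assumes b: "b \<in> carrier_vec m" and u: "u \<in> carrier_vec d" and k: "1 \<le> k"
  shows "pcg (S * X) b H u k \<in> carrier_vec d"
    "least_squares (S * X) b \<in> carrier_vec d"
    "xdist X (least_squares (S * X) b) (pcg (S * X) b H u k)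
      \<le> (1 / 4) ^ k * xdist X (least_squares (S * X) b) u"
proof -
  obtain L where L: "L \<in> carrier_mat d m" "least_squares (S * X) b = L *\<^sub>v b"
    "(transpose_mat (S * X) * (S * X)) *\<^sub>v (L *\<^sub>v b) = transpose_mat (S * X) *\<^sub>v b"
    using least_squares_properties[OF sketched_carrier sketched_inj] b by metis
  define x where "x = L *\<^sub>v b"
  have x: "x \<in> carrier_vec d" using L b by (simp add: x_def)
  then show "least_squares (S * X) b \<in> carrier_vec d" by (simp add: L x_def)
  define y where "y = pcg (S * X) b H u k"
  define q where "q v = sqn (X *\<^sub>v v)" for v
  define qA where "qA v = sqn ((S * X) *\<^sub>v v)" for v
  define qZ where "qZ v = sqn ((S' * X) *\<^sub>v v)" for v
  have bA: "99 / 100 * q v \<le> qA v" "qA v \<le> 101 / 100 * q v" if "v \<in> carrier_vec d" for v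
    using embeds_bounds[OF S_embeds X S that] by (simp_all add: q_def qA_def)
  have bZ: "99 / 100 * q v \<le> qZ v" "qZ v \<le> 101 / 100 * q v" if "v \<in> carrier_vec d" for v
    using embeds_bounds[OF S'_embeds X S' that] by (simp_all add: q_def qZ_def)
  have normal: "(transpose_mat (S * X) * (S * X)) *\<^sub>v x = transpose_mat (S * X) *\<^sub>v b"
    using L(3) by (simp add: x_def)
  have lo: "99 / 101 * sqn ((S' * X) *\<^sub>v v) \<le> sqn ((S * X) *\<^sub>v v)"
    and hi: "sqn ((S * X) *\<^sub>v v) \<le> 101 / 99 * sqn ((S' * X) *\<^sub>v v)"
    if v: "v \<in> carrier_vec d" for v
  proof -
    have "99 / 101 * qZ v \<le> qA v" "qA v \<le> 101 / 99 * qZ v"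
      using bA[OF v] bZ[OF v] by linarith+
    then show "99 / 101 * sqn ((S' * X) *\<^sub>v v) \<le> sqn ((S * X) *\<^sub>v v)"
      "sqn ((S * X) *\<^sub>v v) \<le> 101 / 99 * sqn ((S' * X) *\<^sub>v v)"
      by (simp_all add: qA_def qZ_def)
  qed
  have num: "(0 :: real) < 99 / 101" "(99 / 101 :: real) \<le> 101 / 99" by simp_all
  have y: "y \<in> carrier_vec d" and e': "qA (x - y) \<le> (1 - (99 / 101) / (101 / 99)) ^ k * qA (x - u)"
    unfolding y_def H_def qA_def
    using pcg_error_bound[OF sketched_carrier b precond_carrier precond_inj num lo hi x normal u, of k] by blast+
  have "1 - (99 / 101) / (101 / 99) = (400 / 10201 :: real)" by simp
  with e' have e: "qA (x - y) \<le> (400 / 10201) ^ k * qA (x - u)" by simp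
  from y show "pcg (S * X) b H u k \<in> carrier_vec d" by (simp add: y_def)
  have xy: "x - y \<in> carrier_vec d" "x - u \<in> carrier_vec d" using x y u by auto
  have q0: "0 \<le> q v" for v by (simp add: q_def dot_self_nonneg)
  have "q (x - y) \<le> 100 / 99 * qA (x - y)" using bA(1)[OF xy(1)] by simp
  also have "\<dots> \<le> 100 / 99 * ((400 / 10201) ^ k * qA (x - u))" using e by simp
  also have "\<dots> \<le> 100 / 99 * ((400 / 10201) ^ k * (101 / 100 * q (x - u)))"
    by (intro mult_left_mono bA(2)[OF xy(2)]) auto
  also have "\<dots> = 101 / 99 * (400 / 10201) ^ k * q (x - u)" by simp
  also have "\<dots> \<le> ((1 / 4) ^ k)\<^sup>2 * q (x - u)"
  proof (intro mult_right_mono q0)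
    have "(101 / 99 :: real) \<le> (101 / 99) ^ k" using k by (intro self_le_power) auto
    then have "101 / 99 * (400 / 10201 :: real) ^ k \<le> (101 / 99) ^ k * (400 / 10201) ^ k"
      by (intro mult_right_mono) auto
    also have "\<dots> = (101 / 99 * (400 / 10201)) ^ k" by (simp only: power_mult_distrib)
    also have "\<dots> \<le> (1 / 16) ^ k" by (intro power_mono) auto
    also have "\<dots> = ((1 / 4) ^ k)\<^sup>2" by (simp add: power2_eq_square flip: power_mult_distrib)
    finally show "101 / 99 * (400 / 10201 :: real) ^ k \<le> ((1 / 4) ^ k)\<^sup>2" .
  qed
  finally have "(xdist X x y)\<^sup>2 \<le> ((1 / 4) ^ k * xdist X x u)\<^sup>2"
    by (simp add: xdist_def eucl_norm_sq q_def power_mult_distrib)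
  then show "xdist X (least_squares (S * X) b) (pcg (S * X) b H u k)
      \<le> (1 / 4) ^ k * xdist X (least_squares (S * X) b) u"
    unfolding L(2) x_def[symmetric] y_def[symmetric]
    by (rule power2_le_imp_le) (simp add: xdist_nonneg)
qed

lemma pcg_prediction_error_le:
  assumes b: "b \<in> carrier_vec m" and u: "u \<in> carrier_vec d" and \<beta>: "\<beta> \<in> carrier_vec d" and k: "1 \<le> k"
  shows "xdist X (pcg (S * X) b H u k) \<beta>
    \<le> (1 / 4) ^ k * xdist X u \<beta> + (1 + (1 / 4) ^ k) * xdist X (least_squares (S * X) b) \<beta>"
proof -
  define y x where "y = pcg (S * X) b H u k" and "x = least_squares (S * X) b"
  note c = pcg_contraction[OF b u k, folded x_def y_def]
  have "xdist X y \<beta> \<le> xdist X x y + xdist X x \<beta>"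
    using xdist_triangle[OF X c(1,2) \<beta>] xdist_commute[OF X c(1,2)] by simp
  also have "xdist X x y \<le> (1 / 4) ^ k * xdist X x u" by (rule c(3))
  also have "xdist X x u \<le> xdist X x \<beta> + xdist X u \<beta>"
    using xdist_triangle[OF X c(2) \<beta> u] xdist_commute[OF X \<beta> u] by simp
  finally show ?thesis by (simp add: x_def y_def algebra_simps)
qed

end

end

lemma isotropic_noiseD:
  assumes "isotropic_noise N \<sigma> \<nu>"
  shows "vec_measurable \<nu> N (\<lambda>z. Matrix.vec N z)" "\<And>i. i < N \<Longrightarrow> integrable \<nu> (\<lambda>z. z i)"
proof -
  interpret prob_space \<nu> using assms by (simp add: isotropic_noise_def)
  have sets: "sets \<nu> = sets (Pi\<^sub>M {..<N} (\<lambda>_. borel))" using assms by (simp add: isotropic_noise_def)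
  have meas: "(\<lambda>z. z i) \<in> borel_measurable \<nu>" if "i < N" for i
    unfolding measurable_cong_sets[OF sets refl] using that by (intro measurable_component_singleton) simp
  then show "vec_measurable \<nu> N (\<lambda>z. Matrix.vec N z)" by (simp add: vec_measurable_def)
  fix i assume i: "i < N"
  show "integrable \<nu> (\<lambda>z. z i)"
  proof (rule Bochner_Integration.integrable_bound[OF _ meas[OF i]])
    show "integrable \<nu> (\<lambda>z. 1 + (z i)\<^sup>2)" using assms i by (simp add: isotropic_noise_def)
    show "AE z in \<nu>. norm (z i) \<le> norm (1 + (z i)\<^sup>2)"
    proof (rule AE_I2)
      fix z :: "nat \<Rightarrow> real"
      have "0 \<le> (\<bar>z i\<bar> - 1)\<^sup>2" by simp
      then have "2 * \<bar>z i\<bar> \<le> 1 + (z i)\<^sup>2" by (simp add: power2_diff)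
      then show "norm (z i) \<le> norm (1 + (z i)\<^sup>2)" by simp
    qed
  qed
qed

lemma eucl_norm_le_sum_abs: "eucl_norm v \<le> (\<Sum>i\<in>{0..<dim_vec v}. \<bar>v $ i\<bar>)"
  using L2_set_le_sum_abs[of "\<lambda>i. v $ i" "{0..<dim_vec v}"] by (simp add: eucl_norm_L2[of _ "dim_vec v"])

lemma integrable_eucl_norm_linear:
  assumes noise: "isotropic_noise N \<sigma> \<nu>" and A: "A \<in> carrier_mat m N"
  shows "integrable \<nu> (\<lambda>z. eucl_norm (A *\<^sub>v Matrix.vec N z))"
proof (rule Bochner_Integration.integrable_bound)
  note noiseD = isotropic_noiseD[OF noise]
  have "(A *\<^sub>v Matrix.vec N z) $ i = (\<Sum>j\<in>{0..<N}. A $$ (i, j) * z j)" if "i < m" for i z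
    using that A by (auto simp: scalar_prod_def intro!: sum.cong)
  moreover have "integrable \<nu> (\<lambda>z. \<Sum>i\<in>{0..<m}. \<bar>\<Sum>j\<in>{0..<N}. A $$ (i, j) * z j\<bar>)"
    by (intro Bochner_Integration.integrable_sum Bochner_Integration.integrable_abs
        integrable_mult_right noiseD(2)) simp
  ultimately show "integrable \<nu> (\<lambda>z. \<Sum>i\<in>{0..<m}. \<bar>(A *\<^sub>v Matrix.vec N z) $ i\<bar>)"
    by (simp del: index_mult_mat_vec)
  show "(\<lambda>z. eucl_norm (A *\<^sub>v Matrix.vec N z)) \<in> borel_measurable \<nu>"
    by (rule vec_measurable_eucl_norm[OF vec_measurable_mult_mat[OF A noiseD(1)]])
  show "AE z in \<nu>. norm (eucl_norm (A *\<^sub>v Matrix.vec N z)) \<le> norm (\<Sum>i\<in>{0..<m}. \<bar>(A *\<^sub>v Matrix.vec N z) $ i\<bar>)"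
  proof (rule AE_I2)
    fix z
    have "dim_vec (A *\<^sub>v Matrix.vec N z) = m" using A by simp
    then have "eucl_norm (A *\<^sub>v Matrix.vec N z) \<le> (\<Sum>i\<in>{0..<m}. \<bar>(A *\<^sub>v Matrix.vec N z) $ i\<bar>)"
      using eucl_norm_le_sum_abs[of "A *\<^sub>v Matrix.vec N z"] by simp
    then show "norm (eucl_norm (A *\<^sub>v Matrix.vec N z)) \<le> norm (\<Sum>i\<in>{0..<m}. \<bar>(A *\<^sub>v Matrix.vec N z) $ i\<bar>)"
      using eucl_norm_nonneg[of "A *\<^sub>v Matrix.vec N z"] by (simp del: index_mult_mat_vec)
  qed
qed

context embedded_design
begin

lemma vec_add_diff_cancel:
  "u \<in> carrier_vec m \<Longrightarrow> e \<in> carrier_vec m \<Longrightarrow> u + e - u = (e :: real Matrix.vec)"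
  by (intro eq_vecI) auto

lemma vec_diff_via_sum:
  "u \<in> carrier_vec m \<Longrightarrow> v \<in> carrier_vec m \<Longrightarrow> e \<in> carrier_vec m \<Longrightarrow>
    u - v = u - (v + e) + (e :: real Matrix.vec)"
  by (intro eq_vecI) auto

text \<open>
  The residual of the minimizer is at most the residual \<open>S \<zeta>\<close> of the true parameter, so the sketched
  error is at most \<open>2\<close> times the norm of \<open>S \<zeta>\<close>, and the true error at most \<open>4\<close> times that norm.
\<close>

lemma least_squares_integrable:
  assumes noise: "isotropic_noise N \<sigma> \<nu>" and \<beta>: "\<beta> \<in> carrier_vec d"
    and S: "S \<in> carrier_mat m N" and S_embeds: "embeds (1 / 100) S X"
  shows "integrable \<nu> (\<lambda>z. xdist X (least_squares (S * X) (S *\<^sub>v (X *\<^sub>v \<beta> + Matrix.vec N z))) \<beta>)"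
proof -
  note noiseD = isotropic_noiseD[OF noise]
  note A = sketched_carrier[OF S S_embeds] and inj = sketched_inj[OF S S_embeds]
  define b where "b z = S *\<^sub>v (X *\<^sub>v \<beta> + Matrix.vec N z)" for z
  have X\<beta>: "X *\<^sub>v \<beta> \<in> carrier_vec N" using X \<beta> by simp
  have b: "vec_measurable \<nu> m b"
    unfolding b_def[abs_def] by (intro vec_measurable_mult_mat[OF S] vec_measurable_add vec_measurable_const X\<beta> noiseD(1))
  note bc = vec_measurable_carrier[OF b]
  obtain L where L: "L \<in> carrier_mat d m"
    "\<And>b. b \<in> carrier_vec m \<Longrightarrow> least_squares (S * X) b = L *\<^sub>v b"
    "\<And>b u. b \<in> carrier_vec m \<Longrightarrow> u \<in> carrier_vec d \<Longrightarrow>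
      eucl_norm ((S * X) *\<^sub>v (L *\<^sub>v b) - b) \<le> eucl_norm ((S * X) *\<^sub>v u - b)"
    using least_squares_properties[OF A inj] by metis
  have meas: "(\<lambda>z. xdist X (L *\<^sub>v b z) \<beta>) \<in> borel_measurable \<nu>"
    unfolding xdist_def
    by (rule vec_measurable_eucl_norm[OF vec_measurable_mult_mat[OF X
          vec_measurable_diff[OF vec_measurable_mult_mat[OF L(1) b] vec_measurable_const[OF \<beta>]]]])
  have le: "xdist X (L *\<^sub>v b z) \<beta> \<le> 4 * eucl_norm (S *\<^sub>v Matrix.vec N z)" for z
  proof -
    define x where "x = L *\<^sub>v b z"
    define e where "e = S *\<^sub>v Matrix.vec N z"
    have x: "x \<in> carrier_vec d" using L(1) bc by (simp add: x_def)
    have e: "e \<in> carrier_vec m" using S by (simp add: e_def)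
    have Ac: "(S * X) *\<^sub>v x \<in> carrier_vec m" "(S * X) *\<^sub>v \<beta> \<in> carrier_vec m" using A x \<beta> by auto
    have bz: "b z = (S * X) *\<^sub>v \<beta> + e"
      unfolding b_def e_def assoc_mult_mat_vec[OF S X \<beta>]
      by (rule mult_add_distrib_mat_vec[OF S X\<beta>]) simp
    have n1: "eucl_norm ((S * X) *\<^sub>v x - b z) \<le> eucl_norm e"
    proof -
      have "eucl_norm ((S * X) *\<^sub>v \<beta> - b z) = eucl_norm (b z - (S * X) *\<^sub>v \<beta>)"
        by (rule eucl_norm_minus_commute[OF Ac(2) bc])
      also have "b z - (S * X) *\<^sub>v \<beta> = e" unfolding bz by (rule vec_add_diff_cancel[OF Ac(2) e])
      finally show ?thesis using L(3)[OF bc[of z] \<beta>] by (simp add: x_def)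
    qed
    have "(S * X) *\<^sub>v (x - \<beta>) = ((S * X) *\<^sub>v x - b z) + e"
      unfolding bz mult_minus_distrib_mat_vec[OF A x \<beta>] by (rule vec_diff_via_sum[OF Ac e])
    then have n2: "eucl_norm ((S * X) *\<^sub>v (x - \<beta>)) \<le> 2 * eucl_norm e"
      using eucl_norm_add_le[of "(S * X) *\<^sub>v x - b z" m e] n1 Ac bc[of z] e by simp
    have "(xdist X x \<beta>)\<^sup>2 \<le> 4 * (eucl_norm ((S * X) *\<^sub>v (x - \<beta>)))\<^sup>2"
      using embeds_bounds(1)[OF S_embeds X S, of "x - \<beta>"] x \<beta> dot_self_nonneg[of "X *\<^sub>v (x - \<beta>)"]
      by (simp add: xdist_def eucl_norm_sq)
    also have "\<dots> \<le> 4 * (2 * eucl_norm e)\<^sup>2"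
      by (intro mult_left_mono power_mono n2 eucl_norm_nonneg) simp
    also have "\<dots> = (4 * eucl_norm e)\<^sup>2" by (simp add: power_mult_distrib)
    finally have "xdist X x \<beta> \<le> 4 * eucl_norm e"
      by (rule power2_le_imp_le) (simp add: eucl_norm_nonneg)
    then show ?thesis by (simp add: x_def e_def)
  qed
  have "integrable \<nu> (\<lambda>z. xdist X (L *\<^sub>v b z) \<beta>)"
  proof (rule Bochner_Integration.integrable_bound[OF _ meas])
    show "integrable \<nu> (\<lambda>z. 4 * eucl_norm (S *\<^sub>v Matrix.vec N z))"
      by (intro integrable_mult_right integrable_eucl_norm_linear[OF noise S])
    show "AE z in \<nu>. norm (xdist X (L *\<^sub>v b z) \<beta>) \<le> norm (4 * eucl_norm (S *\<^sub>v Matrix.vec N z))"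
      using le by (intro AE_I2) (simp add: xdist_nonneg eucl_norm_nonneg)
  qed
  then show ?thesis using L(2)[OF bc] by (simp add: b_def)
qed

text \<open>
  The pointwise inequality bounds the error of each iterate by the errors of its starting point and of
  the least squares solution, so integrability propagates from one subproblem to the next along the
  warm starts; measurability does so because an iterate depends measurably on its starting point and
  on the data. Without integrability, the integrals would not be monotone.
\<close>

lemma spcg_prediction_errors:
  fixes K :: nat and m a :: "nat \<Rightarrow> nat" and S :: "nat \<Rightarrow> real mat"
  assumes noise: "isotropic_noise N \<sigma> \<nu>" and \<beta>: "\<beta> \<in> carrier_vec d" and \<beta>0: "\<beta>0 \<in> carrier_vec d"
    and S: "\<And>i. i \<in> {1..K} \<Longrightarrow> S i \<in> carrier_mat (m i) N"
    and S_embeds: "\<And>i. i \<in> {1..K} \<Longrightarrow> embeds (1 / 100) (S i) X"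
    and a: "\<And>i. i \<in> {1..K} \<Longrightarrow> 1 \<le> a i" and i: "i \<in> {1..K}"
  shows "prediction_error \<nu> X \<beta> (\<lambda>Y. spcg_iterate S H X Y \<beta>0 a i (a i))
    \<le> (1 / 4) ^ a i * prediction_error \<nu> X \<beta> (\<lambda>Y. spcg_start S H X Y \<beta>0 a i)
      + (1 + (1 / 4) ^ a i) * prediction_error \<nu> X \<beta> (\<lambda>Y. least_squares (S i * X) (S i *\<^sub>v Y))"
proof -
  interpret noise: prob_space \<nu> using noise by (simp add: isotropic_noise_def)
  note noiseD = isotropic_noiseD[OF noise]
  have pe: "prediction_error \<nu> X \<beta> b = (\<integral>z. xdist X (b (X *\<^sub>v \<beta> + Matrix.vec N z)) \<beta> \<partial>\<nu>)" for b
    using X by (simp add: prediction_error_def xdist_def)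
  define Y where "Y z = X *\<^sub>v \<beta> + Matrix.vec N z" for z
  have X\<beta>: "X *\<^sub>v \<beta> \<in> carrier_vec N" using X \<beta> by simp
  have Y: "vec_measurable \<nu> N Y"
    unfolding Y_def[abs_def] by (intro vec_measurable_add vec_measurable_const X\<beta> noiseD(1))
  define F where "F i z = spcg_start S H X (Y z) \<beta>0 a i" for i z
  define G where "G i z = pcg (S i * X) (S i *\<^sub>v Y z) H (F i z) (a i)" for i z
  define l where "l i z = xdist X (least_squares (S i * X) (S i *\<^sub>v Y z)) \<beta>" for i z
  have l: "integrable \<nu> (l i)" if "i \<in> {1..K}" for i
    unfolding l_def[abs_def] Y_def by (rule least_squares_integrable[OF noise \<beta> S[OF that] S_embeds[OF that]])
  have step: "xdist X (G i z) \<beta> \<le> (1 / 4) ^ a i * xdist X (F i z) \<beta> + (1 + (1 / 4) ^ a i) * l i z"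
    if i: "i \<in> {1..K}" and F: "vec_measurable \<nu> d (F i)" for i z
    unfolding G_def l_def
    by (rule pcg_prediction_error_le[OF S[OF i] S_embeds[OF i] _ vec_measurable_carrier[OF F] \<beta> a[OF i]])
       (use S[OF i] vec_measurable_carrier[OF Y] in auto)
  have G: "vec_measurable \<nu> d (G i)" if i: "i \<in> {1..K}" and F: "vec_measurable \<nu> d (F i)" for i
    unfolding G_def[abs_def] H_def
    by (rule vec_measurable_pcg[OF sketched_carrier[OF S[OF i] S_embeds[OF i]] precond_carrier precond_inj
        vec_measurable_mult_mat[OF S[OF i] Y] F])
  have G_int: "integrable \<nu> (\<lambda>z. xdist X (G i z) \<beta>)"
    if i: "i \<in> {1..K}" and F: "vec_measurable \<nu> d (F i)" "integrable \<nu> (\<lambda>z. xdist X (F i z) \<beta>)" for i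
  proof (rule Bochner_Integration.integrable_bound)
    show "integrable \<nu> (\<lambda>z. (1 / 4) ^ a i * xdist X (F i z) \<beta> + (1 + (1 / 4) ^ a i) * l i z)"
      by (intro Bochner_Integration.integrable_add integrable_mult_right F l i)
    show "(\<lambda>z. xdist X (G i z) \<beta>) \<in> borel_measurable \<nu>"
      unfolding xdist_def
      by (rule vec_measurable_eucl_norm[OF vec_measurable_mult_mat[OF X vec_measurable_diff[OF G[OF i F(1)] vec_measurable_const[OF \<beta>]]]])
    show "AE z in \<nu>. norm (xdist X (G i z) \<beta>)
        \<le> norm ((1 / 4) ^ a i * xdist X (F i z) \<beta> + (1 + (1 / 4) ^ a i) * l i z)"
    proof (rule AE_I2)
      fix z
      show "norm (xdist X (G i z) \<beta>) \<le> norm ((1 / 4) ^ a i * xdist X (F i z) \<beta> + (1 + (1 / 4) ^ a i) * l i z)"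
        using step[OF i F(1), of z] xdist_nonneg[of X "G i z" \<beta>] by simp
    qed
  qed
  have F: "vec_measurable \<nu> d (F i) \<and> integrable \<nu> (\<lambda>z. xdist X (F i z) \<beta>)" if "i \<in> {1..K}" for i
    using that
  proof (induction i)
    case (Suc i)
    show ?case
    proof (cases i)
      case 0
      then show ?thesis using \<beta>0 by (simp add: F_def[abs_def] vec_measurable_const)
    next
      case (Suc i')
      then have i: "i \<in> {1..K}" using Suc.prems by simp
      have "F (Suc i) = G i" unfolding F_def[abs_def] G_def[abs_def] by (simp add: Suc)
      then show ?thesis using G[OF i] G_int[OF i] Suc.IH[OF i] by simp
    qed
  qed simp
  have "(\<integral>z. xdist X (G i z) \<beta> \<partial>\<nu>)
      \<le> (\<integral>z. (1 / 4) ^ a i * xdist X (F i z) \<beta> + (1 + (1 / 4) ^ a i) * l i z \<partial>\<nu>)"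
    using F[OF i] i l by (intro integral_mono G_int step) auto
  also have "\<dots> = (1 / 4) ^ a i * (\<integral>z. xdist X (F i z) \<beta> \<partial>\<nu>) + (1 + (1 / 4) ^ a i) * (\<integral>z. l i z \<partial>\<nu>)"
    using F[OF i] l[OF i] by simp
  finally show ?thesis
    unfolding pe spcg_iterate_def by (simp add: G_def F_def l_def Y_def)
qed

end

section \<open>The union bound over the sketches\<close>

lemma exp_neg_ceiling_ln_le:
  assumes "0 < x" "0 < p"
  shows "x * exp (- real (nat \<lceil>ln (x / p)\<rceil>)) \<le> p"
proof -
  have "ln (x / p) \<le> real (nat \<lceil>ln (x / p)\<rceil>)" by (rule real_nat_ceiling_ge)
  then have "exp (- real (nat \<lceil>ln (x / p)\<rceil>)) \<le> exp (- ln (x / p))" by simp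
  also have "\<dots> = p / x" using assms by (simp add: exp_minus)
  finally show ?thesis using assms by (simp add: field_simps)
qed

text \<open>
  Choose the exponents \<open>Q\<close> for the row norms and \<open>P\<close> for the sampling such that each stage fails
  with probability at most \<open>\<delta> / (2 K)\<close>. The logarithms of \<open>2 K N / \<delta>\<close> and \<open>2 K d / \<delta>\<close> exceed
  those of \<open>N / \<delta>\<close> and \<open>d / \<delta>\<close> by at most \<open>K\<close>, which costs a factor proportional to \<open>K\<close> for each of
  them. The numerical constant is \<open>4 * 2 * 3 * 12 * 5 * 3 * 100\<^sup>2\<close>, where \<open>3\<close> bounds \<open>e\<close> and \<open>1 / 100\<close> is the accuracy.
\<close>

lemma srht_embedding_prob:
  fixes K n d m :: nat and \<delta> :: real and X :: "real mat" defines "N \<equiv> (2 :: nat) ^ n"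
  assumes K: "1 \<le> K" and d: "1 \<le> d" and X: "X \<in> carrier_mat N d"
    and inj: "\<And>v. v \<in> carrier_vec d \<Longrightarrow> X *\<^sub>v v = 0\<^sub>v N \<Longrightarrow> v = 0\<^sub>v d"
    and m: "m \<le> N" and \<delta>: "0 < \<delta>" "\<delta> < 1"
    and size: "43200000 * (real K)\<^sup>2 * (real d + ln (real N / \<delta>)) * ln (exp 1 * real d / \<delta>) \<le> real m"
  shows "measure_pmf.prob (pair_pmf (sign_perm_law N) (index_law N m))
      {(g, I). \<not> embeds (1 / 100) (srht n m g I) X} \<le> \<delta> / real K"
proof -
  define a b where "a = real d + ln (real N / \<delta>)" and "b = ln (exp 1 * real d / \<delta>)"
  define \<delta>' where "\<delta>' = \<delta> / real K"
  define P Q where "P = nat \<lceil>ln (real d / (\<delta>' / 2))\<rceil>" and "Q = nat \<lceil>ln (real N / (\<delta>' / 2))\<rceil>"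
  have N: "1 \<le> real N" by (simp add: N_def)
  have K': "1 \<le> real K" and d': "1 \<le> real d" using K d by auto
  have \<delta>': "0 < \<delta>'" using \<delta> K' by (simp add: \<delta>'_def)
  have lnN: "0 \<le> ln (real N / \<delta>)" using N \<delta> by (intro ln_ge_zero) (simp add: le_divide_eq)
  have b_eq: "b = 1 + ln (real d / \<delta>)"
    using d' \<delta> by (simp add: b_def ln_mult ln_div)
  have lnd: "0 \<le> ln (real d / \<delta>)" using d' \<delta> by (intro ln_ge_zero) (simp add: le_divide_eq)
  have a1: "1 \<le> a" and b1: "1 \<le> b" using lnN lnd d' by (simp_all add: a_def b_eq)
  have lnK: "ln (2 * real K) \<le> real K"
  proof -
    have "ln 2 \<le> (1 :: real)" using ln_le_minus_one[of "2 :: real"] by simp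
    moreover have "ln (real K) \<le> real K - 1" using K' by (intro ln_le_minus_one) simp
    ultimately show ?thesis using K' by (simp add: ln_mult)
  qed
  have split: "ln (x / (\<delta>' / 2)) = ln (2 * real K) + ln (x / \<delta>)" if "0 < x" for x
  proof -
    have "x / (\<delta>' / 2) = (2 * real K) * (x / \<delta>)" using K' \<delta> by (simp add: \<delta>'_def field_simps)
    then show ?thesis using that K' \<delta> by (simp only:) (rule ln_mult_pos, simp_all)
  qed
  have ceil: "real (nat \<lceil>x\<rceil>) \<le> x + 1" if "0 \<le> x" for x :: real
    using that by linarith
  have lnd': "0 < ln (real d / (\<delta>' / 2))"
  proof -
    have "0 < ln (2 * real K)" using K' by (intro ln_gt_zero) simp
    then show ?thesis using split[of "real d"] lnd d' by simp
  qed
  then have P0: "0 < P" by (simp add: P_def)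
  have P: "real P \<le> 2 * real K * b"
  proof -
    have "real P \<le> ln (real d / (\<delta>' / 2)) + 1" unfolding P_def using lnd' by (intro ceil) simp
    also have "\<dots> \<le> real K + b" using split[of "real d"] lnK d' by (simp add: b_eq)
    also have "\<dots> \<le> real K * b + real K * b"
      using mult_left_mono[OF b1 of_nat_0_le_iff[of K]]
        mult_right_mono[OF K' order_trans[OF zero_le_one b1]] by linarith
    finally show ?thesis by (simp add: mult_ac)
  qed
  have Q: "real d + 4 * real Q \<le> 12 * real K * a"
  proof -
    have "0 \<le> ln (2 * real K)" using K' by (intro ln_ge_zero) simp
    then have "real Q \<le> ln (real N / (\<delta>' / 2)) + 1"
      unfolding Q_def using split[of "real N"] lnN N by (intro ceil) simp
    also have "\<dots> \<le> real K + ln (real N / \<delta>) + 1" using split[of "real N"] lnK N by simp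
    finally have "real d + 4 * real Q \<le> 4 * a + 4 * real K + 4"
      using d' by (simp add: a_def)
    also have "\<dots> \<le> 4 * (real K * a) + 4 * (real K * a) + 4 * (real K * a)"
    proof -
      have "a \<le> real K * a" "real K \<le> real K * a" 
        using mult_left_mono[OF a1 of_nat_0_le_iff[of K]]
          mult_right_mono[OF K' order_trans[OF zero_le_one a1]] by linarith+
      then show ?thesis using K' by linarith
    qed
    finally show ?thesis by (simp add: mult_ac)
  qed
  have e3: "exp 1 \<le> (3 :: real)" by (rule exp_le)
  have PQ: "4 * real P * (exp 1 * (real d + 4 * real Q)) \<le> (1 / 100)\<^sup>2 / (5 * exp 1) * real m"
  proof -
    have "4 * real P * (exp 1 * (real d + 4 * real Q)) \<le> 4 * (2 * real K * b) * (3 * (12 * real K * a))"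
      using P Q e3 a1 b1 K' by (intro mult_mono mult_nonneg_nonneg) auto
    also have "\<dots> = 288 * (real K)\<^sup>2 * a * b" by (simp add: power2_eq_square)
    also have "\<dots> = (1 / 100)\<^sup>2 / (5 * 3) * (43200000 * (real K)\<^sup>2 * a * b)" by (simp add: power2_eq_square)
    also have "\<dots> \<le> (1 / 100)\<^sup>2 / (5 * 3) * real m"
      using size by (intro mult_left_mono) (simp_all add: a_def b_def)
    also have "\<dots> \<le> (1 / 100)\<^sup>2 / (5 * exp 1) * real m"
      using e3 by (intro mult_right_mono divide_left_mono) auto
    finally show ?thesis .
  qed
  have m0: "0 < m"
  proof -
    have "0 < 43200000 * (real K)\<^sup>2 * a * b" using K' a1 b1 by simp
    then have "0 < real m" using size unfolding a_def b_def by linarith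
    then show ?thesis by simp
  qed
  have "measure_pmf.prob (pair_pmf (sign_perm_law N) (index_law N m))
      {(g, I). \<not> embeds (1 / 100) (srht n m g I) X} \<le> real N * exp (- real Q) + real d * exp (- real P)"
    unfolding N_def
    by (rule prob_srht_not_embeds_le[OF _ X[unfolded N_def] inj[unfolded N_def] m0 m[unfolded N_def] _ _ P0 PQ])
       (use d in auto)
  also have "\<dots> \<le> \<delta>' / 2 + \<delta>' / 2"
    unfolding P_def Q_def using N d' \<delta>' by (intro add_mono exp_neg_ceiling_ln_le) auto
  finally show ?thesis by (simp add: \<delta>'_def)
qed

lemma pair_pmf_marginal:
  "map_pmf (\<lambda>(g, t, s). (g, h t)) (pair_pmf A (pair_pmf T B)) = pair_pmf A (map_pmf h T)"
proof -
  have "map_pmf h T = map_pmf (h \<circ> fst) (pair_pmf T B)"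
    by (simp add: map_pmf_comp[symmetric] pmf.map_comp[symmetric] map_fst_pair_pmf)
  then show ?thesis
    by (simp add: pair_map_pmf2 case_prod_unfold o_def apsnd_def map_prod_def)
qed

lemma nested_sizes:
  fixes m :: "nat \<Rightarrow> nat"
  assumes dbl: "\<forall>i\<in>{1..<K}. m (Suc i) = 2 * m i" and i: "i \<in> {1..K}"
  shows "m 1 \<le> m i" "m i \<le> m K"
proof -
  have "1 \<le> i \<Longrightarrow> i \<le> K \<Longrightarrow> m 1 \<le> m i" for i
  proof (induction i rule: dec_induct)
    case (step n)
    then show ?case using dbl by force
  qed simp
  then show "m 1 \<le> m i" using i by simp
  have "i \<le> k \<Longrightarrow> k \<le> K \<Longrightarrow> m i \<le> m k" for k
  proof (induction k rule: dec_induct)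
    case (step n)
    then show ?case using dbl i by force
  qed simp
  then show "m i \<le> m K" using i by simp
qed

theorem theorem3p1:
  fixes K :: nat
  assumes "K \<ge> 1"
  shows "\<exists>c::real. c > 0 \<and>
    (\<forall>(n::nat) (N::nat) (d::nat) (r::nat) (m::nat \<Rightarrow> nat) (a::nat \<Rightarrow> nat)
      (\<epsilon>::real) (\<delta>::real) (\<sigma>::real) (X::real mat) (\<beta>::real Matrix.vec) (\<beta>0::real Matrix.vec)
      (\<nu>::(nat \<Rightarrow> real) measure) (\<tau>::(nat \<Rightarrow> nat set) pmf).
      N = 2 ^ n \<longrightarrow> (\<exists>k. m 1 = 2 ^ k) \<longrightarrow>
      1 \<le> d \<longrightarrow> d < m 1 \<longrightarrow> (\<forall>i\<in>{1..<K}. m (Suc i) = 2 * m i) \<longrightarrow> m K < N \<longrightarrow>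
      X \<in> carrier_mat N d \<longrightarrow> vec_space.rank N X = d \<longrightarrow>
      \<beta> \<in> carrier_vec d \<longrightarrow> \<beta>0 \<in> carrier_vec d \<longrightarrow>
      isotropic_noise N \<sigma> \<nu> \<longrightarrow> nested_index_law N K m \<tau> \<longrightarrow>
      0 < \<epsilon> \<longrightarrow> \<epsilon> < 1 / 9 \<longrightarrow> 0 < \<delta> \<longrightarrow> \<delta> < 1 \<longrightarrow> (\<forall>i\<in>{1..K}. a i \<ge> 1) \<longrightarrow>
      real r \<ge> c * (1 / \<epsilon>\<^sup>2) * (real d + ln (real N / \<delta>)) * ln (exp 1 * real d / \<delta>) \<longrightarrow>
      m 1 > r \<longrightarrow>
      measure_pmf.prob (sketch_law N r \<tau>)
        {(g, I, g', J).
          let S = (\<lambda>i. srht n (m i) g (I i));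
              S' = srht n r g' J;
              H = transpose_mat (S' * X) * (S' * X);
              \<theta> = (1 / 4 :: real)
          in invertible_mat H \<and>
             (\<forall>i\<in>{1..K}. vec_space.rank (m i) (S i * X) = d \<and>
                prediction_error \<nu> X \<beta> (\<lambda>Y. spcg_iterate S H X Y \<beta>0 a i (a i))
                \<le> \<theta> ^ a i * prediction_error \<nu> X \<beta> (\<lambda>Y. spcg_start S H X Y \<beta>0 a i)
                  + (1 + \<theta> ^ a i) * prediction_error \<nu> X \<beta> (\<lambda>Y. least_squares (S i * X) (S i *\<^sub>v Y)))}
      \<ge> 1 - 2 * \<delta>)"
proof (intro exI[of _ "43200000 * (real K)\<^sup>2"] conjI allI impI)
  show "0 < 43200000 * (real K)\<^sup>2" using assms by simp
  fix n N d r :: nat and m a :: "nat \<Rightarrow> nat" and \<epsilon> \<delta> \<sigma> :: real and X :: "real mat"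
    and \<beta> \<beta>0 :: "real Matrix.vec" and \<nu> :: "(nat \<Rightarrow> real) measure" and \<tau> :: "(nat \<Rightarrow> nat set) pmf"
  assume N: "N = 2 ^ n" and d: "1 \<le> d" and dbl: "\<forall>i\<in>{1..<K}. m (Suc i) = 2 * m i" and mK: "m K < N"
    and X: "X \<in> carrier_mat N d" and rk: "vec_space.rank N X = d"
    and \<beta>: "\<beta> \<in> carrier_vec d" and \<beta>0: "\<beta>0 \<in> carrier_vec d"
    and noise: "isotropic_noise N \<sigma> \<nu>" and nested: "nested_index_law N K m \<tau>"
    and \<epsilon>: "0 < \<epsilon>" "\<epsilon> < 1 / 9" and \<delta>: "0 < \<delta>" "\<delta> < 1" and a: "\<forall>i\<in>{1..K}. 1 \<le> a i"
    and r: "43200000 * (real K)\<^sup>2 * (1 / \<epsilon>\<^sup>2) * (real d + ln (real N / \<delta>)) * ln (exp 1 * real d / \<delta>) \<le> real r"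
    and rm: "r < m 1"
  have inj: "v = 0\<^sub>v d" if "v \<in> carrier_vec d" "X *\<^sub>v v = 0\<^sub>v N" for v
    using full_rank_iff_injective[OF X] rk that by blast
  define E where "E = {(g, I, g', J).
          let S = (\<lambda>i. srht n (m i) g (I i));
              S' = srht n r g' J;
              H = transpose_mat (S' * X) * (S' * X);
              \<theta> = (1 / 4 :: real)
          in invertible_mat H \<and>
             (\<forall>i\<in>{1..K}. vec_space.rank (m i) (S i * X) = d \<and>
                prediction_error \<nu> X \<beta> (\<lambda>Y. spcg_iterate S H X Y \<beta>0 a i (a i))
                \<le> \<theta> ^ a i * prediction_error \<nu> X \<beta> (\<lambda>Y. spcg_start S H X Y \<beta>0 a i)
                  + (1 + \<theta> ^ a i) * prediction_error \<nu> X \<beta> (\<lambda>Y. least_squares (S i * X) (S i *\<^sub>v Y)))}"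
  define Bi where "Bi i = {(g, I, g' :: sign_perm, J :: nat set). \<not> embeds (1 / 100) (srht n (m i) g (I i)) X}" for i
  define Br where "Br = {(g :: sign_perm, I :: nat \<Rightarrow> nat set, g', J). \<not> embeds (1 / 100) (srht n r g' J) X}"
  have sizes: "r \<le> m i" "m i \<le> N" if "i \<in> {1..K}" for i
    using nested_sizes[OF dbl that] rm mK by auto
  have rN: "r \<le> N" using sizes[of 1] assms by simp
  have size: "43200000 * (real K)\<^sup>2 * (real d + ln (real N / \<delta>)) * ln (exp 1 * real d / \<delta>) \<le> real r"
  proof -
    \<comment> \<open>As \<open>\<epsilon> < 1\<close>, the condition on \<open>r\<close> implies the one for the accuracy \<open>1 / 100\<close>.\<close>
    have "\<epsilon>\<^sup>2 \<le> 1" using \<epsilon> by (simp add: power_le_one)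
    then have e: "1 \<le> 1 / \<epsilon>\<^sup>2" using \<epsilon> by (simp add: le_divide_eq)
    have "0 \<le> ln (real N / \<delta>)" using \<delta> N by (intro ln_ge_zero) (simp add: le_divide_eq order_trans[OF less_imp_le])
    moreover have "0 \<le> ln (exp 1 * real d / \<delta>)"
    proof (intro ln_ge_zero)
      have "1 * 1 \<le> exp 1 * real d" using d by (intro mult_mono) auto
      then show "1 \<le> exp 1 * real d / \<delta>" using \<delta> by (simp add: le_divide_eq)
    qed
    ultimately have "0 \<le> 43200000 * (real K)\<^sup>2 * (real d + ln (real N / \<delta>)) * ln (exp 1 * real d / \<delta>)" by simp
    from mult_right_mono[OF e this] r show ?thesis by (simp add: mult_ac)
  qed
  have set_idx: "J \<subseteq> {..<N}" "card J = k" if "J \<in> set_pmf (index_law N k)" "k \<le> N" for J k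
  proof -
    have "finite {I. I \<subseteq> {..<N} \<and> card I = k}"
      by (rule finite_subset[of _ "Pow {..<N}"]) auto
    moreover have "{..<k} \<in> {I. I \<subseteq> {..<N} \<and> card I = k}" using that(2) by auto
    then have "{I. I \<subseteq> {..<N} \<and> card I = k} \<noteq> {}" by (metis empty_iff)
    ultimately show "J \<subseteq> {..<N}" "card J = k" using that(1) by (auto simp: index_law_def)
  qed
  have set_perm: "p permutes {..<N}" if "(s, p) \<in> set_pmf (sign_perm_law N)" for s p
  proof -
    have "finite {p. p permutes {..<N}}" by (rule finite_permutations) simp
    moreover have "{p. p permutes {..<N}} \<noteq> {}" using permutes_id by blast
    ultimately show ?thesis using that by (simp add: sign_perm_law_def)
  qed
  have car: "srht n k g J \<in> carrier_mat k N"
    if "g \<in> set_pmf (sign_perm_law N)" "J \<in> set_pmf (index_law N k)" "k \<le> N" for g J k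
  proof -
    obtain s p where g: "g = (s, p)" by (cases g)
    show ?thesis
      unfolding g N
      by (rule srht_quadratic_form(1)) (use set_idx[OF that(2,3)] set_perm[of s p] that(1) g N in auto)
  qed
  have good: "t \<in> E"
    if t: "t \<in> set_pmf (sketch_law N r \<tau>)" and nb: "t \<notin> Br" "\<And>i. i \<in> {1..K} \<Longrightarrow> t \<notin> Bi i" for t
  proof -
    obtain g I g' J where teq: "t = (g, I, g', J)" by (cases t)
    have sup: "g \<in> set_pmf (sign_perm_law N)" "I \<in> set_pmf \<tau>" "g' \<in> set_pmf (sign_perm_law N)"
      "J \<in> set_pmf (index_law N r)" using t by (auto simp: teq sketch_law_def)
    have Ii: "I i \<in> set_pmf (index_law N (m i))" if "i \<in> {1..K}" for i
    proof -
      have "map_pmf (\<lambda>I. I i) \<tau> = index_law N (m i)" using nested that by (simp add: nested_index_law_def)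
      then show ?thesis using sup(2) by (metis (no_types, lifting) imageI set_map_pmf)
    qed
    define S where "S i = srht n (m i) g (I i)" for i
    define S' where "S' = srht n r g' J"
    interpret embedded_design N d r X S'
      using X inj car[OF sup(3,4) rN] nb(1)
      by unfold_locales (auto simp: S'_def teq Br_def)
    have S: "S i \<in> carrier_mat (m i) N" "embeds (1 / 100) (S i) X" if "i \<in> {1..K}" for i
      using car[OF sup(1) Ii[OF that] sizes(2)[OF that]] nb(2)[OF that] by (auto simp: S_def teq Bi_def)
    have "vec_space.rank (m i) (S i * X) = d" if "i \<in> {1..K}" for i
      by (rule full_rank_sketch[OF S[OF that]])
    moreover have "prediction_error \<nu> X \<beta> (\<lambda>Y. spcg_iterate S H X Y \<beta>0 a i (a i))
        \<le> (1 / 4) ^ a i * prediction_error \<nu> X \<beta> (\<lambda>Y. spcg_start S H X Y \<beta>0 a i)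
          + (1 + (1 / 4) ^ a i) * prediction_error \<nu> X \<beta> (\<lambda>Y. least_squares (S i * X) (S i *\<^sub>v Y))"
      if "i \<in> {1..K}" for i
      by (rule spcg_prediction_errors[OF noise \<beta> \<beta>0 _ _ _ that]) (use S a in auto)
    ultimately show ?thesis
      unfolding teq E_def Let_def prod.case mem_Collect_eq S_def[symmetric] S'_def[symmetric] H_def[symmetric]
      using invertible_H by (intro conjI ballI)
  qed
  have pBi: "measure_pmf.prob (sketch_law N r \<tau>) (Bi i) \<le> \<delta> / real K" if i: "i \<in> {1..K}" for i
  proof -
    have "map_pmf (\<lambda>(g, I, s). (g, I i)) (sketch_law N r \<tau>) = pair_pmf (sign_perm_law N) (index_law N (m i))"
      unfolding sketch_law_def pair_pmf_marginal using nested i by (simp add: nested_index_law_def)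
    then have "measure_pmf.prob (pair_pmf (sign_perm_law N) (index_law N (m i)))
        {(g, I). \<not> embeds (1 / 100) (srht n (m i) g I) X}
      = measure_pmf.prob (map_pmf (\<lambda>(g, I, s). (g, I i)) (sketch_law N r \<tau>))
        {(g, I). \<not> embeds (1 / 100) (srht n (m i) g I) X}" by simp
    also have "\<dots> = measure_pmf.prob (sketch_law N r \<tau>) (Bi i)"
      by (simp add: Bi_def vimage_def case_prod_unfold del: srht.simps)
    finally show ?thesis
      using srht_embedding_prob[of K d X n "m i" \<delta>] assms d X inj sizes[OF i] \<delta> size by (simp add: N)
  qed
  have pBr: "measure_pmf.prob (sketch_law N r \<tau>) Br \<le> \<delta>"
  proof -
    have "map_pmf (snd \<circ> snd) (sketch_law N r \<tau>) = pair_pmf (sign_perm_law N) (index_law N r)"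
      by (simp add: sketch_law_def pmf.map_comp[symmetric] map_snd_pair_pmf)
    then have "measure_pmf.prob (pair_pmf (sign_perm_law N) (index_law N r))
        {(g, I). \<not> embeds (1 / 100) (srht n r g I) X}
      = measure_pmf.prob (map_pmf (snd \<circ> snd) (sketch_law N r \<tau>))
        {(g, I). \<not> embeds (1 / 100) (srht n r g I) X}" by simp
    also have "\<dots> = measure_pmf.prob (sketch_law N r \<tau>) Br"
      by (simp add: Br_def vimage_def case_prod_unfold del: srht.simps)
    finally have "measure_pmf.prob (sketch_law N r \<tau>) Br \<le> \<delta> / real K"
      using srht_embedding_prob[of K d X n r \<delta>] assms d X inj rN \<delta> size by (simp add: N)
    also have "\<dots> \<le> \<delta>" using assms \<delta> by (simp add: divide_le_eq mult_le_cancel_left1)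
    finally show ?thesis .
  qed
  have "measure_pmf.prob (sketch_law N r \<tau>) (- E)
      \<le> measure_pmf.prob (sketch_law N r \<tau>) (Br \<union> (\<Union>i\<in>{1..K}. Bi i))"
    by (rule prob_pmf_mono) (use good in blast)
  also have "\<dots> \<le> measure_pmf.prob (sketch_law N r \<tau>) Br
      + measure_pmf.prob (sketch_law N r \<tau>) (\<Union>i\<in>{1..K}. Bi i)"
    by (rule measure_Un_le) auto
  also have "measure_pmf.prob (sketch_law N r \<tau>) (\<Union>i\<in>{1..K}. Bi i)
      \<le> (\<Sum>i\<in>{1..K}. measure_pmf.prob (sketch_law N r \<tau>) (Bi i))"
    by (rule measure_UNION_le) auto
  also have "\<dots> \<le> (\<Sum>i\<in>{1..K}. \<delta> / real K)" by (intro sum_mono pBi)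
  also have "\<dots> = \<delta>" using assms by simp
  finally have "measure_pmf.prob (sketch_law N r \<tau>) (- E) \<le> 2 * \<delta>" using pBr by simp
  moreover have "measure_pmf.prob (sketch_law N r \<tau>) E = 1 - measure_pmf.prob (sketch_law N r \<tau>) (- E)"
    using measure_pmf.prob_compl[of E "sketch_law N r \<tau>"] by (simp add: Compl_eq_Diff_UNIV)
  ultimately have "1 - 2 * \<delta> \<le> measure_pmf.prob (sketch_law N r \<tau>) E" by simp
  then show "1 - 2 * \<delta> \<le> measure_pmf.prob (sketch_law N r \<tau>)
        {(g, I, g', J).
          let S = (\<lambda>i. srht n (m i) g (I i));
              S' = srht n r g' J;
              H = transpose_mat (S' * X) * (S' * X);
              \<theta> = (1 / 4 :: real)
          in invertible_mat H \<and>
             (\<forall>i\<in>{1..K}. vec_space.rank (m i) (S i * X) = d \<and>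
                prediction_error \<nu> X \<beta> (\<lambda>Y. spcg_iterate S H X Y \<beta>0 a i (a i))
                \<le> \<theta> ^ a i * prediction_error \<nu> X \<beta> (\<lambda>Y. spcg_start S H X Y \<beta>0 a i)
                  + (1 + \<theta> ^ a i) * prediction_error \<nu> X \<beta> (\<lambda>Y. least_squares (S i * X) (S i *\<^sub>v Y)))}"
    by (simp only: E_def)
qed

end
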